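(* Let $V$ be a finite-dimensional complex representation of a complex reductive group $G$ with $\mathbb{C}(V)^G=\operatorname{Frac}(\mathbb{C}[V]^G)$, and let $K=\overline{\mathbb{C}(V)^G}$. Let $Y$ be an extension subvariety of $V$. Then there is a natural bijection between the set \[A=\{\text{closed points }p\in\mathcal{M} : Y_p=Y\}\] and the set \[B=\{\text{field embeddings }\sigma:\mathbb{C}(Y)\to K : \sigma|_{\mathbb{C}(V)^G}=\operatorname{Id}_{\mathbb{C}(V)^G}\}.\]
   Context: $K$ is an algebraic closure of $\mathbb{C}(V)^G$. The extension parameter scheme is the $K$-scheme $\mathcal{M}=\operatorname{Spec}(\mathbb{C}[V]\otimes_{\mathbb{C}[V]^G}K)$, a closed subscheme of $\operatorname{Spec}(\mathbb{C}[V]\otimes_{\mathbb{C}}K)$. For a closed point $p\in\mathcal{M}$ with corresponding maximal ideal $\mathfrak{m}\subset\mathbb{C}[V]\otimes_{\mathbb{C}}K$, the extension subvariety $Y_p\subset V$ is the irreducible closed subvariety defined by the prime ideal $\mathfrak{m}\cap\mathbb{C}[V]$ (preimage of $\mathfrak m$ under $f\mapsto f\otimes1$), so $\mathbb{C}[Y_p]=\mathbb{C}[V]/(\mathfrak{m}\cap\mathbb{C}[V])$. An extension subvariety of $V$ is a subvariety of the form $Y_p$. The residue field at $p$ is $K$, so $f\mapsto f\otimes1$ induces an injection $\mathbb{C}[Y_p]\to(\mathbb{C}[V]\otimes_{\mathbb{C}}K)/\mathfrak{m}\cong K$ (the isomorphism being the unique one over $K$) and hence a field embedding $\mathbb{C}(Y_p)\to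 K$; the natural bijection sends $p\in A$ to this embedding. For an extension subvariety $Y$, restriction of functions embeds $\mathbb{C}(V)^G$ into $\mathbb{C}(Y)$, and $\mathbb{C}(V)^G$ is regarded as a subfield of $\mathbb{C}(Y)$ in this way. *)

theory Defs
  imports
    "HOL-Analysis.Determinants"
    "HOL-Library.Poly_Mapping"
    "HOL-Algebra.QuotRing"
    "HOL-Algebra.Algebraic_Closure_Type"
begin

section \<open>Complex reductive groups\<close>

text \<open>The algebra of functions generated by the constants and a given set of functions.\<close>

inductive_set poly_funs :: "('x \<Rightarrow> complex) set \<Rightarrow> ('x \<Rightarrow> complex) set"
  for L :: "('x \<Rightarrow> complex) set" where
  const: "(\<lambda>_. c) \<in> poly_funs L"
| gen: "f \<in> L \<Longrightarrow> f \<in> poly_funs L"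
| add: "f \<in> poly_funs L \<Longrightarrow> g \<in> poly_funs L \<Longrightarrow> (\<lambda>x. f x + g x) \<in> poly_funs L"
| mult: "f \<in> poly_funs L \<Longrightarrow> g \<in> poly_funs L \<Longrightarrow> (\<lambda>x. f x * g x) \<in> poly_funs L"

definition GL :: "(complex^'m^'m) monoid" where
  "GL = \<lparr>carrier = {A. invertible A}, monoid.mult = (**), one = mat 1\<rparr>"

definition matrix_polys :: "(complex^'m^'m \<Rightarrow> complex) set" where
  "matrix_polys = poly_funs {\<lambda>A. A $ i $ j | i j. True}"

text \<open>Since \<open>det\<close> is invertible on \<open>GL\<close>, the regular functions \<open>p / det ^ k\<close> cut out the same
  closed subsets as the polynomials \<open>p\<close>.\<close>

definition zariski_closed :: "(complex^'m^'m) set \<Rightarrow> bool" where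
  "zariski_closed S \<longleftrightarrow>
     (\<exists>F \<subseteq> matrix_polys. S = {A \<in> carrier GL. \<forall>f\<in>F. f A = 0})"

definition zariski_connected :: "(complex^'m^'m) set \<Rightarrow> bool" where
  "zariski_connected U \<longleftrightarrow>
     \<not> (\<exists>S T. zariski_closed S \<and> zariski_closed T \<and> U \<subseteq> S \<union> T \<and>
          U \<inter> S \<inter> T = {} \<and> U \<inter> S \<noteq> {} \<and> U \<inter> T \<noteq> {})"

definition unipotent :: "complex^'m^'m \<Rightarrow> bool" where
  "unipotent A \<longleftrightarrow> (\<exists>k. (((**) (A - mat 1)) ^^ k) (mat 1) = 0)"

text \<open>A linear algebraic group is a Zariski closed subgroup of some \<open>GL\<close>, not necessarily connected.
  It is reductive if its unipotent radical, the largest connected normal unipotent closed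
  subgroup, is trivial.\<close>

definition linear_algebraic_group :: "(complex^'m^'m) set \<Rightarrow> bool" where
  "linear_algebraic_group G \<longleftrightarrow> subgroup G GL \<and> zariski_closed G"

definition reductive_group :: "(complex^'m^'m) set \<Rightarrow> bool" where
  "reductive_group G \<longleftrightarrow> linear_algebraic_group G \<and>
     (\<forall>U. U \<lhd> GL\<lparr>carrier := G\<rparr> \<and> zariski_closed U \<and> zariski_connected U \<and>
          (\<forall>A\<in>U. unipotent A) \<longrightarrow> U = {mat 1})"


section \<open>Representations and invariants\<close>

definition linear_functionals :: "(complex \<Rightarrow> 'v \<Rightarrow> 'v) \<Rightarrow> ('v::ab_group_add \<Rightarrow> complex) set" where
  "linear_functionals scl = {\<phi>. Vector_Spaces.linear scl (*) \<phi>}"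

definition GL_space :: "(complex \<Rightarrow> 'v \<Rightarrow> 'v) \<Rightarrow> ('v::ab_group_add \<Rightarrow> 'v) monoid" where
  "GL_space scl =
     \<lparr>carrier = {T. Vector_Spaces.linear scl scl T \<and> bij T}, monoid.mult = (\<circ>), one = id\<rparr>"

text \<open>Representations of algebraic groups are morphisms of varieties: the matrix coefficients are
  regular functions on \<open>G\<close>.\<close>

definition regular_on :: "(complex^'m^'m) set \<Rightarrow> (complex^'m^'m \<Rightarrow> complex) \<Rightarrow> bool" where
  "regular_on G F \<longleftrightarrow> (\<exists>p\<in>matrix_polys. \<exists>k. \<forall>g\<in>G. F g = p g / det g ^ k)"

definition rational_representation ::
  "(complex \<Rightarrow> 'v \<Rightarrow> 'v) \<Rightarrow> (complex^'m^'m) set \<Rightarrow> (complex^'m^'m \<Rightarrow> 'v::ab_group_add \<Rightarrow> 'v) \<Rightarrow> bool"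
  where "rational_representation scl G \<rho> \<longleftrightarrow>
     \<rho> \<in> hom (GL\<lparr>carrier := G\<rparr>) (GL_space scl) \<and>
     (\<forall>\<phi>\<in>linear_functionals scl. \<forall>v. regular_on G (\<lambda>g. \<phi> (\<rho> g v)))"

text \<open>\<open>\<complex>[V]\<close>, as polynomial functions on \<open>V\<close>.\<close>

definition coord_ring :: "(complex \<Rightarrow> 'v \<Rightarrow> 'v) \<Rightarrow> ('v::ab_group_add \<Rightarrow> complex) ring" where
  "coord_ring scl =
     \<lparr>carrier = poly_funs (linear_functionals scl),
      monoid.mult = (\<lambda>f g v. f v * g v), one = (\<lambda>_. 1),
      ring.zero = (\<lambda>_. 0), add = (\<lambda>f g v. f v + g v)\<rparr>"

definition act ::
  "(complex^'m^'m \<Rightarrow> 'v \<Rightarrow> 'v) \<Rightarrow> complex^'m^'m \<Rightarrow> ('v \<Rightarrow> complex) \<Rightarrow> 'v \<Rightarrow> complex" where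
  "act \<rho> g f = (\<lambda>v. f (\<rho> (inv\<^bsub>GL\<^esub> g) v))"

definition inv_ring ::
  "(complex \<Rightarrow> 'v \<Rightarrow> 'v) \<Rightarrow> (complex^'m^'m) set \<Rightarrow> (complex^'m^'m \<Rightarrow> 'v \<Rightarrow> 'v) \<Rightarrow>
     ('v::ab_group_add \<Rightarrow> complex) ring" where
  "inv_ring scl G \<rho> =
     (coord_ring scl)\<lparr>carrier := {f \<in> carrier (coord_ring scl). \<forall>g\<in>G. act \<rho> g f = f}\<rparr>"


section \<open>Fields of fractions\<close>

definition frac_rel :: "('a, 'm) ring_scheme \<Rightarrow> (('a \<times> 'a) \<times> ('a \<times> 'a)) set" where
  "frac_rel R = {((a, b), (c, d)).
     a \<in> carrier R \<and> c \<in> carrier R \<and>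
     b \<in> carrier R - {\<zero>\<^bsub>R\<^esub>} \<and> d \<in> carrier R - {\<zero>\<^bsub>R\<^esub>} \<and>
     a \<otimes>\<^bsub>R\<^esub> d = c \<otimes>\<^bsub>R\<^esub> b}"

definition fraction :: "('a, 'm) ring_scheme \<Rightarrow> 'a \<Rightarrow> 'a \<Rightarrow> ('a \<times> 'a) set" where
  "fraction R a b = frac_rel R `` {(a, b)}"

definition frac_field :: "('a, 'm) ring_scheme \<Rightarrow> ('a \<times> 'a) set ring" where
  "frac_field R =
     \<lparr>carrier = (carrier R \<times> (carrier R - {\<zero>\<^bsub>R\<^esub>})) // frac_rel R,
      monoid.mult = (\<lambda>Z Y. \<Union>(a, b)\<in>Z. \<Union>(c, d)\<in>Y. fraction R (a \<otimes>\<^bsub>R\<^esub> c) (b \<otimes>\<^bsub>R\<^esub> d)),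
      one = fraction R \<one>\<^bsub>R\<^esub> \<one>\<^bsub>R\<^esub>,
      ring.zero = fraction R \<zero>\<^bsub>R\<^esub> \<one>\<^bsub>R\<^esub>,
      add = (\<lambda>Z Y. \<Union>(a, b)\<in>Z. \<Union>(c, d)\<in>Y.
               fraction R (a \<otimes>\<^bsub>R\<^esub> d \<oplus>\<^bsub>R\<^esub> c \<otimes>\<^bsub>R\<^esub> b) (b \<otimes>\<^bsub>R\<^esub> d))\<rparr>"

text \<open>The extension of an injective homomorphism \<open>j\<close> from a domain to a field \<open>K\<close>
  to the field of fractions of the domain.\<close>

definition frac_lift :: "('k, 'm) ring_scheme \<Rightarrow> ('a \<Rightarrow> 'k) \<Rightarrow> ('a \<times> 'a) set \<Rightarrow> 'k" where
  "frac_lift K j Z = the_elem ((\<lambda>(a, b). j a \<otimes>\<^bsub>K\<^esub> inv\<^bsub>K\<^esub> j b) ` Z)"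

text \<open>\<open>\<complex>(V)\<^sup>G\<close>; the image of a class \<open>a / b\<close> under \<open>g\<close> is the class of \<open>ga / gb\<close>.\<close>

definition inv_field ::
  "(complex \<Rightarrow> 'v \<Rightarrow> 'v) \<Rightarrow> (complex^'m^'m) set \<Rightarrow> (complex^'m^'m \<Rightarrow> 'v \<Rightarrow> 'v) \<Rightarrow>
     (('v::ab_group_add \<Rightarrow> complex) \<times> ('v \<Rightarrow> complex)) set ring" where
  "inv_field scl G \<rho> =
     (frac_field (coord_ring scl))\<lparr>carrier :=
        {Z \<in> carrier (frac_field (coord_ring scl)).
           \<forall>g\<in>G. map_prod (act \<rho> g) (act \<rho> g) ` Z = Z}\<rparr>"


section \<open>Tensor products of commutative algebras\<close>

text \<open>For commutative rings \<open>A\<close> and \<open>B\<close>, \<open>tensor_free A B\<close> is the free abelian group on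
  \<open>A \<times> B\<close> with multiplication \<open>(a, b) (a', b') = (a a', b b')\<close>.  The tensor product over \<open>R\<close>, with
  respect to structure maps \<open>\<phi> : R \<rightarrow> A\<close> and \<open>\<psi> : R \<rightarrow> B\<close>, is its quotient by the usual
  bilinearity relations.  The subgroup they generate is an ideal.\<close>

definition tensor_free :: "('a, 'm) ring_scheme \<Rightarrow> ('b, 'n) ring_scheme \<Rightarrow> ('a \<times> 'b \<Rightarrow>\<^sub>0 int) ring"
  where "tensor_free A B =
     \<lparr>carrier = {x. Poly_Mapping.keys x \<subseteq> carrier A \<times> carrier B},
      monoid.mult = (\<lambda>x y. frag_extend (\<lambda>(a, b).
         frag_extend (\<lambda>(a', b'). frag_of (a \<otimes>\<^bsub>A\<^esub> a', b \<otimes>\<^bsub>B\<^esub> b')) y) x),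
      one = frag_of (\<one>\<^bsub>A\<^esub>, \<one>\<^bsub>B\<^esub>), ring.zero = 0, add = (+)\<rparr>"

definition tensor_relations ::
  "('r, 'l) ring_scheme \<Rightarrow> ('r \<Rightarrow> 'a) \<Rightarrow> ('r \<Rightarrow> 'b) \<Rightarrow>
     ('a, 'm) ring_scheme \<Rightarrow> ('b, 'n) ring_scheme \<Rightarrow> ('a \<times> 'b \<Rightarrow>\<^sub>0 int) set" where
  "tensor_relations R \<phi> \<psi> A B =
     {frag_of (a \<oplus>\<^bsub>A\<^esub> a', b) - frag_of (a, b) - frag_of (a', b) | a a' b.
        a \<in> carrier A \<and> a' \<in> carrier A \<and> b \<in> carrier B} \<union>
     {frag_of (a, b \<oplus>\<^bsub>B\<^esub> b') - frag_of (a, b) - frag_of (a, b') | a b b'.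
        a \<in> carrier A \<and> b \<in> carrier B \<and> b' \<in> carrier B} \<union>
     {frag_of (\<phi> r \<otimes>\<^bsub>A\<^esub> a, b) - frag_of (a, \<psi> r \<otimes>\<^bsub>B\<^esub> b) | r a b.
        r \<in> carrier R \<and> a \<in> carrier A \<and> b \<in> carrier B}"

definition tensor_ideal ::
  "('r, 'l) ring_scheme \<Rightarrow> ('r \<Rightarrow> 'a) \<Rightarrow> ('r \<Rightarrow> 'b) \<Rightarrow>
     ('a, 'm) ring_scheme \<Rightarrow> ('b, 'n) ring_scheme \<Rightarrow> ('a \<times> 'b \<Rightarrow>\<^sub>0 int) set" where
  "tensor_ideal R \<phi> \<psi> A B = genideal (tensor_free A B) (tensor_relations R \<phi> \<psi> A B)"

definition tensor ::
  "('r, 'l) ring_scheme \<Rightarrow> ('r \<Rightarrow> 'a) \<Rightarrow> ('r \<Rightarrow> 'b) \<Rightarrow>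
     ('a, 'm) ring_scheme \<Rightarrow> ('b, 'n) ring_scheme \<Rightarrow> ('a \<times> 'b \<Rightarrow>\<^sub>0 int) set ring" where
  "tensor R \<phi> \<psi> A B = tensor_free A B Quot tensor_ideal R \<phi> \<psi> A B"

definition pure_tensor ::
  "('r, 'l) ring_scheme \<Rightarrow> ('r \<Rightarrow> 'a) \<Rightarrow> ('r \<Rightarrow> 'b) \<Rightarrow>
     ('a, 'm) ring_scheme \<Rightarrow> ('b, 'n) ring_scheme \<Rightarrow> 'a \<Rightarrow> 'b \<Rightarrow> ('a \<times> 'b \<Rightarrow>\<^sub>0 int) set" where
  "pure_tensor R \<phi> \<psi> A B a b = tensor_ideal R \<phi> \<psi> A B +>\<^bsub>tensor_free A B\<^esub> frag_of (a, b)"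


section \<open>The extension parameter scheme\<close>

text \<open>Throughout, \<open>\<iota> : \<complex>(V)\<^sup>G \<rightarrow> K\<close> is the inclusion of \<open>\<complex>(V)\<^sup>G\<close> into its algebraic closure.\<close>

type_synonym 'v rat_fun = "(('v \<Rightarrow> complex) \<times> ('v \<Rightarrow> complex)) set"

definition inv_to_K ::
  "(complex \<Rightarrow> 'v \<Rightarrow> 'v) \<Rightarrow> ('v::ab_group_add rat_fun \<Rightarrow> 'k) \<Rightarrow> ('v \<Rightarrow> complex) \<Rightarrow> 'k" where
  "inv_to_K scl \<iota> f = \<iota> (fraction (coord_ring scl) f (\<lambda>_. 1))"

definition complex_to_K ::
  "(complex \<Rightarrow> 'v \<Rightarrow> 'v) \<Rightarrow> ('v::ab_group_add rat_fun \<Rightarrow> 'k) \<Rightarrow> complex \<Rightarrow> 'k" where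
  "complex_to_K scl \<iota> c = inv_to_K scl \<iota> (\<lambda>_. c)"

text \<open>\<open>param_ring\<close> is \<open>\<complex>[V] \<otimes> K\<close> over \<open>\<complex>[V]\<^sup>G\<close>, and \<open>ambient_ring\<close> is \<open>\<complex>[V] \<otimes> K\<close> over \<open>\<complex>\<close>.\<close>

definition param_ring ::
  "(complex \<Rightarrow> 'v \<Rightarrow> 'v) \<Rightarrow> (complex^'m^'m) set \<Rightarrow> (complex^'m^'m \<Rightarrow> 'v \<Rightarrow> 'v) \<Rightarrow>
     'k ring \<Rightarrow> ('v::ab_group_add rat_fun \<Rightarrow> 'k) \<Rightarrow> (('v \<Rightarrow> complex) \<times> 'k \<Rightarrow>\<^sub>0 int) set ring" where
  "param_ring scl G \<rho> K \<iota> =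
     tensor (inv_ring scl G \<rho>) (\<lambda>f. f) (inv_to_K scl \<iota>) (coord_ring scl) K"

definition ambient_ring ::
  "(complex \<Rightarrow> 'v \<Rightarrow> 'v) \<Rightarrow> 'k ring \<Rightarrow> ('v::ab_group_add rat_fun \<Rightarrow> 'k) \<Rightarrow>
     (('v \<Rightarrow> complex) \<times> 'k \<Rightarrow>\<^sub>0 int) set ring" where
  "ambient_ring scl K \<iota> =
     tensor (ring_of_type_algebra :: complex ring) (\<lambda>c _. c) (complex_to_K scl \<iota>)
       (coord_ring scl) K"

definition ambient_pure ::
  "(complex \<Rightarrow> 'v \<Rightarrow> 'v) \<Rightarrow> 'k ring \<Rightarrow> ('v::ab_group_add rat_fun \<Rightarrow> 'k) \<Rightarrow>
     ('v \<Rightarrow> complex) \<Rightarrow> 'k \<Rightarrow> (('v \<Rightarrow> complex) \<times> 'k \<Rightarrow>\<^sub>0 int) set" where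
  "ambient_pure scl K \<iota> =
     pure_tensor (ring_of_type_algebra :: complex ring) (\<lambda>c _. c) (complex_to_K scl \<iota>)
       (coord_ring scl) K"

text \<open>Both rings are quotients of the same free ring, and the ideal defining \<open>ambient_ring\<close> is
  contained in the one defining \<open>param_ring\<close>.  The canonical surjection \<open>ambient_ring \<rightarrow> param_ring\<close>
  thus sends a coset to the larger coset containing it.\<close>

definition ambient_to_param ::
  "(complex \<Rightarrow> 'v \<Rightarrow> 'v) \<Rightarrow> (complex^'m^'m) set \<Rightarrow> (complex^'m^'m \<Rightarrow> 'v \<Rightarrow> 'v) \<Rightarrow>
     'k ring \<Rightarrow> ('v::ab_group_add rat_fun \<Rightarrow> 'k) \<Rightarrow>
     (('v \<Rightarrow> complex) \<times> 'k \<Rightarrow>\<^sub>0 int) set \<Rightarrow> (('v \<Rightarrow> complex) \<times> 'k \<Rightarrow>\<^sub>0 int) set" where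
  "ambient_to_param scl G \<rho> K \<iota> Z =
     (\<Union>x\<in>Z. tensor_ideal (inv_ring scl G \<rho>) (\<lambda>f. f) (inv_to_K scl \<iota>) (coord_ring scl) K
              +>\<^bsub>tensor_free (coord_ring scl) K\<^esub> x)"

definition closed_point ::
  "(complex \<Rightarrow> 'v \<Rightarrow> 'v) \<Rightarrow> (complex^'m^'m) set \<Rightarrow> (complex^'m^'m \<Rightarrow> 'v \<Rightarrow> 'v) \<Rightarrow>
     'k ring \<Rightarrow> ('v::ab_group_add rat_fun \<Rightarrow> 'k) \<Rightarrow>
     (('v \<Rightarrow> complex) \<times> 'k \<Rightarrow>\<^sub>0 int) set set \<Rightarrow> bool" where
  "closed_point scl G \<rho> K \<iota> p \<longleftrightarrow> maximalideal p (param_ring scl G \<rho> K \<iota>)"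

definition point_ideal ::
  "(complex \<Rightarrow> 'v \<Rightarrow> 'v) \<Rightarrow> (complex^'m^'m) set \<Rightarrow> (complex^'m^'m \<Rightarrow> 'v \<Rightarrow> 'v) \<Rightarrow>
     'k ring \<Rightarrow> ('v::ab_group_add rat_fun \<Rightarrow> 'k) \<Rightarrow>
     (('v \<Rightarrow> complex) \<times> 'k \<Rightarrow>\<^sub>0 int) set set \<Rightarrow> (('v \<Rightarrow> complex) \<times> 'k \<Rightarrow>\<^sub>0 int) set set" where
  "point_ideal scl G \<rho> K \<iota> p =
     {Z \<in> carrier (ambient_ring scl K \<iota>). ambient_to_param scl G \<rho> K \<iota> Z \<in> p}"

definition point_prime ::
  "(complex \<Rightarrow> 'v \<Rightarrow> 'v) \<Rightarrow> (complex^'m^'m) set \<Rightarrow> (complex^'m^'m \<Rightarrow> 'v \<Rightarrow> 'v) \<Rightarrow>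
     'k ring \<Rightarrow> ('v::ab_group_add rat_fun \<Rightarrow> 'k) \<Rightarrow>
     (('v \<Rightarrow> complex) \<times> 'k \<Rightarrow>\<^sub>0 int) set set \<Rightarrow> ('v \<Rightarrow> complex) set" where
  "point_prime scl G \<rho> K \<iota> p =
     {f \<in> carrier (coord_ring scl). ambient_pure scl K \<iota> f \<one>\<^bsub>K\<^esub> \<in> point_ideal scl G \<rho> K \<iota> p}"

definition point_subvariety ::
  "(complex \<Rightarrow> 'v \<Rightarrow> 'v) \<Rightarrow> (complex^'m^'m) set \<Rightarrow> (complex^'m^'m \<Rightarrow> 'v \<Rightarrow> 'v) \<Rightarrow>
     'k ring \<Rightarrow> ('v::ab_group_add rat_fun \<Rightarrow> 'k) \<Rightarrow>
     (('v \<Rightarrow> complex) \<times> 'k \<Rightarrow>\<^sub>0 int) set set \<Rightarrow> 'v set" where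
  "point_subvariety scl G \<rho> K \<iota> p = {v. \<forall>f\<in>point_prime scl G \<rho> K \<iota> p. f v = 0}"

definition extension_subvariety ::
  "(complex \<Rightarrow> 'v \<Rightarrow> 'v) \<Rightarrow> (complex^'m^'m) set \<Rightarrow> (complex^'m^'m \<Rightarrow> 'v \<Rightarrow> 'v) \<Rightarrow>
     'k ring \<Rightarrow> ('v::ab_group_add rat_fun \<Rightarrow> 'k) \<Rightarrow> 'v set \<Rightarrow> bool" where
  "extension_subvariety scl G \<rho> K \<iota> Y \<longleftrightarrow>
     (\<exists>p. closed_point scl G \<rho> K \<iota> p \<and> Y = point_subvariety scl G \<rho> K \<iota> p)"


section \<open>Functions on a subvariety\<close>

text \<open>For \<open>Y = point_subvariety p\<close> the vanishing ideal is \<open>point_prime p\<close>, by the Nullstellensatz.\<close>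

definition vanishing_ideal ::
  "(complex \<Rightarrow> 'v \<Rightarrow> 'v) \<Rightarrow> 'v::ab_group_add set \<Rightarrow> ('v \<Rightarrow> complex) set" where
  "vanishing_ideal scl Y = {f \<in> carrier (coord_ring scl). \<forall>v\<in>Y. f v = 0}"

definition subvariety_ring ::
  "(complex \<Rightarrow> 'v \<Rightarrow> 'v) \<Rightarrow> 'v::ab_group_add set \<Rightarrow> ('v \<Rightarrow> complex) set ring" where
  "subvariety_ring scl Y = coord_ring scl Quot vanishing_ideal scl Y"

definition function_field ::
  "(complex \<Rightarrow> 'v \<Rightarrow> 'v) \<Rightarrow> 'v::ab_group_add set \<Rightarrow> (('v \<Rightarrow> complex) set \<times> ('v \<Rightarrow> complex) set) set ring"
  where "function_field scl Y = frac_field (subvariety_ring scl Y)"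

text \<open>Restriction to \<open>Y\<close> of a rational function on \<open>V\<close>, computed from any representative \<open>a / b\<close>
  whose denominator does not vanish identically on \<open>Y\<close>.\<close>

definition restrict_rat ::
  "(complex \<Rightarrow> 'v \<Rightarrow> 'v) \<Rightarrow> 'v::ab_group_add set \<Rightarrow> 'v rat_fun \<Rightarrow>
     (('v \<Rightarrow> complex) set \<times> ('v \<Rightarrow> complex) set) set" where
  "restrict_rat scl Y Z =
     (\<Union>(a, b)\<in>{(a, b) \<in> Z. b \<notin> vanishing_ideal scl Y}.
        fraction (subvariety_ring scl Y)
          (vanishing_ideal scl Y +>\<^bsub>coord_ring scl\<^esub> a)
          (vanishing_ideal scl Y +>\<^bsub>coord_ring scl\<^esub> b))"

text \<open>The field embeddings \<open>\<complex>(Y) \<rightarrow> K\<close> that are the identity on \<open>\<complex>(V)\<^sup>G\<close>.  Extensionality makes them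
  functions on the carrier of \<open>\<complex>(Y)\<close> only.\<close>

definition K_embeddings ::
  "(complex \<Rightarrow> 'v \<Rightarrow> 'v) \<Rightarrow> (complex^'m^'m) set \<Rightarrow> (complex^'m^'m \<Rightarrow> 'v \<Rightarrow> 'v) \<Rightarrow>
     'k ring \<Rightarrow> ('v::ab_group_add rat_fun \<Rightarrow> 'k) \<Rightarrow> 'v set \<Rightarrow>
     ((('v \<Rightarrow> complex) set \<times> ('v \<Rightarrow> complex) set) set \<Rightarrow> 'k) set" where
  "K_embeddings scl G \<rho> K \<iota> Y =
     {\<sigma> \<in> ring_hom (function_field scl Y) K \<inter> extensional (carrier (function_field scl Y)).
        inj_on \<sigma> (carrier (function_field scl Y)) \<and>
        (\<forall>Z\<in>carrier (inv_field scl G \<rho>). \<sigma> (restrict_rat scl Y Z) = \<iota> Z)}"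


section \<open>The natural map from closed points to embeddings\<close>

text \<open>\<open>residue_value\<close> is the composite of \<open>ambient_ring \<rightarrow> ambient_ring / \<mm>\<close> with the inverse of
  the isomorphism \<open>K \<rightarrow> ambient_ring / \<mm>\<close>, \<open>k \<mapsto> 1 \<otimes> k\<close>.\<close>

definition residue_value ::
  "(complex \<Rightarrow> 'v \<Rightarrow> 'v) \<Rightarrow> 'k ring \<Rightarrow> ('v::ab_group_add rat_fun \<Rightarrow> 'k) \<Rightarrow>
     (('v \<Rightarrow> complex) \<times> 'k \<Rightarrow>\<^sub>0 int) set set \<Rightarrow> (('v \<Rightarrow> complex) \<times> 'k \<Rightarrow>\<^sub>0 int) set \<Rightarrow> 'k" where
  "residue_value scl K \<iota> \<mm> Z =
     the_inv_into (carrier K)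
       (\<lambda>k. \<mm> +>\<^bsub>ambient_ring scl K \<iota>\<^esub> ambient_pure scl K \<iota> \<one>\<^bsub>coord_ring scl\<^esub> k)
       (\<mm> +>\<^bsub>ambient_ring scl K \<iota>\<^esub> Z)"

text \<open>The map \<open>\<complex>[Y] \<rightarrow> K\<close> induced by \<open>f \<mapsto> f \<otimes> 1\<close>.  The argument is a coset of polynomials, and
  the value is the same for all \<open>f\<close> in it when \<open>p\<close> lies over \<open>Y\<close>.\<close>

definition coord_embedding ::
  "(complex \<Rightarrow> 'v \<Rightarrow> 'v) \<Rightarrow> (complex^'m^'m) set \<Rightarrow> (complex^'m^'m \<Rightarrow> 'v \<Rightarrow> 'v) \<Rightarrow>
     'k ring \<Rightarrow> ('v::ab_group_add rat_fun \<Rightarrow> 'k) \<Rightarrow>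
     (('v \<Rightarrow> complex) \<times> 'k \<Rightarrow>\<^sub>0 int) set set \<Rightarrow> ('v \<Rightarrow> complex) set \<Rightarrow> 'k" where
  "coord_embedding scl G \<rho> K \<iota> p F =
     the_elem ((\<lambda>f. residue_value scl K \<iota> (point_ideal scl G \<rho> K \<iota> p)
                      (ambient_pure scl K \<iota> f \<one>\<^bsub>K\<^esub>)) ` F)"

definition natural_embedding ::
  "(complex \<Rightarrow> 'v \<Rightarrow> 'v) \<Rightarrow> (complex^'m^'m) set \<Rightarrow> (complex^'m^'m \<Rightarrow> 'v \<Rightarrow> 'v) \<Rightarrow>
     'k ring \<Rightarrow> ('v::ab_group_add rat_fun \<Rightarrow> 'k) \<Rightarrow> 'v set \<Rightarrow>
     (('v \<Rightarrow> complex) \<times> 'k \<Rightarrow>\<^sub>0 int) set set \<Rightarrow>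
     (('v \<Rightarrow> complex) set \<times> ('v \<Rightarrow> complex) set) set \<Rightarrow> 'k" where
  "natural_embedding scl G \<rho> K \<iota> Y p =
     restrict (frac_lift K (coord_embedding scl G \<rho> K \<iota> p)) (carrier (function_field scl Y))"

end

theory Submission
  imports
    Defs
    "HOL-Algebra.Free_Abelian_Groups"
    "HOL-Library.Countable_Set"
    "HOL-Analysis.Continuum_Not_Denumerable"
    "HOL-Computational_Algebra.Fundamental_Theorem_Algebra"
begin

text \<open>A closed point \<open>p\<close> of the parameter scheme is the kernel of a unique \<open>K\<close>-algebra
  homomorphism \<open>\<eta> : \<complex>[V] \<otimes> K \<rightarrow> K\<close>, by the Nullstellensatz over \<open>K\<close>; equivalently, it is a
  homomorphism \<open>h : \<complex>[V] \<rightarrow> K\<close>, \<open>h f = \<eta> (f \<otimes> 1)\<close>, that is the inclusion on the invariants.  The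
  ideal of \<open>Y\<^sub>p\<close> is the kernel of \<open>h\<close>, by the Nullstellensatz over \<open>\<complex>\<close>, so the points over \<open>Y\<close> are
  the injective homomorphisms \<open>\<complex>[Y] \<rightarrow> K\<close> extending the inclusion of the invariants.  These are the
  embeddings of the field of fractions, and because \<open>\<complex>(V)\<^sup>G\<close> consists of fractions of invariants they
  are the identity there.

  Both \<open>\<complex>\<close> and \<open>K\<close> are uncountable and the algebras in question have countable dimension, so both
  cases of the Nullstellensatz follow from one argument: if \<open>r\<close> were transcendental over \<open>K\<close>, the
  uncountably many elements \<open>1 / (r - k)\<close> would be linearly independent.\<close>

section \<open>Nullstellensatz over uncountable algebraically closed fields\<close>

text \<open>Two obstacles shape the proof. The variety \<open>Y\<close> is given as a set of points
  and remembers an ideal only up to its radical, so the fibre over \<open>Y\<close> can be compared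
  with functions on \<open>Y\<close> only after the ideal of a point has been recovered from its
  zeros; this takes the strong Nullstellensatz over \<complex>. A closed point is just a maximal
  ideal, and it assigns values in \<open>K\<close> only because its residue field is no larger than
  \<open>K\<close>; this takes the weak form over \<open>K\<close>. The field \<open>K\<close>
  inherits uncountability from \<complex>, because constants are invariant. Countable dimension
  comes from the monomials in the coordinates: they span \<complex>[V] over \<complex>, hence also
  the tensor product over \<open>K\<close>. The description of \<complex>(V)^G by fractions of
  invariants makes restriction to \<open>Y\<close> meaningful: a nonzero invariant \<open>b\<close>
  has its reciprocal in that field, so \<open>h b\<close> is nonzero in \<open>K\<close>, so
  \<open>b\<close> does not vanish identically on \<open>Y\<close>. The value of an embedding on a
  restricted fraction is then forced by the values of \<open>h\<close> on numerator and
  denominator.\<close>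

lemma poly_eval_hom:
  assumes "domain K" "domain D" and \<beta>: "\<beta> \<in> ring_hom K D" and r: "r \<in> carrier D"
  shows "(\<lambda>P. ring.eval D (map \<beta> P) r) \<in> ring_hom (poly_ring K) D"
proof -
  interpret K: domain K by fact
  interpret D: domain D by fact
  interpret h: ring_hom_ring K D \<beta>
    by (rule ring_hom_ringI2[OF K.ring_axioms D.ring_axioms \<beta>])
  have set_in: "set P \<subseteq> carrier K" if "P \<in> carrier (poly_ring K)" for P
    using that K.polynomial_incl unfolding univ_poly_def by auto
  have map_in: "set (map \<beta> P) \<subseteq> carrier D" if "set P \<subseteq> carrier K" for P
    using that by auto
  show ?thesis
  proof (rule ring_hom_memI)
    fix P assume P: "P \<in> carrier (poly_ring K)"
    show "D.eval (map \<beta> P) r \<in> carrier D"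
      by (rule D.eval_in_carrier[OF map_in[OF set_in[OF P]] r])
  next
    fix P Q assume P: "P \<in> carrier (poly_ring K)" and Q: "Q \<in> carrier (poly_ring K)"
    \<comment> \<open>Mapping coefficients may create leading zeros, so it respects products and
      sums only after \<open>normalize\<close>; evaluation does not see the difference.\<close>
    have "D.eval (map \<beta> (K.poly_mult P Q)) r = D.eval (D.normalize (map \<beta> (K.poly_mult P Q))) r"
      by (rule D.eval_normalize[symmetric, OF map_in[OF K.poly_mult_in_carrier[OF set_in[OF P] set_in[OF Q]]] r])
    also have "\<dots> = D.eval (map \<beta> P) r \<otimes>\<^bsub>D\<^esub> D.eval (map \<beta> Q) r"
      unfolding h.poly_mult_hom'[OF set_in[OF P] set_in[OF Q]]
      by (rule D.eval_poly_mult[OF map_in[OF set_in[OF P]] map_in[OF set_in[OF Q]] r])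
    finally show "D.eval (map \<beta> (P \<otimes>\<^bsub>poly_ring K\<^esub> Q)) r = D.eval (map \<beta> P) r \<otimes>\<^bsub>D\<^esub> D.eval (map \<beta> Q) r"
      by (simp add: univ_poly_mult)
    have "D.eval (map \<beta> (K.poly_add P Q)) r = D.eval (D.normalize (map \<beta> (K.poly_add P Q))) r"
      by (rule D.eval_normalize[symmetric, OF map_in[OF K.poly_add_in_carrier[OF set_in[OF P] set_in[OF Q]]] r])
    also have "\<dots> = D.eval (map \<beta> P) r \<oplus>\<^bsub>D\<^esub> D.eval (map \<beta> Q) r"
      unfolding h.poly_add_hom'[OF set_in[OF P] set_in[OF Q]]
      by (rule D.eval_poly_add[OF map_in[OF set_in[OF P]] map_in[OF set_in[OF Q]] r])
    finally show "D.eval (map \<beta> (P \<oplus>\<^bsub>poly_ring K\<^esub> Q)) r = D.eval (map \<beta> P) r \<oplus>\<^bsub>D\<^esub> D.eval (map \<beta> Q) r"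
      by (simp add: univ_poly_add)
  next
    show "D.eval (map \<beta> \<one>\<^bsub>poly_ring K\<^esub>) r = \<one>\<^bsub>D\<^esub>"
      using r by (simp add: univ_poly_one)
  qed
qed

text \<open>\<open>P\<close> splits over \<open>K\<close>, so a linear factor can be peeled off.
  Since \<open>D\<close> has no zero divisors, either \<open>r\<close> is the image of that root or
  it is annihilated by the cofactor, whose degree is smaller. A nonzero constant cannot vanish at
  \<open>r\<close>, because a homomorphism from a field to a nontrivial ring is injective.\<close>

lemma alg_closed_hom_root:
  assumes "algebraically_closed K" "domain D" and \<beta>: "\<beta> \<in> ring_hom K D" and r: "r \<in> carrier D"
    and "P \<in> carrier (poly_ring K)" "P \<noteq> []" "ring.eval D (map \<beta> P) r = \<zero>\<^bsub>D\<^esub>"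
  shows "\<exists>a\<in>carrier K. r = \<beta> a"
  using assms(5-7)
proof (induction "Polynomials.degree P" arbitrary: P rule: less_induct)
  case less
  interpret K: algebraically_closed K by fact
  interpret D: domain D by fact
  interpret h: ring_hom_ring K D \<beta>
    by (rule ring_hom_ringI2[OF K.ring_axioms D.ring_axioms \<beta>])
  have inj: "inj_on \<beta> (carrier K)"
  proof (rule h.non_trivial_field_hom_imp_inj[OF K.field_axioms])
    have "\<one>\<^bsub>D\<^esub> \<in> \<beta> ` carrier K"
      using h.hom_one K.one_closed by (metis imageI)
    then show "\<beta> ` carrier K \<noteq> {\<zero>\<^bsub>D\<^esub>}"
      using D.one_not_zero by (metis singletonD)
  qed
  have E: "(\<lambda>P. ring.eval D (map \<beta> P) r) \<in> ring_hom (poly_ring K) D"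
    by (rule poly_eval_hom[OF K.domain_axioms D.domain_axioms \<beta> r])
  show ?case
  proof (cases "Polynomials.degree P = 0")
    case True
    with \<open>P \<noteq> []\<close> obtain c where P: "P = [c]"
      by (cases P) auto
    with less.prems have c: "c \<in> carrier K" "c \<noteq> \<zero>\<^bsub>K\<^esub>"
      by (auto simp: univ_poly_def polynomial_def)
    have "\<beta> c = \<zero>\<^bsub>D\<^esub>"
      using less.prems r c by (simp add: P)
    then have "c = \<zero>\<^bsub>K\<^esub>"
      using inj_onD[OF inj, of c "\<zero>\<^bsub>K\<^esub>"] c by simp
    with c show ?thesis by simp
  next
    case False
    have "K.splitted P"
      by (rule K.roots_over_carrier[OF less.prems(1)])
    then have "K.roots P \<noteq> {#}"
      using False by (auto simp: K.splitted_def)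
    then obtain a where a: "a \<in> carrier K" "a \<in># K.roots P"
        and pdiv: "[ \<one>\<^bsub>K\<^esub>, \<ominus>\<^bsub>K\<^esub> a ] pdivides\<^bsub>K\<^esub> P" and X: "[ \<one>\<^bsub>K\<^esub>, \<ominus>\<^bsub>K\<^esub> a ] \<in> carrier (poly_ring K)"
      using less.prems(1) by blast
    then obtain q where q: "q \<in> carrier (poly_ring K)"
        and p: "P = [ \<one>\<^bsub>K\<^esub>, \<ominus>\<^bsub>K\<^esub> a ] \<otimes>\<^bsub>poly_ring K\<^esub> q"
      unfolding pdivides_def by blast
    have nz: "q \<noteq> []"
      using domain.integral_iff[OF K.univ_poly_is_domain[OF K.carrier_is_subring] X, of q] p less.prems(2)
      by (metis K.carrier_is_subring K.poly_mult_zero(2) K.polynomial_incl X univ_poly_carrier univ_poly_mult)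
    have deg: "Polynomials.degree P = Suc (Polynomials.degree q)"
      using K.poly_mult_degree_eq[OF K.carrier_is_subring] X q p nz
      unfolding univ_poly_carrier sym[OF univ_poly_mult[of K "carrier K"]] by auto
    have "(r \<ominus>\<^bsub>D\<^esub> \<beta> a) \<otimes>\<^bsub>D\<^esub> D.eval (map \<beta> q) r = D.eval (map \<beta> P) r"
      unfolding p using ring_hom_mult[OF E X q] a r by (simp add: D.minus_eq)
    then have "(r \<ominus>\<^bsub>D\<^esub> \<beta> a) \<otimes>\<^bsub>D\<^esub> D.eval (map \<beta> q) r = \<zero>\<^bsub>D\<^esub>"
      using less.prems by simp
    moreover have "D.eval (map \<beta> q) r \<in> carrier D"
      using ring_hom_closed[OF E q] .
    ultimately consider "r \<ominus>\<^bsub>D\<^esub> \<beta> a = \<zero>\<^bsub>D\<^esub>" | "D.eval (map \<beta> q) r = \<zero>\<^bsub>D\<^esub>"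
      using D.integral[of "r \<ominus>\<^bsub>D\<^esub> \<beta> a" "D.eval (map \<beta> q) r"] a r by auto
    then show ?thesis
    proof cases
      case 1
      then show ?thesis using a r by auto
    next
      case 2
      then show ?thesis using less.hyps[of q] q nz deg by simp
    qed
  qed
qed

text \<open>Linear dependence is formulated with \<open>combine\<close> on lists, clearing
  denominators with sums over a finite set. Distinctness ensures that no repeated index is lost in
  the passage to the set.\<close>

lemma (in ring) combine_distinct_eq_finsum:
  assumes "distinct ks" "c ` set ks \<subseteq> carrier R" "u ` set ks \<subseteq> carrier R"
  shows "combine (map c ks) (map u ks) = (\<Oplus>k\<in>set ks. c k \<otimes> u k)"
  using assms by (induction ks) (auto simp: Pi_def image_subset_iff)

text \<open>Clearing denominators in a linear dependence between the fractions \<open>g / (r - k)\<close> yields a polynomial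
  vanishing at \<open>r\<close>.  It is not zero because all of its terms but one vanish at \<open>k0\<close>.\<close>

lemma alg_closed_dependent_inverses:
  assumes K: "algebraically_closed K" and D: "domain D" and \<beta>: "\<beta> \<in> ring_hom K D" and r: "r \<in> carrier D"
    and T: "finite T" "T \<subseteq> carrier K" and g: "g \<in> carrier D" "g \<noteq> \<zero>\<^bsub>D\<^esub>"
    and u: "u \<in> T \<rightarrow> carrier D" "\<And>k. k \<in> T \<Longrightarrow> (r \<ominus>\<^bsub>D\<^esub> \<beta> k) \<otimes>\<^bsub>D\<^esub> u k = g"
    and c: "c \<in> T \<rightarrow> carrier K" "k0 \<in> T" "c k0 \<noteq> \<zero>\<^bsub>K\<^esub>"
    and dep: "(\<Oplus>\<^bsub>D\<^esub>k\<in>T. \<beta> (c k) \<otimes>\<^bsub>D\<^esub> u k) = \<zero>\<^bsub>D\<^esub>"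
  shows "\<exists>a\<in>carrier K. r = \<beta> a"
proof -
  interpret K: algebraically_closed K by fact
  interpret D: domain D by fact
  interpret h: ring_hom_ring K D \<beta>
    by (rule ring_hom_ringI2[OF K.ring_axioms D.ring_axioms \<beta>])
  interpret KX: domain "poly_ring K"
    by (rule K.univ_poly_is_domain[OF K.carrier_is_subring])
  define E where "E = (\<lambda>P. D.eval (map \<beta> P) r)"
  interpret E: ring_hom_cring "poly_ring K" D E
    unfolding E_def
    by (intro ring_hom_cring.intro ring_hom_cring_axioms.intro KX.cring_axioms D.cring_axioms poly_eval_hom[OF K.domain_axioms D \<beta> r])
  interpret F: ring_hom_cring "poly_ring K" K "\<lambda>P. K.eval P k0"
    by (rule K.eval_cring_hom[OF K.carrier_is_subring]) (use c T in auto)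
  define lx where "lx k = [\<one>\<^bsub>K\<^esub>, \<ominus>\<^bsub>K\<^esub> k]" for k
  \<comment> \<open>The constant polynomial \<open>k\<close>; zero has to be the empty list because
    the leading coefficient of a nonempty list must not vanish.\<close>
  define C where "C k = (if k = \<zero>\<^bsub>K\<^esub> then [] else [k])" for k
  have lx_in: "lx k \<in> carrier (poly_ring K)" if "k \<in> carrier K" for k
    using that by (auto simp: lx_def univ_poly_def polynomial_def)
  have C_in: "C k \<in> carrier (poly_ring K)" if "k \<in> carrier K" for k
    using that by (auto simp: C_def univ_poly_def polynomial_def)
  have EX: "E (lx k) = r \<ominus>\<^bsub>D\<^esub> \<beta> k" if "k \<in> carrier K" for k
    using that r by (simp add: E_def lx_def D.minus_eq)
  have EC: "E (C k) = \<beta> k" if "k \<in> carrier K" for k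
    using that r by (simp add: E_def C_def)
  have k0: "k0 \<in> carrier K" using c T by auto
  have FX: "K.eval (lx k) k0 = k0 \<ominus>\<^bsub>K\<^esub> k" if "k \<in> carrier K" for k
    using that k0 by (simp add: lx_def K.minus_eq)
  have FC: "K.eval (C k) k0 = k" if "k \<in> carrier K" for k
    using that k0 by (simp add: C_def)
  \<comment> \<open>Over the common denominator \<open>Q\<close>, the product of all
    \<open>X - j\<close> with \<open>j\<close> in \<open>T\<close>, the fraction
    \<open>1 / (X - k)\<close> has numerator \<open>L k\<close>. So \<open>P\<close> below is the
    numerator of the sum of the \<open>c k / (X - k)\<close>.\<close>
  define L where "L k = (\<Otimes>\<^bsub>poly_ring K\<^esub>j\<in>T - {k}. lx j)" for k
  have L_in: "L k \<in> carrier (poly_ring K)" for k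
    unfolding L_def using T lx_in by (intro KX.finprod_closed) auto
  define P where "P = (\<Oplus>\<^bsub>poly_ring K\<^esub>k\<in>T. C (c k) \<otimes>\<^bsub>poly_ring K\<^esub> L k)"
  have term_in: "(\<lambda>k. C (c k) \<otimes>\<^bsub>poly_ring K\<^esub> L k) \<in> T \<rightarrow> carrier (poly_ring K)"
    using c C_in L_in by (auto simp: Pi_def)
  have P_in: "P \<in> carrier (poly_ring K)"
    unfolding P_def by (rule KX.finsum_closed[OF term_in])
  define Q where "Q = (\<Otimes>\<^bsub>poly_ring K\<^esub>j\<in>T. lx j)"
  have Q_in: "Q \<in> carrier (poly_ring K)"
    unfolding Q_def using T lx_in by (intro KX.finprod_closed) auto
  have Q_eq: "Q = lx k \<otimes>\<^bsub>poly_ring K\<^esub> L k" if "k \<in> T" for k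
  proof -
    have "Q = (\<Otimes>\<^bsub>poly_ring K\<^esub>j\<in>insert k (T - {k}). lx j)"
      using that by (simp add: Q_def insert_absorb)
    also have "\<dots> = lx k \<otimes>\<^bsub>poly_ring K\<^esub> L k"
      unfolding L_def using T lx_in that by (intro KX.finprod_insert) auto
    finally show ?thesis .
  qed
  \<comment> \<open>\<open>u k\<close> plays the part of \<open>g / (r - k)\<close>. This is the
    division-free form of \<open>Q / (X - k) = L k\<close>, read at \<open>r\<close>.\<close>
  have Qu: "E Q \<otimes>\<^bsub>D\<^esub> u k = g \<otimes>\<^bsub>D\<^esub> E (L k)" if k: "k \<in> T" for k
  proof -
    have kK: "k \<in> carrier K" and uk: "u k \<in> carrier D" using k T u by auto
    have "E Q \<otimes>\<^bsub>D\<^esub> u k = ((r \<ominus>\<^bsub>D\<^esub> \<beta> k) \<otimes>\<^bsub>D\<^esub> u k) \<otimes>\<^bsub>D\<^esub> E (L k)"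
      using kK uk r L_in lx_in EX by (simp add: Q_eq[OF k] D.m_ac)
    then show ?thesis using u k by simp
  qed
  have "g \<otimes>\<^bsub>D\<^esub> E P = (\<Oplus>\<^bsub>D\<^esub>k\<in>T. g \<otimes>\<^bsub>D\<^esub> (\<beta> (c k) \<otimes>\<^bsub>D\<^esub> E (L k)))"
  proof -
    have "E P = (\<Oplus>\<^bsub>D\<^esub>k\<in>T. \<beta> (c k) \<otimes>\<^bsub>D\<^esub> E (L k))"
      unfolding P_def E.hom_finsum[OF term_in]
      by (intro D.finsum_cong') (use c C_in L_in EC in \<open>auto simp: Pi_def\<close>)
    then show ?thesis
      using g c L_in T by (simp add: D.finsum_rdistr Pi_def)
  qed
  also have "\<dots> = (\<Oplus>\<^bsub>D\<^esub>k\<in>T. E Q \<otimes>\<^bsub>D\<^esub> (\<beta> (c k) \<otimes>\<^bsub>D\<^esub> u k))"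
  proof (intro D.finsum_cong')
    fix k assume k: "k \<in> T"
    then have "c k \<in> carrier K" "u k \<in> carrier D" using c u by auto
    then show "g \<otimes>\<^bsub>D\<^esub> (\<beta> (c k) \<otimes>\<^bsub>D\<^esub> E (L k)) = E Q \<otimes>\<^bsub>D\<^esub> (\<beta> (c k) \<otimes>\<^bsub>D\<^esub> u k)"
      using Qu[OF k] g L_in[of k] Q_in
        D.m_lcomm[of g "\<beta> (c k)" "E (L k)"] D.m_lcomm[of "E Q" "\<beta> (c k)" "u k"] by simp
  qed (use c u Q_in in \<open>auto simp: Pi_def\<close>)
  also have "\<dots> = E Q \<otimes>\<^bsub>D\<^esub> \<zero>\<^bsub>D\<^esub>"
    unfolding dep[symmetric] by (rule D.finsum_rdistr[symmetric]) (use T c u Q_in in \<open>auto simp: Pi_def\<close>)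
  finally have "g \<otimes>\<^bsub>D\<^esub> E P = \<zero>\<^bsub>D\<^esub>" using Q_in by simp
  then have EP: "E P = \<zero>\<^bsub>D\<^esub>"
    using D.integral[of g "E P"] g P_in by auto
  have "K.eval P k0 = (\<Oplus>\<^bsub>K\<^esub>k\<in>T. c k \<otimes>\<^bsub>K\<^esub> K.eval (L k) k0)"
    unfolding P_def F.hom_finsum[OF term_in]
    by (intro K.finsum_cong') (use c C_in L_in FC in \<open>auto simp: Pi_def\<close>)
  also have "\<dots> = (\<Oplus>\<^bsub>K\<^esub>k\<in>T. if k0 = k then c k \<otimes>\<^bsub>K\<^esub> K.eval (L k) k0 else \<zero>\<^bsub>K\<^esub>)"
  proof (intro K.finsum_cong')
    fix k assume k: "k \<in> T"
    show "c k \<otimes>\<^bsub>K\<^esub> K.eval (L k) k0 = (if k0 = k then c k \<otimes>\<^bsub>K\<^esub> K.eval (L k) k0 else \<zero>\<^bsub>K\<^esub>)"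
    proof (cases "k0 = k")
      case False
      have "L k = lx k0 \<otimes>\<^bsub>poly_ring K\<^esub> (\<Otimes>\<^bsub>poly_ring K\<^esub>j\<in>T - {k} - {k0}. lx j)"
      proof -
        have "L k = (\<Otimes>\<^bsub>poly_ring K\<^esub>j\<in>insert k0 (T - {k} - {k0}). lx j)"
          using c False by (simp add: L_def insert_absorb)
        also have "\<dots> = lx k0 \<otimes>\<^bsub>poly_ring K\<^esub> (\<Otimes>\<^bsub>poly_ring K\<^esub>j\<in>T - {k} - {k0}. lx j)"
          using T lx_in c by (intro KX.finprod_insert) auto
        finally show ?thesis .
      qed
      moreover have "(\<Otimes>\<^bsub>poly_ring K\<^esub>j\<in>T - {k} - {k0}. lx j) \<in> carrier (poly_ring K)"
        using T lx_in by (intro KX.finprod_closed) auto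
      ultimately have "K.eval (L k) k0 = \<zero>\<^bsub>K\<^esub>"
        using lx_in[OF k0] FX[OF k0] k0 F.hom_closed by (simp add: K.minus_eq K.r_neg)
      then show ?thesis using False k c by (auto simp: Pi_def)
    qed simp
  qed (use c L_in in \<open>auto simp: Pi_def\<close>)
  also have "\<dots> = c k0 \<otimes>\<^bsub>K\<^esub> K.eval (L k0) k0"
    by (rule K.finsum_singleton) (use T c L_in in \<open>auto simp: Pi_def\<close>)
  finally have FP: "K.eval P k0 = c k0 \<otimes>\<^bsub>K\<^esub> K.eval (L k0) k0" .
  \<comment> \<open>The factor left in the one surviving term is the product of the differences
    \<open>k0 - j\<close> for \<open>j \<noteq> k0\<close>, which is nonzero in a field.\<close>
  have "K.eval (L k0) k0 = (\<Otimes>\<^bsub>K\<^esub>j\<in>T - {k0}. k0 \<ominus>\<^bsub>K\<^esub> j)"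
  proof -
    have "lx \<in> T - {k0} \<rightarrow> carrier (poly_ring K)" using T lx_in by auto
    from F.hom_finprod[OF this] show ?thesis
      unfolding L_def
      by simp (intro K.finprod_cong', use T FX k0 in auto)
  qed
  moreover have "(\<Otimes>\<^bsub>K\<^esub>j\<in>S. k0 \<ominus>\<^bsub>K\<^esub> j) \<noteq> \<zero>\<^bsub>K\<^esub>" if "finite S" "S \<subseteq> T - {k0}" for S
    using that
  proof (induction S rule: finite_induct)
    case (insert j S)
    have j: "j \<in> carrier K" "j \<noteq> k0" using insert T by auto
    have S: "(\<lambda>j. k0 \<ominus>\<^bsub>K\<^esub> j) \<in> S \<rightarrow> carrier K" using insert T k0 by auto
    have "k0 \<ominus>\<^bsub>K\<^esub> j \<noteq> \<zero>\<^bsub>K\<^esub>" using j k0 by simp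
    then show ?case
      using insert j k0 S K.integral[of "k0 \<ominus>\<^bsub>K\<^esub> j" "\<Otimes>\<^bsub>K\<^esub>j\<in>S. k0 \<ominus>\<^bsub>K\<^esub> j"]
      by (auto simp: K.finprod_insert)
  qed simp
  ultimately have "K.eval (L k0) k0 \<noteq> \<zero>\<^bsub>K\<^esub>" using T by simp
  then have "K.eval P k0 \<noteq> \<zero>\<^bsub>K\<^esub>"
    unfolding FP using c L_in K.integral[of "c k0" "K.eval (L k0) k0"] by auto
  then have "P \<noteq> []" by auto
  with alg_closed_hom_root[OF K D \<beta> r P_in] EP show ?thesis
    by (simp add: E_def)
qed

section \<open>Zero cosets and spans of infinite sets\<close>

lemma (in ideal) quot_zero_iff:
  assumes "a \<in> carrier R"
  shows "I +> a = \<zero>\<^bsub>R Quot I\<^esub> \<longleftrightarrow> a \<in> I"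
proof -
  have "\<zero>\<^bsub>R Quot I\<^esub> = I" by (simp add: FactRing_def)
  then show ?thesis using a_rcos_const[of a] a_rcos_self[OF assms] by auto
qed

lemma (in ideal) quot_carrier: "carrier (R Quot I) = (+>) I ` carrier R"
  by (auto simp: FactRing_simps)

text \<open>Unlike \<open>Span\<close>, which takes a finite list, this allows an infinite spanning
  set. The scalars are merely a set, so spans can be carried along a homomorphism without first
  giving its image a field structure.\<close>

inductive_set lin_span :: "('a, 'm) ring_scheme \<Rightarrow> 'a set \<Rightarrow> 'a set \<Rightarrow> 'a set"
  for R (structure) and F S where
  zero: "\<zero> \<in> lin_span R F S"
| step: "a \<in> F \<Longrightarrow> s \<in> S \<Longrightarrow> x \<in> lin_span R F S \<Longrightarrow> a \<otimes> s \<oplus> x \<in> lin_span R F S"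

lemma (in ring) lin_span_in_carrier:
  assumes "F \<subseteq> carrier R" "S \<subseteq> carrier R" "x \<in> lin_span R F S"
  shows "x \<in> carrier R"
  using assms(3) by induction (use assms in auto)

lemma (in ring) lin_span_add:
  assumes F: "F \<subseteq> carrier R" and S: "S \<subseteq> carrier R"
    and x: "x \<in> lin_span R F S" and y: "y \<in> lin_span R F S"
  shows "x \<oplus> y \<in> lin_span R F S"
  using x
proof induction
  case zero
  then show ?case using y lin_span_in_carrier[OF F S y] by simp
next
  case (step a s x)
  have "a \<otimes> s \<oplus> x \<oplus> y = a \<otimes> s \<oplus> (x \<oplus> y)"
    using step F S lin_span_in_carrier[OF F S] y by (intro a_assoc) auto
  then show ?case using lin_span.step[OF step(1,2) step.IH] by simp
qed

lemma (in ring) lin_span_smult: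
  assumes F: "F \<subseteq> carrier R" "\<And>a b. a \<in> F \<Longrightarrow> b \<in> F \<Longrightarrow> a \<otimes> b \<in> F" and S: "S \<subseteq> carrier R"
    and b: "b \<in> F" and x: "x \<in> lin_span R F S"
  shows "b \<otimes> x \<in> lin_span R F S"
  using x
proof induction
  case zero
  then show ?case using b F lin_span.zero by (metis r_null subsetD)
next
  case (step a s x)
  have "b \<otimes> (a \<otimes> s \<oplus> x) = (b \<otimes> a) \<otimes> s \<oplus> b \<otimes> x"
    using step F S lin_span_in_carrier[OF F(1) S] b by (simp add: r_distr m_assoc subset_iff)
  then show ?case using lin_span.step[OF F(2)[OF b step(1)] step(2) step.IH] by simp
qed

lemma (in ring_hom_ring) lin_span_hom:
  assumes F: "F \<subseteq> carrier R" and S: "T \<subseteq> carrier R" and x: "x \<in> lin_span R F T"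
  shows "h x \<in> lin_span S (h ` F) (h ` T)"
  using x
proof induction
  case zero
  then show ?case by (simp add: lin_span.zero)
next
  case (step a s x)
  then have "a \<in> carrier R" "s \<in> carrier R" "x \<in> carrier R"
    using F S R.lin_span_in_carrier[OF F S] by auto
  then show ?case using step by (auto intro: lin_span.step)
qed

lemma lin_span_mono:
  assumes "F \<subseteq> F'" "x \<in> lin_span R F S"
  shows "x \<in> lin_span R F' S"
  using assms(2) by induction (use assms(1) in \<open>auto intro: lin_span.intros\<close>)

text \<open>Meant for \<open>S\<close> the set of monomials: their span is then closed under
  products, which lets an induction over polynomial functions stay inside it.\<close>

lemma (in cring) lin_span_mult:
  assumes F: "F \<subseteq> carrier R" "\<And>a b. a \<in> F \<Longrightarrow> b \<in> F \<Longrightarrow> a \<otimes> b \<in> F"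
    and S: "S \<subseteq> carrier R" "\<And>s t. s \<in> S \<Longrightarrow> t \<in> S \<Longrightarrow> s \<otimes> t \<in> S"
    and x: "x \<in> lin_span R F S" and y: "y \<in> lin_span R F S"
  shows "x \<otimes> y \<in> lin_span R F S"
proof -
  note in_R = lin_span_in_carrier[OF F(1) S(1)]
  have base: "s \<otimes> y \<in> lin_span R F S" if s: "s \<in> S" for s
    using y
  proof induction
    case zero
    then show ?case using s S lin_span.zero by (metis r_null subsetD)
  next
    case (step a t y)
    have "s \<otimes> (a \<otimes> t \<oplus> y) = a \<otimes> (s \<otimes> t) \<oplus> s \<otimes> y"
      using step s F S in_R by (simp add: r_distr m_lcomm subset_iff)
    then show ?case using lin_span.step[OF step(1) S(2)[OF s step(2)] step.IH] by simp
  qed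
  show ?thesis using x
  proof induction
    case zero
    then show ?case using y in_R lin_span.zero by simp
  next
    case (step a s x)
    have "(a \<otimes> s \<oplus> x) \<otimes> y = a \<otimes> (s \<otimes> y) \<oplus> x \<otimes> y"
      using step y F S in_R by (simp add: l_distr m_assoc subset_iff)
    then show ?case
      using lin_span_add[OF F(1) S(1) lin_span_smult[OF F S(1) step(1) base[OF step(2)]] step.IH] by simp
  qed
qed

text \<open>The assumption \<open>divides\<close> says that inverting \<open>f\<close> would turn
  \<open>D\<close> into a field. Writing the inverse of \<open>r - k\<close> as
  \<open>u / f ^ n\<close> with \<open>u\<close> in \<open>D\<close> keeps the counting inside
  \<open>D\<close>, where the countable spanning set lives, and avoids constructing the
  localisation.\<close>

lemma alg_closed_hom_surj:
  assumes K: "algebraically_closed K" and unc: "uncountable (carrier K)"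
    and D: "domain D" and \<beta>: "\<beta> \<in> ring_hom K D"
    and S: "countable S" "S \<subseteq> carrier D" and span: "carrier D \<subseteq> lin_span D (\<beta> ` carrier K) S"
    and f: "f \<in> carrier D" "f \<noteq> \<zero>\<^bsub>D\<^esub>"
    and divides: "\<And>x. x \<in> carrier D \<Longrightarrow> x \<noteq> \<zero>\<^bsub>D\<^esub> \<Longrightarrow> \<exists>n::nat. \<exists>u\<in>carrier D. x \<otimes>\<^bsub>D\<^esub> u = f [^]\<^bsub>D\<^esub> n"
    and r: "r \<in> carrier D"
  shows "\<exists>a\<in>carrier K. r = \<beta> a"
proof (rule ccontr)
  assume r_notin: "\<not> (\<exists>a\<in>carrier K. r = \<beta> a)"
  interpret K: algebraically_closed K by fact
  interpret D: domain D by fact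
  interpret h: ring_hom_ring K D \<beta>
    by (rule ring_hom_ringI2[OF K.ring_axioms D.ring_axioms \<beta>])
  define F where "F = \<beta> ` carrier K"
  have F: "subfield F D"
    unfolding F_def by (rule h.img_is_subfield(2)[OF K.carrier_is_subfield D.one_not_zero])
  have in_Span: "\<exists>us\<in>lists S. x \<in> D.Span F us" if "x \<in> carrier D" for x
  proof -
    have "x \<in> lin_span D F S" using span that by (auto simp: F_def)
    then show ?thesis
    proof induction
      case zero
      show ?case by (intro bexI[of _ "[]"]) simp_all
    next
      case (step a s x)
      then obtain us where us: "us \<in> lists S" "x \<in> D.Span F us" by blast
      then have "a \<otimes>\<^bsub>D\<^esub> s \<oplus>\<^bsub>D\<^esub> x \<in> D.Span F (s # us)"
        using step by (auto simp: D.line_extension_mem_iff)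
      with us step show ?case by (intro bexI[of _ "s # us"]) auto
    qed
  qed
  have "\<forall>k\<in>carrier K. \<exists>t :: nat \<times> _ \<times> _. fst (snd t) \<in> carrier D \<and> snd (snd t) \<in> lists S \<and>
      (r \<ominus>\<^bsub>D\<^esub> \<beta> k) \<otimes>\<^bsub>D\<^esub> fst (snd t) = f [^]\<^bsub>D\<^esub> fst t \<and> fst (snd t) \<in> D.Span F (snd (snd t))"
  proof
    fix k assume k: "k \<in> carrier K"
    have "r \<ominus>\<^bsub>D\<^esub> \<beta> k \<in> carrier D" "r \<ominus>\<^bsub>D\<^esub> \<beta> k \<noteq> \<zero>\<^bsub>D\<^esub>"
      using r k r_notin by auto
    from divides[OF this] obtain n :: nat and u where
      "u \<in> carrier D" "(r \<ominus>\<^bsub>D\<^esub> \<beta> k) \<otimes>\<^bsub>D\<^esub> u = f [^]\<^bsub>D\<^esub> n" by blast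
    moreover obtain us where "us \<in> lists S" "u \<in> D.Span F us"
      using in_Span[OF \<open>u \<in> carrier D\<close>] by blast
    ultimately show "\<exists>t :: nat \<times> _ \<times> _. fst (snd t) \<in> carrier D \<and> snd (snd t) \<in> lists S \<and>
      (r \<ominus>\<^bsub>D\<^esub> \<beta> k) \<otimes>\<^bsub>D\<^esub> fst (snd t) = f [^]\<^bsub>D\<^esub> fst t \<and> fst (snd t) \<in> D.Span F (snd (snd t))"
      by (intro exI[of _ "(n, u, us)"]) simp
  qed
  from bchoice[OF this] obtain t :: "_ \<Rightarrow> nat \<times> _ \<times> _" where
    t: "\<And>k. k \<in> carrier K \<Longrightarrow> fst (snd (t k)) \<in> carrier D \<and> snd (snd (t k)) \<in> lists S \<and>
      (r \<ominus>\<^bsub>D\<^esub> \<beta> k) \<otimes>\<^bsub>D\<^esub> fst (snd (t k)) = f [^]\<^bsub>D\<^esub> fst (t k) \<and>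
      fst (snd (t k)) \<in> D.Span F (snd (snd (t k)))"
    by blast
  define n where "n k = fst (t k)" for k
  define u where "u k = fst (snd (t k))" for k
  define us where "us k = snd (snd (t k))" for k
  have n: "(r \<ominus>\<^bsub>D\<^esub> \<beta> k) \<otimes>\<^bsub>D\<^esub> u k = f [^]\<^bsub>D\<^esub> n k" if "k \<in> carrier K" for k
    using t[OF that] unfolding n_def u_def by blast
  have u: "u k \<in> carrier D" "u k \<in> D.Span F (us k)" if "k \<in> carrier K" for k
    using t[OF that] unfolding u_def us_def by blast+
  have us: "us k \<in> lists S" if "k \<in> carrier K" for k
    using t[OF that] unfolding us_def by blast
  \<comment> \<open>There are uncountably many \<open>k\<close> but only countably many exponents and finite lists from \<open>S\<close>, so
    infinitely many \<open>f ^ n / (r - k)\<close> share \<open>n\<close> and a finite-dimensional space.\<close>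
  define fib where "fib i = {k \<in> carrier K. (n k, us k) = i}" for i
  have "\<exists>i\<in>UNIV \<times> lists S. infinite (fib i)"
  proof (rule ccontr)
    assume fin: "\<not> (\<exists>i\<in>UNIV \<times> lists S. infinite (fib i))"
    then have "countable (\<Union>i\<in>UNIV \<times> lists S. fib i)"
    proof (intro countable_UN)
      show "countable ((UNIV :: nat set) \<times> lists S)"
        by (intro countable_SIGMA countable_lists S) simp
    qed (use fin countable_finite in blast)
    moreover have "carrier K \<subseteq> (\<Union>i\<in>UNIV \<times> lists S. fib i)"
      using us by (auto simp: fib_def)
    ultimately show False using unc countable_subset by blast
  qed
  then obtain m ws where ws: "ws \<in> lists S" and inf: "infinite (fib (m, ws))" by auto
  have ws_in: "set ws \<subseteq> carrier D" using ws S by auto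
  \<comment> \<open>The list \<open>ws\<close> may itself be dependent. A basis of its span provides
    the dimension, and \<open>T\<close> is chosen with one element more.\<close>
  obtain Vs where
    Vs: "set Vs \<subseteq> carrier D" "D.independent F Vs" "D.Span F Vs = D.Span F ws"
    by (rule D.filter_base[OF F ws_in])
  obtain T where T: "finite T" "card T = Suc (length Vs)" "T \<subseteq> fib (m, ws)"
    using infinite_arbitrarily_large[OF inf] by blast
  obtain ks where ks: "set ks = T" "distinct ks"
    using finite_distinct_list[OF T(1)] by blast
  have T_K: "T \<subseteq> carrier K" using T by (auto simp: fib_def)
  have uT: "u ` T \<subseteq> carrier D" using T_K u by auto
  have "D.dependent F (map u ks)"
  proof
    assume "D.independent F (map u ks)"
    moreover have "set (map u ks) \<subseteq> D.Span F Vs"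
    proof
      fix y assume "y \<in> set (map u ks)"
      then obtain k where k: "k \<in> fib (m, ws)" "y = u k" using ks T by auto
      then have "k \<in> carrier K" "us k = ws" by (auto simp: fib_def)
      with u(2)[of k] show "y \<in> D.Span F Vs" unfolding Vs(3) k by argo
    qed
    ultimately have "length (map u ks) \<le> length Vs"
      using D.independent_length_le[OF F _ Vs(2)] by blast
    then show False using T ks distinct_card[of ks] by simp
  qed
  then obtain Ks where Ks: "length Ks = length (map u ks)" "D.combine Ks (map u ks) = \<zero>\<^bsub>D\<^esub>"
      "set Ks \<subseteq> F" "set Ks \<noteq> {\<zero>\<^bsub>D\<^esub>}"
    using D.dependent_imp_non_trivial_combine[OF F, of "map u ks"] uT ks by auto
  have "\<forall>y\<in>F. \<exists>a\<in>carrier K. y = \<beta> a" by (auto simp: F_def)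
  then obtain g where g: "\<And>y. y \<in> F \<Longrightarrow> g y \<in> carrier K \<and> \<beta> (g y) = y" by metis
  \<comment> \<open>The dependence arrives as a list of coefficients in the image of
    \<open>K\<close>. Indexing it by the elements of \<open>T\<close> and lifting it through
    \<open>\<beta>\<close> by \<open>g\<close> produces the coefficients in \<open>K\<close> from
    which a polynomial can be formed.\<close>
  define c where "c k = the (map_of (zip ks Ks) k)" for k
  have Ks_map: "Ks = map c ks"
    using Ks(1) ks(2) by (intro nth_equalityI) (auto simp: c_def map_of_zip_nth)
  have cF: "c k \<in> F" if "k \<in> T" for k using that Ks(3) ks by (auto simp: Ks_map)
  have "T \<noteq> {}" using T by auto
  have "c ` T \<noteq> {\<zero>\<^bsub>D\<^esub>}" using Ks(4) ks unfolding Ks_map by simp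
  with \<open>T \<noteq> {}\<close> have "\<exists>k\<in>T. c k \<noteq> \<zero>\<^bsub>D\<^esub>" by (metis image_constant_conv image_cong)
  then obtain k0 where k0: "k0 \<in> T" "c k0 \<noteq> \<zero>\<^bsub>D\<^esub>" by blast
  have F_in: "F \<subseteq> carrier D" by (auto simp: F_def)
  have "(\<Oplus>\<^bsub>D\<^esub>k\<in>T. \<beta> (g (c k)) \<otimes>\<^bsub>D\<^esub> u k) = (\<Oplus>\<^bsub>D\<^esub>k\<in>T. c k \<otimes>\<^bsub>D\<^esub> u k)"
    by (intro D.finsum_cong') (use g cF u T_K F_in in \<open>auto simp: Pi_def subset_iff\<close>)
  also have "\<dots> = \<zero>\<^bsub>D\<^esub>"
  proof -
    have "c ` T \<subseteq> carrier D" using cF F_in by blast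
    from D.combine_distinct_eq_finsum[OF ks(2), of c u, unfolded ks(1), OF this uT] Ks(2)
    show ?thesis by (simp add: Ks_map)
  qed
  finally have dep: "(\<Oplus>\<^bsub>D\<^esub>k\<in>T. \<beta> (g (c k)) \<otimes>\<^bsub>D\<^esub> u k) = \<zero>\<^bsub>D\<^esub>" .
  have fm: "f [^]\<^bsub>D\<^esub> m \<noteq> \<zero>\<^bsub>D\<^esub>"
  proof (induction m)
    case (Suc m)
    then show ?case using f D.integral[of "f [^]\<^bsub>D\<^esub> m" f] by auto
  qed simp
  have "\<exists>a\<in>carrier K. r = \<beta> a"
  proof (rule alg_closed_dependent_inverses[OF K D \<beta> r T(1) T_K _ fm _ _ _ k0(1) _ dep])
    show "\<And>k. k \<in> T \<Longrightarrow> (r \<ominus>\<^bsub>D\<^esub> \<beta> k) \<otimes>\<^bsub>D\<^esub> u k = f [^]\<^bsub>D\<^esub> m"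
      using T n by (force simp: fib_def)
    show "g (c k0) \<noteq> \<zero>\<^bsub>K\<^esub>" using k0 g[OF cF[OF k0(1)]] by (metis h.hom_zero)
  qed (use f uT cF g in auto)
  with r_notin show False by blast
qed

text \<open>Zorn's lemma applies because a power of \<open>f\<close> in the union of a chain already
  lies in a member of the chain. The ideal obtained need not be a maximal ideal; it corresponds to
  one in the localisation at \<open>f\<close>.\<close>

lemma (in ring) exists_ideal_maximal_avoiding_powers:
  assumes P: "ideal P R" and f: "\<And>n::nat. f [^] n \<notin> P"
  obtains M where "ideal M R" "P \<subseteq> M" "\<And>n::nat. f [^] n \<notin> M"
    "\<And>J. ideal J R \<Longrightarrow> M \<subseteq> J \<Longrightarrow> (\<And>n::nat. f [^] n \<notin> J) \<Longrightarrow> J = M"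
proof -
  define \<A> where "\<A> = {J. ideal J R \<and> P \<subseteq> J \<and> (\<forall>n::nat. f [^] n \<notin> J)}"
  have "\<exists>M\<in>\<A>. \<forall>J\<in>\<A>. M \<subseteq> J \<longrightarrow> J = M"
  proof (rule subset_Zorn_nonempty)
    show "\<A> \<noteq> {}" using P f by (auto simp: \<A>_def)
  next
    fix C assume C: "C \<noteq> {}" "subset.chain \<A> C"
    then have "subset.chain {I. ideal I R} C" by (auto simp: pred_on.chain_def \<A>_def)
    from chain_Union_is_ideal[OF this] C have "ideal (\<Union>C) R" by simp
    moreover have "P \<subseteq> \<Union>C"
      using C unfolding pred_on.chain_def \<A>_def by blast
    moreover have "\<forall>n::nat. f [^] n \<notin> \<Union>C"
      using C by (auto simp: pred_on.chain_def \<A>_def)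
    ultimately show "\<Union>C \<in> \<A>" by (simp add: \<A>_def)
  qed
  then obtain M where "M \<in> \<A>" and max: "\<And>J. J \<in> \<A> \<Longrightarrow> M \<subseteq> J \<Longrightarrow> J = M" by blast
  then show thesis
    by (intro that[of M]) (auto simp: \<A>_def)
qed

text \<open>For \<open>f = 1\<close> this is the weak Nullstellensatz, for prime \<open>P\<close> the strong one.  Taking an ideal that
  is maximal among those avoiding the powers of \<open>f\<close> replaces the localisation at \<open>f\<close>.\<close>

lemma exists_hom_to_alg_closed:
  assumes K: "algebraically_closed K" and unc: "uncountable (carrier K)"
    and R: "cring R" and \<beta>: "\<beta> \<in> ring_hom K R"
    and S: "countable S" "S \<subseteq> carrier R" and span: "carrier R \<subseteq> lin_span R (\<beta> ` carrier K) S"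
    and P: "ideal P R" and f: "f \<in> carrier R" "\<And>n::nat. f [^]\<^bsub>R\<^esub> n \<notin> P"
  obtains \<eta> where "\<eta> \<in> ring_hom R K" "\<And>k. k \<in> carrier K \<Longrightarrow> \<eta> (\<beta> k) = k"
    "\<And>x. x \<in> P \<Longrightarrow> \<eta> x = \<zero>\<^bsub>K\<^esub>" "\<eta> f \<noteq> \<zero>\<^bsub>K\<^esub>"
proof -
  interpret K: algebraically_closed K by fact
  interpret R: cring R by fact
  obtain M where M: "ideal M R" "P \<subseteq> M" and fM: "\<And>n::nat. f [^]\<^bsub>R\<^esub> n \<notin> M"
    and max: "\<And>J. ideal J R \<Longrightarrow> M \<subseteq> J \<Longrightarrow> (\<And>n::nat. f [^]\<^bsub>R\<^esub> n \<notin> J) \<Longrightarrow> J = M"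
    using R.exists_ideal_maximal_avoiding_powers[OF P f(2)] by blast
  interpret M: ideal M R by fact
  interpret q: ring_hom_ring R "R Quot M" "(+>\<^bsub>R\<^esub>) M" by (rule M.rcos_ring_hom_ring)
  interpret D: cring "R Quot M" by (rule M.quotient_is_cring[OF R])
  note zero_iff = M.quot_zero_iff
  have surj: "\<exists>x\<in>carrier R. Z = M +>\<^bsub>R\<^esub> x" if "Z \<in> carrier (R Quot M)" for Z
    using that unfolding M.quot_carrier by blast
  \<comment> \<open>If \<open>x\<close> is not in \<open>M\<close>, then \<open>M + (x)\<close> is
    strictly larger, so by maximality it contains a power of \<open>f\<close>. Modulo
    \<open>M\<close> this power becomes a multiple of the class of \<open>x\<close>.\<close>
  have ndvd: "\<exists>n::nat. \<exists>U\<in>carrier (R Quot M). Z \<otimes>\<^bsub>R Quot M\<^esub> U = (M +>\<^bsub>R\<^esub> f) [^]\<^bsub>R Quot M\<^esub> n"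
    if Z: "Z \<in> carrier (R Quot M)" "Z \<noteq> \<zero>\<^bsub>R Quot M\<^esub>" for Z
  proof -
    obtain x where x: "x \<in> carrier R" "Z = M +>\<^bsub>R\<^esub> x" using surj Z by blast
    then have xM: "x \<notin> M" using Z zero_iff by simp
    define J where "J = M <+>\<^bsub>R\<^esub> PIdl\<^bsub>R\<^esub> x"
    have J: "ideal J R"
      unfolding J_def by (intro R.add_ideals M R.cgenideal_ideal x)
    have Px: "ideal (PIdl\<^bsub>R\<^esub> x) R" by (rule R.cgenideal_ideal[OF x(1)])
    have zP: "\<zero>\<^bsub>R\<^esub> \<in> PIdl\<^bsub>R\<^esub> x"
      by (rule additive_subgroup.zero_closed[OF ideal.axioms(1)[OF Px]])
    have "M \<subseteq> J"
    proof
      fix y assume "y \<in> M"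
      then have "y \<oplus>\<^bsub>R\<^esub> \<zero>\<^bsub>R\<^esub> \<in> J" unfolding J_def set_add_def' using zP by blast
      then show "y \<in> J" using \<open>y \<in> M\<close> M.a_Hcarr by simp
    qed
    moreover have "x \<in> J"
    proof -
      have "\<zero>\<^bsub>R\<^esub> \<oplus>\<^bsub>R\<^esub> x \<in> J"
        unfolding J_def set_add_def' using R.cgenideal_self[OF x(1)] M.zero_closed by blast
      then show ?thesis using x(1) by simp
    qed
    ultimately obtain n :: nat where "f [^]\<^bsub>R\<^esub> n \<in> J" using max[OF J] xM by blast
    then obtain y a where y: "y \<in> M" "a \<in> carrier R" "f [^]\<^bsub>R\<^esub> n = y \<oplus>\<^bsub>R\<^esub> a \<otimes>\<^bsub>R\<^esub> x"
      unfolding J_def set_add_def' cgenideal_def by auto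
    have "(M +>\<^bsub>R\<^esub> f) [^]\<^bsub>R Quot M\<^esub> n = M +>\<^bsub>R\<^esub> (f [^]\<^bsub>R\<^esub> n)"
      using f(1) by (simp add: q.hom_nat_pow)
    also have "\<dots> = (M +>\<^bsub>R\<^esub> a) \<otimes>\<^bsub>R Quot M\<^esub> Z"
      using y x M.a_Hcarr[OF y(1)] zero_iff[of y] by (simp add: q.hom_add q.hom_mult)
    also have "\<dots> = Z \<otimes>\<^bsub>R Quot M\<^esub> (M +>\<^bsub>R\<^esub> a)"
      using Z y(2) by (intro D.m_comm) auto
    finally show ?thesis using y(2) q.hom_closed by metis
  qed
  have fn: "(M +>\<^bsub>R\<^esub> f) [^]\<^bsub>R Quot M\<^esub> n \<noteq> \<zero>\<^bsub>R Quot M\<^esub>" for n :: nat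
    using fM[of n] zero_iff[of "f [^]\<^bsub>R\<^esub> n"] f(1) by (simp add: q.hom_nat_pow[symmetric])
  \<comment> \<open>Two nonzero classes each divide a power of \<open>f\<close>, so their product
    divides a power of \<open>f\<close> too; that power is nonzero because \<open>M\<close> avoids
    it.\<close>
  have D: "domain (R Quot M)"
  proof (intro domain.intro domain_axioms.intro D.cring_axioms)
    show "\<one>\<^bsub>R Quot M\<^esub> \<noteq> \<zero>\<^bsub>R Quot M\<^esub>" using fn[of 0] by simp
  next
    fix Z Y assume XY: "Z \<otimes>\<^bsub>R Quot M\<^esub> Y = \<zero>\<^bsub>R Quot M\<^esub>"
      and Z: "Z \<in> carrier (R Quot M)" and Y: "Y \<in> carrier (R Quot M)"
    show "Z = \<zero>\<^bsub>R Quot M\<^esub> \<or> Y = \<zero>\<^bsub>R Quot M\<^esub>"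
    proof (rule ccontr)
      assume "\<not> ?thesis"
      then obtain n m :: nat and U V where U: "U \<in> carrier (R Quot M)" "Z \<otimes>\<^bsub>R Quot M\<^esub> U = (M +>\<^bsub>R\<^esub> f) [^]\<^bsub>R Quot M\<^esub> n"
        and V: "V \<in> carrier (R Quot M)" "Y \<otimes>\<^bsub>R Quot M\<^esub> V = (M +>\<^bsub>R\<^esub> f) [^]\<^bsub>R Quot M\<^esub> m"
        using ndvd Z Y by metis
      have "(M +>\<^bsub>R\<^esub> f) [^]\<^bsub>R Quot M\<^esub> (n + m) = (Z \<otimes>\<^bsub>R Quot M\<^esub> U) \<otimes>\<^bsub>R Quot M\<^esub> (Y \<otimes>\<^bsub>R Quot M\<^esub> V)"
        using U V f(1) by (simp add: q.S.nat_pow_mult)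
      also have "\<dots> = (Z \<otimes>\<^bsub>R Quot M\<^esub> Y) \<otimes>\<^bsub>R Quot M\<^esub> (U \<otimes>\<^bsub>R Quot M\<^esub> V)"
        using Z Y U(1) V(1) by (simp add: D.m_ac)
      also have "\<dots> = \<zero>\<^bsub>R Quot M\<^esub>" using U V XY by simp
      finally show False using fn by blast
    qed
  qed
  interpret D: domain "R Quot M" by fact
  define \<gamma> where "\<gamma> = (\<lambda>k. M +>\<^bsub>R\<^esub> \<beta> k)"
  have \<gamma>: "\<gamma> \<in> ring_hom K (R Quot M)"
    using ring_hom_trans[OF \<beta> q.homh] by (simp add: \<gamma>_def o_def)
  interpret h: ring_hom_ring K "R Quot M" \<gamma>
    by (rule ring_hom_ringI2[OF K.ring_axioms q.S.ring_axioms \<gamma>])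
  have \<beta>_in: "\<beta> ` carrier K \<subseteq> carrier R" using \<beta> by (auto simp: ring_hom_def)
  have "\<exists>a\<in>carrier K. Z = \<gamma> a" if Z: "Z \<in> carrier (R Quot M)" for Z
  proof (rule alg_closed_hom_surj[OF K unc D \<gamma> _ _ _ _ _ ndvd Z])
    show "countable ((+>\<^bsub>R\<^esub>) M ` S)" using S by simp
    show "(+>\<^bsub>R\<^esub>) M ` S \<subseteq> carrier (R Quot M)" using S by auto
    have "(+>\<^bsub>R\<^esub>) M ` \<beta> ` carrier K = \<gamma> ` carrier K" by (auto simp: \<gamma>_def)
    then show "carrier (R Quot M) \<subseteq> lin_span (R Quot M) (\<gamma> ` carrier K) ((+>\<^bsub>R\<^esub>) M ` S)"
      using q.lin_span_hom[OF \<beta>_in S(2)] span unfolding M.quot_carrier by auto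
  qed (use f fn[of 1] in auto)
  then have img: "\<gamma> ` carrier K = carrier (R Quot M)" using h.hom_closed by blast
  have inj: "inj_on \<gamma> (carrier K)"
    using h.img_is_subfield(1)[OF K.carrier_is_subfield D.one_not_zero] .
  have "\<gamma> \<in> ring_iso K (R Quot M)"
    using \<gamma> inj img by (simp add: ring_iso_def bij_betw_def)
  then have inv: "inv_into (carrier K) \<gamma> \<in> ring_hom (R Quot M) K"
    using ring_iso_set_sym[OF K.ring_axioms] by (auto simp: ring_iso_def)
  interpret i: ring_hom_ring "R Quot M" K "inv_into (carrier K) \<gamma>"
    by (rule ring_hom_ringI2[OF q.S.ring_axioms K.ring_axioms inv])
  \<comment> \<open>The scalars already fill the whole quotient, so \<open>\<gamma>\<close>
    identifies it with \<open>K\<close>, and reducing modulo \<open>M\<close> becomes a homomorphism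
    to \<open>K\<close> that fixes the scalars.\<close>
  define \<eta> where "\<eta> = inv_into (carrier K) \<gamma> \<circ> (+>\<^bsub>R\<^esub>) M"
  show thesis
  proof (rule that[of \<eta>])
    show "\<eta> \<in> ring_hom R K" unfolding \<eta>_def by (rule ring_hom_trans[OF q.homh inv])
    show "\<eta> (\<beta> k) = k" if "k \<in> carrier K" for k
      using inv_into_f_f[OF inj that] by (simp add: \<eta>_def \<gamma>_def)
    show "\<eta> x = \<zero>\<^bsub>K\<^esub>" if "x \<in> P" for x
    proof -
      have "x \<in> M" using M that by auto
      then have "M +>\<^bsub>R\<^esub> x = \<zero>\<^bsub>R Quot M\<^esub>" using zero_iff M.a_Hcarr by auto
      then show ?thesis using i.hom_zero by (simp add: \<eta>_def)
    qed
    show "\<eta> f \<noteq> \<zero>\<^bsub>K\<^esub>"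
    proof
      assume "\<eta> f = \<zero>\<^bsub>K\<^esub>"
      then have "\<gamma> (\<eta> f) = \<zero>\<^bsub>R Quot M\<^esub>" by simp
      moreover have "\<gamma> (\<eta> f) = M +>\<^bsub>R\<^esub> f"
        unfolding \<eta>_def using f(1) img by (auto intro!: f_inv_into_f)
      ultimately show False using fn[of 1] f(1) by simp
    qed
  qed
qed

section \<open>Tensor products of commutative rings\<close>

lemma (in ideal) quot_minus_mem_iff:
  assumes "x \<in> carrier R" "y \<in> carrier R"
  shows "I +> x = I +> y \<longleftrightarrow> x \<ominus> y \<in> I"
  using quotient_eq_iff_same_a_r_cos[OF ideal_axioms assms] by blast

lemma a_kernel_mem_iff: "x \<in> a_kernel R S h \<longleftrightarrow> x \<in> carrier R \<and> h x = \<zero>\<^bsub>S\<^esub>"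
  by (simp add: a_kernel_def')

lemma (in ring_hom_ring) kernel_coset_eq_iff:
  assumes "x \<in> carrier R" "y \<in> carrier R"
  shows "a_kernel R S h +>\<^bsub>R\<^esub> x = a_kernel R S h +>\<^bsub>R\<^esub> y \<longleftrightarrow> h x = h y"
proof -
  have "h (x \<ominus>\<^bsub>R\<^esub> y) = h x \<ominus>\<^bsub>S\<^esub> h y"
    using assms by (simp add: R.minus_eq S.minus_eq)
  then show ?thesis
    unfolding ideal.quot_minus_mem_iff[OF kernel_is_ideal assms] a_kernel_mem_iff
    using assms by simp
qed

lemma (in ring_hom_ring) quot_lift:
  assumes I: "ideal I R" and ker: "\<And>x. x \<in> I \<Longrightarrow> h x = \<zero>\<^bsub>S\<^esub>"
  shows "\<exists>\<eta>\<in>ring_hom (R Quot I) S. \<forall>x\<in>carrier R. \<eta> (I +> x) = h x"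
proof -
  interpret I: ideal I R by fact
  define \<eta> where "\<eta> Z = h (SOME x. x \<in> carrier R \<and> Z = I +> x)" for Z
  have \<eta>: "\<eta> (I +> x) = h x" if x: "x \<in> carrier R" for x
  proof -
    define y where "y = (SOME y. y \<in> carrier R \<and> I +> x = I +> y)"
    have "y \<in> carrier R \<and> I +> x = I +> y"
      unfolding y_def by (rule someI[of _ x]) (use x in simp)
    then have y: "y \<in> carrier R" "x \<ominus> y \<in> I" using I.quot_minus_mem_iff[OF x] by auto
    then have "h x \<ominus>\<^bsub>S\<^esub> h y = \<zero>\<^bsub>S\<^esub>" using ker[OF y(2)] x by (simp add: R.minus_eq S.minus_eq)
    then have "h x = h y" using x y by simp
    then show ?thesis by (simp add: \<eta>_def y_def)
  qed
  have "\<eta> \<in> ring_hom (R Quot I) S"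
  proof (rule ring_hom_memI)
    fix Z assume "Z \<in> carrier (R Quot I)"
    then show "\<eta> Z \<in> carrier S" by (auto simp: I.quot_carrier \<eta>)
  next
    fix Z Y assume "Z \<in> carrier (R Quot I)" "Y \<in> carrier (R Quot I)"
    then obtain x y where xy: "x \<in> carrier R" "y \<in> carrier R" "Z = I +> x" "Y = I +> y"
      by (auto simp: I.quot_carrier)
    show "\<eta> (Z \<otimes>\<^bsub>R Quot I\<^esub> Y) = \<eta> Z \<otimes>\<^bsub>S\<^esub> \<eta> Y"
      using xy \<eta> by (simp add: FactRing_def I.rcoset_mult_add)
    show "\<eta> (Z \<oplus>\<^bsub>R Quot I\<^esub> Y) = \<eta> Z \<oplus>\<^bsub>S\<^esub> \<eta> Y"
      using xy \<eta> by (simp add: FactRing_def I.a_rcos_sum)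
  next
    show "\<eta> \<one>\<^bsub>R Quot I\<^esub> = \<one>\<^bsub>S\<^esub>" using \<eta>[of "\<one>"] by (simp add: FactRing_def)
  qed
  with \<eta> show ?thesis by blast
qed

text \<open>Elements of one coset of \<open>I\<close> lie in a single coset of the larger ideal, so
  all members of the union coincide. This is why the union in \<open>ambient_to_param\<close> is a
  well-defined map of quotients.\<close>

lemma (in ring) quot_coarsen:
  assumes I: "ideal I R" and J: "ideal J R" and IJ: "I \<subseteq> J" and x: "x \<in> carrier R"
  shows "(\<Union>y\<in>I +> x. J +> y) = J +> x"
proof -
  interpret I: ideal I R by fact
  interpret J: ideal J R by fact
  have "J +> y = J +> x" if "y \<in> I +> x" for y
  proof -
    have y: "y \<in> carrier R" using that a_r_coset_subset_G[OF I.a_subset x] by blast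
    have "I +> y = I +> x" using a_repr_independence[OF that x I.a_subgroup] by simp
    then show ?thesis using I.quot_minus_mem_iff[OF y x] J.quot_minus_mem_iff[OF y x] IJ by blast
  qed
  moreover have "x \<in> I +> x" by (rule I.a_rcos_self[OF x])
  ultimately show ?thesis by blast
qed

lemma (in ring) quot_coarsen_hom:
  assumes I: "ideal I R" and J: "ideal J R" and IJ: "I \<subseteq> J"
  shows "(\<lambda>Z. \<Union>y\<in>Z. J +> y) \<in> ring_hom (R Quot I) (R Quot J)"
proof -
  interpret I: ideal I R by fact
  interpret J: ideal J R by fact
  show ?thesis
  proof (rule ring_hom_memI)
    fix Z assume "Z \<in> carrier (R Quot I)"
    then show "(\<Union>y\<in>Z. J +> y) \<in> carrier (R Quot J)"
      using quot_coarsen[OF I J IJ] by (auto simp: I.quot_carrier J.quot_carrier)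
  next
    fix Z Y assume "Z \<in> carrier (R Quot I)" "Y \<in> carrier (R Quot I)"
    then obtain x y where xy: "x \<in> carrier R" "y \<in> carrier R" "Z = I +> x" "Y = I +> y"
      by (auto simp: I.quot_carrier)
    show "(\<Union>y\<in>Z \<otimes>\<^bsub>R Quot I\<^esub> Y. J +> y) = (\<Union>y\<in>Z. J +> y) \<otimes>\<^bsub>R Quot J\<^esub> (\<Union>y\<in>Y. J +> y)"
      using xy quot_coarsen[OF I J IJ]
      by (simp add: FactRing_def I.rcoset_mult_add J.rcoset_mult_add)
    show "(\<Union>y\<in>Z \<oplus>\<^bsub>R Quot I\<^esub> Y. J +> y) = (\<Union>y\<in>Z. J +> y) \<oplus>\<^bsub>R Quot J\<^esub> (\<Union>y\<in>Y. J +> y)"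
      using xy quot_coarsen[OF I J IJ]
      by (simp add: FactRing_def I.a_rcos_sum J.a_rcos_sum)
  next
    show "(\<Union>y\<in>\<one>\<^bsub>R Quot I\<^esub>. J +> y) = \<one>\<^bsub>R Quot J\<^esub>"
      using quot_coarsen[OF I J IJ one_closed] by (simp add: FactRing_def)
  qed
qed

text \<open>Stated with closure of the carrier in place of the ring axioms, because
  \<open>frac_field_closed\<close> supplies exactly these properties for fields of
  fractions.\<close>

lemma restrict_ring_hom:
  assumes "f \<in> ring_hom R S"
    and "\<one>\<^bsub>R\<^esub> \<in> carrier R"
    and "\<And>x y. x \<in> carrier R \<Longrightarrow> y \<in> carrier R \<Longrightarrow> x \<otimes>\<^bsub>R\<^esub> y \<in> carrier R"
    and "\<And>x y. x \<in> carrier R \<Longrightarrow> y \<in> carrier R \<Longrightarrow> x \<oplus>\<^bsub>R\<^esub> y \<in> carrier R"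
  shows "restrict f (carrier R) \<in> ring_hom R S"
  using assms by (auto simp: ring_hom_def)

section \<open>The free ring on pairs\<close>

lemma frag_extend_fun_diff:
  "frag_extend (\<lambda>p. f p - g p) x = frag_extend f x - frag_extend g x"
proof -
  have "frag_cmul k (a - b) = frag_cmul k a - frag_cmul k b" for k and a b :: "'a \<Rightarrow>\<^sub>0 int"
    using frag_cmul_distrib2[of k "a - b" b] by simp
  then show ?thesis by (simp add: frag_extend_def sum_subtractf)
qed

text \<open>Differences instead of sums, to match \<open>tensor_free_induct\<close>, which builds
  the free group from its generators by subtraction. The rules for zero then follow from
  \<open>0 = z - z\<close>.\<close>

lemma tensor_free_mult_diff_left:
  "(x - y) \<otimes>\<^bsub>tensor_free A B\<^esub> z = x \<otimes>\<^bsub>tensor_free A B\<^esub> z - y \<otimes>\<^bsub>tensor_free A B\<^esub> z"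
  by (simp add: tensor_free_def frag_extend_diff)

lemma tensor_free_mult_diff_right:
  "z \<otimes>\<^bsub>tensor_free A B\<^esub> (x - y) = z \<otimes>\<^bsub>tensor_free A B\<^esub> x - z \<otimes>\<^bsub>tensor_free A B\<^esub> y"
  by (simp add: tensor_free_def frag_extend_diff case_prod_unfold frag_extend_fun_diff)

lemma tensor_free_mult_zero_left: "0 \<otimes>\<^bsub>tensor_free A B\<^esub> z = 0"
  using tensor_free_mult_diff_left[of A B z z z] by simp

lemma tensor_free_mult_zero_right: "z \<otimes>\<^bsub>tensor_free A B\<^esub> 0 = 0"
  using tensor_free_mult_diff_right[of A B z z z] by simp

lemma tensor_free_mult_frag_of:
  "frag_of (a, b) \<otimes>\<^bsub>tensor_free A B\<^esub> frag_of (a', b') = frag_of (a \<otimes>\<^bsub>A\<^esub> a', b \<otimes>\<^bsub>B\<^esub> b')"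
  by (simp add: tensor_free_def)

lemmas tensor_free_mult_simps = tensor_free_mult_diff_left tensor_free_mult_diff_right
  tensor_free_mult_zero_left tensor_free_mult_zero_right tensor_free_mult_frag_of

lemma tensor_free_simps:
  "carrier (tensor_free A B) = {x. Poly_Mapping.keys x \<subseteq> carrier A \<times> carrier B}"
  "\<one>\<^bsub>tensor_free A B\<^esub> = frag_of (\<one>\<^bsub>A\<^esub>, \<one>\<^bsub>B\<^esub>)"
  "\<zero>\<^bsub>tensor_free A B\<^esub> = 0"
  "x \<oplus>\<^bsub>tensor_free A B\<^esub> y = x + y"
  by (simp_all add: tensor_free_def)

lemma tensor_free_induct [consumes 1, case_names zero pure diff]:
  assumes "x \<in> carrier (tensor_free A B)" "P 0"
    and "\<And>a b. a \<in> carrier A \<Longrightarrow> b \<in> carrier B \<Longrightarrow> P (frag_of (a, b))"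
    and "\<And>x y. x \<in> carrier (tensor_free A B) \<Longrightarrow> y \<in> carrier (tensor_free A B) \<Longrightarrow>
      P x \<Longrightarrow> P y \<Longrightarrow> P (x - y)"
  shows "P x"
proof -
  have "Poly_Mapping.keys x \<subseteq> carrier A \<times> carrier B"
    using assms(1) by (simp add: tensor_free_simps)
  then show ?thesis
    by (induction x rule: free_Abelian_group_induct) (use assms in \<open>auto simp: tensor_free_simps\<close>)
qed

text \<open>Multiplication is additive in each argument, so nested inductions reduce commutativity
  and associativity to generators, where they are the laws of \<open>A\<close> and \<open>B\<close>
  in each component.\<close>

lemma tensor_free_cring:
  assumes "cring A" "cring B"
  shows "cring (tensor_free A B)"
proof -
  interpret A: cring A by fact
  interpret B: cring B by fact
  let ?W = "tensor_free A B"
  have comm: "x \<otimes>\<^bsub>?W\<^esub> y = y \<otimes>\<^bsub>?W\<^esub> x" if "x \<in> carrier ?W" "y \<in> carrier ?W" for x y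
    using that(1)
  proof (induction rule: tensor_free_induct)
    case (pure a b)
    show ?case using that(2)
      by (induction rule: tensor_free_induct)
        (use pure in \<open>auto simp: tensor_free_mult_simps A.m_comm B.m_comm\<close>)
  qed (auto simp: tensor_free_mult_simps)
  have closed: "x \<otimes>\<^bsub>?W\<^esub> y \<in> carrier ?W" if "x \<in> carrier ?W" "y \<in> carrier ?W" for x y
    using that(1)
  proof (induction rule: tensor_free_induct)
    case (pure a b)
    show ?case using that(2)
      by (induction rule: tensor_free_induct)
        (use pure keys_diff in \<open>force simp: tensor_free_mult_simps tensor_free_simps\<close>)+
  qed (use keys_diff in \<open>force simp: tensor_free_mult_simps tensor_free_simps\<close>)+
  have assoc: "x \<otimes>\<^bsub>?W\<^esub> y \<otimes>\<^bsub>?W\<^esub> z = x \<otimes>\<^bsub>?W\<^esub> (y \<otimes>\<^bsub>?W\<^esub> z)"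
    if "x \<in> carrier ?W" "y \<in> carrier ?W" "z \<in> carrier ?W" for x y z
    using that(1)
  proof (induction rule: tensor_free_induct)
    case (pure a b)
    show ?case using that(2)
    proof (induction rule: tensor_free_induct)
      case (pure a' b')
      show ?case using that(3)
        by (induction rule: tensor_free_induct)
          (use pure \<open>a \<in> carrier A\<close> \<open>b \<in> carrier B\<close> in \<open>auto simp: tensor_free_mult_simps A.m_assoc B.m_assoc\<close>)
    qed (auto simp: tensor_free_mult_simps)
  qed (auto simp: tensor_free_mult_simps)
  have one: "\<one>\<^bsub>?W\<^esub> \<otimes>\<^bsub>?W\<^esub> x = x" if "x \<in> carrier ?W" for x
    using that by (induction rule: tensor_free_induct) (auto simp: tensor_free_mult_simps tensor_free_simps)
  have distr: "(x + y) \<otimes>\<^bsub>?W\<^esub> z = x \<otimes>\<^bsub>?W\<^esub> z + y \<otimes>\<^bsub>?W\<^esub> z" for x y z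
    using tensor_free_mult_diff_left[of A B "x + y" y z] by simp
  show ?thesis
  proof (rule cringI)
    show "abelian_group ?W"
    proof (rule abelian_groupI)
      fix x assume "x \<in> carrier ?W"
      then show "\<exists>y\<in>carrier ?W. y \<oplus>\<^bsub>?W\<^esub> x = \<zero>\<^bsub>?W\<^esub>"
        by (intro bexI[of _ "- x"]) (auto simp: tensor_free_simps)
    qed (use keys_add in \<open>force simp: tensor_free_simps\<close>)+
    show "comm_monoid ?W"
      by (rule comm_monoidI) (use comm closed assoc one in \<open>auto simp: tensor_free_simps(1,2)\<close>)
  qed (simp add: tensor_free_simps distr)
qed

lemma tensor_free_minus:
  assumes "cring A" "cring B" "x \<in> carrier (tensor_free A B)" "y \<in> carrier (tensor_free A B)"
  shows "x \<ominus>\<^bsub>tensor_free A B\<^esub> y = x - y"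
proof -
  interpret W: cring "tensor_free A B" by (rule tensor_free_cring) fact+
  have "- y \<in> carrier (tensor_free A B)" using assms by (simp add: tensor_free_simps)
  then have "\<ominus>\<^bsub>tensor_free A B\<^esub> y = - y"
    using assms by (intro W.minus_equality) (simp_all add: tensor_free_simps)
  then show ?thesis by (simp add: W.minus_eq tensor_free_simps)
qed

section \<open>The tensor product and its universal property\<close>

locale tensor_product = A: cring A + B: cring B
  for R :: "('r, 'l) ring_scheme" and \<phi> :: "'r \<Rightarrow> 'a" and \<psi> :: "'r \<Rightarrow> 'b"
    and A :: "('a, 'm) ring_scheme" and B :: "('b, 'n) ring_scheme" +
  assumes \<phi>_closed: "r \<in> carrier R \<Longrightarrow> \<phi> r \<in> carrier A"
    and \<psi>_closed: "r \<in> carrier R \<Longrightarrow> \<psi> r \<in> carrier B"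
begin

abbreviation "W \<equiv> tensor_free A B"
abbreviation "J \<equiv> tensor_ideal R \<phi> \<psi> A B"
abbreviation "T \<equiv> tensor R \<phi> \<psi> A B"
abbreviation "pure \<equiv> pure_tensor R \<phi> \<psi> A B"

sublocale W: cring W
  by (rule tensor_free_cring[OF A.cring_axioms B.cring_axioms])

lemma frag_of_in_carrier: "a \<in> carrier A \<Longrightarrow> b \<in> carrier B \<Longrightarrow> frag_of (a, b) \<in> carrier W"
  by (simp add: tensor_free_simps)

lemma diff_in_carrier: "x \<in> carrier W \<Longrightarrow> y \<in> carrier W \<Longrightarrow> x - y \<in> carrier W"
  using tensor_free_minus[OF A.cring_axioms B.cring_axioms] W.minus_closed by metis

lemma relations_in_carrier: "tensor_relations R \<phi> \<psi> A B \<subseteq> carrier W"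
  unfolding tensor_relations_def
  by (auto intro!: diff_in_carrier frag_of_in_carrier \<phi>_closed \<psi>_closed)

sublocale J: ideal J W
  unfolding tensor_ideal_def by (rule W.genideal_ideal[OF relations_in_carrier])

lemma relation_in_ideal: "x \<in> tensor_relations R \<phi> \<psi> A B \<Longrightarrow> x \<in> J"
  unfolding tensor_ideal_def using W.genideal_self[OF relations_in_carrier] by blast

lemma tensor_cring: "cring T"
  unfolding tensor_def by (rule J.quotient_is_cring[OF W.cring_axioms])

sublocale T: cring T by (rule tensor_cring)

lemma coset_hom: "(+>\<^bsub>W\<^esub>) J \<in> ring_hom W T"
  unfolding tensor_def by (rule J.rcos_ring_hom)

lemma tensor_carrier: "carrier T = (+>\<^bsub>W\<^esub>) J ` carrier W"
  unfolding tensor_def by (rule J.quot_carrier)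

lemma coset_eqI:
  assumes "x \<in> carrier W" "y \<in> carrier W" "x - y \<in> J"
  shows "J +>\<^bsub>W\<^esub> x = J +>\<^bsub>W\<^esub> y"
  using J.quot_minus_mem_iff[OF assms(1,2)] tensor_free_minus[OF A.cring_axioms B.cring_axioms assms(1,2)] assms(3)
  by simp

lemma pure_closed [simp]: "a \<in> carrier A \<Longrightarrow> b \<in> carrier B \<Longrightarrow> pure a b \<in> carrier T"
  unfolding pure_tensor_def by (rule ring_hom_closed[OF coset_hom frag_of_in_carrier])

lemma pure_mult:
  assumes "a \<in> carrier A" "b \<in> carrier B" "a' \<in> carrier A" "b' \<in> carrier B"
  shows "pure a b \<otimes>\<^bsub>T\<^esub> pure a' b' = pure (a \<otimes>\<^bsub>A\<^esub> a') (b \<otimes>\<^bsub>B\<^esub> b')"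
  unfolding pure_tensor_def
  using ring_hom_mult[OF coset_hom frag_of_in_carrier[OF assms(1,2)] frag_of_in_carrier[OF assms(3,4)]]
  by (simp add: tensor_free_mult_simps)

lemma pure_one: "pure \<one>\<^bsub>A\<^esub> \<one>\<^bsub>B\<^esub> = \<one>\<^bsub>T\<^esub>"
  unfolding pure_tensor_def using ring_hom_one[OF coset_hom] by (simp add: tensor_free_simps)

lemma pure_add_left:
  assumes "a \<in> carrier A" "a' \<in> carrier A" "b \<in> carrier B"
  shows "pure (a \<oplus>\<^bsub>A\<^esub> a') b = pure a b \<oplus>\<^bsub>T\<^esub> pure a' b"
proof -
  have "frag_of (a \<oplus>\<^bsub>A\<^esub> a', b) - frag_of (a, b) - frag_of (a', b) \<in> J"
    by (rule relation_in_ideal) (use assms in \<open>auto simp: tensor_relations_def\<close>)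
  then have "frag_of (a \<oplus>\<^bsub>A\<^esub> a', b) - (frag_of (a, b) \<oplus>\<^bsub>W\<^esub> frag_of (a', b)) \<in> J"
    by (simp add: tensor_free_simps algebra_simps)
  then have "J +>\<^bsub>W\<^esub> frag_of (a \<oplus>\<^bsub>A\<^esub> a', b) = J +>\<^bsub>W\<^esub> (frag_of (a, b) \<oplus>\<^bsub>W\<^esub> frag_of (a', b))"
    by (intro coset_eqI) (use assms frag_of_in_carrier in auto)
  then show ?thesis
    unfolding pure_tensor_def using ring_hom_add[OF coset_hom] assms frag_of_in_carrier by simp
qed

lemma pure_add_right:
  assumes "a \<in> carrier A" "b \<in> carrier B" "b' \<in> carrier B"
  shows "pure a (b \<oplus>\<^bsub>B\<^esub> b') = pure a b \<oplus>\<^bsub>T\<^esub> pure a b'"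
proof -
  have "frag_of (a, b \<oplus>\<^bsub>B\<^esub> b') - frag_of (a, b) - frag_of (a, b') \<in> J"
    by (rule relation_in_ideal) (use assms in \<open>auto simp: tensor_relations_def\<close>)
  then have "frag_of (a, b \<oplus>\<^bsub>B\<^esub> b') - (frag_of (a, b) \<oplus>\<^bsub>W\<^esub> frag_of (a, b')) \<in> J"
    by (simp add: tensor_free_simps algebra_simps)
  then have "J +>\<^bsub>W\<^esub> frag_of (a, b \<oplus>\<^bsub>B\<^esub> b') = J +>\<^bsub>W\<^esub> (frag_of (a, b) \<oplus>\<^bsub>W\<^esub> frag_of (a, b'))"
    by (intro coset_eqI) (use assms frag_of_in_carrier in auto)
  then show ?thesis
    unfolding pure_tensor_def using ring_hom_add[OF coset_hom] assms frag_of_in_carrier by simp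
qed

lemma pure_balanced:
  assumes "r \<in> carrier R" "a \<in> carrier A" "b \<in> carrier B"
  shows "pure (\<phi> r \<otimes>\<^bsub>A\<^esub> a) b = pure a (\<psi> r \<otimes>\<^bsub>B\<^esub> b)"
  unfolding pure_tensor_def
proof (rule coset_eqI)
  show "frag_of (\<phi> r \<otimes>\<^bsub>A\<^esub> a, b) - frag_of (a, \<psi> r \<otimes>\<^bsub>B\<^esub> b) \<in> J"
    by (rule relation_in_ideal) (use assms in \<open>auto simp: tensor_relations_def\<close>)
qed (use assms \<phi>_closed \<psi>_closed frag_of_in_carrier in auto)

lemma pure_hom_left: "(\<lambda>a. pure a \<one>\<^bsub>B\<^esub>) \<in> ring_hom A T"
  by (rule ring_hom_memI) (auto simp: pure_mult pure_one pure_add_left)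

lemma pure_hom_right: "(\<lambda>b. pure \<one>\<^bsub>A\<^esub> b) \<in> ring_hom B T"
  by (rule ring_hom_memI) (auto simp: pure_mult pure_one pure_add_right)

lemma tensor_induct [consumes 1, case_names zero pure diff]:
  assumes Z: "Z \<in> carrier T" and z: "P \<zero>\<^bsub>T\<^esub>"
    and p: "\<And>a b. a \<in> carrier A \<Longrightarrow> b \<in> carrier B \<Longrightarrow> P (pure a b)"
    and d: "\<And>x y. x \<in> carrier T \<Longrightarrow> y \<in> carrier T \<Longrightarrow> P x \<Longrightarrow> P y \<Longrightarrow> P (x \<ominus>\<^bsub>T\<^esub> y)"
  shows "P Z"
proof -
  interpret q: ring_hom_ring W T "(+>\<^bsub>W\<^esub>) J"
    by (rule ring_hom_ringI2[OF W.ring_axioms T.ring_axioms coset_hom])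
  obtain x where x: "x \<in> carrier W" "Z = J +>\<^bsub>W\<^esub> x" using Z by (auto simp: tensor_carrier)
  have "P (J +>\<^bsub>W\<^esub> x)"
    using x(1)
  proof (induction rule: tensor_free_induct)
    case zero
    then show ?case using q.hom_zero z by (simp add: tensor_free_simps)
  next
    case (pure a b)
    then show ?case using p by (simp add: pure_tensor_def)
  next
    case (diff x y)
    have "J +>\<^bsub>W\<^esub> (x - y) = (J +>\<^bsub>W\<^esub> x) \<ominus>\<^bsub>T\<^esub> (J +>\<^bsub>W\<^esub> y)"
      using diff tensor_free_minus[OF A.cring_axioms B.cring_axioms diff(1,2), symmetric]
      by (simp add: W.minus_eq T.minus_eq)
    then show ?case using diff d by simp
  qed
  then show ?thesis using x by simp
qed

text \<open>Freeness extends the map \<open>(a, b) \<mapsto> \<alpha> a \<cdot> \<kappa> b\<close>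
  additively to \<open>ev\<close>. It is multiplicative because this holds on generators,
  \<open>C\<close> being commutative. Additivity of \<open>\<alpha>\<close> and
  \<open>\<kappa>\<close> kills the first two families of relations, and \<open>compat\<close> kills
  the third.\<close>

lemma tensor_lift:
  assumes C: "cring C" and \<alpha>: "\<alpha> \<in> ring_hom A C" and \<kappa>: "\<kappa> \<in> ring_hom B C"
    and compat: "\<And>r. r \<in> carrier R \<Longrightarrow> \<alpha> (\<phi> r) = \<kappa> (\<psi> r)"
  shows "\<exists>\<eta>\<in>ring_hom T C. \<forall>a\<in>carrier A. \<forall>b\<in>carrier B. \<eta> (pure a b) = \<alpha> a \<otimes>\<^bsub>C\<^esub> \<kappa> b"
proof -
  interpret C: cring C by fact
  interpret \<alpha>: ring_hom_ring A C \<alpha> by (rule ring_hom_ringI2[OF A.ring_axioms C.ring_axioms \<alpha>])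
  interpret \<kappa>: ring_hom_ring B C \<kappa> by (rule ring_hom_ringI2[OF B.ring_axioms C.ring_axioms \<kappa>])
  obtain ev where ev: "ev \<in> hom (free_Abelian_group (carrier A \<times> carrier B)) (add_monoid C)"
    and ev_of: "\<And>p. p \<in> carrier A \<times> carrier B \<Longrightarrow> ev (frag_of p) = \<alpha> (fst p) \<otimes>\<^bsub>C\<^esub> \<kappa> (snd p)"
    by (rule comm_group.free_Abelian_group_universal[OF C.a_comm_group,
          of "\<lambda>p. \<alpha> (fst p) \<otimes>\<^bsub>C\<^esub> \<kappa> (snd p)" "carrier A \<times> carrier B"]) auto
  have ev_in: "ev x \<in> carrier C" if "x \<in> carrier W" for x
    using ev that by (auto simp: hom_def tensor_free_simps free_Abelian_group_def)
  have ev_add: "ev (x + y) = ev x \<oplus>\<^bsub>C\<^esub> ev y" if "x \<in> carrier W" "y \<in> carrier W" for x y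
    using ev that by (auto simp: hom_def tensor_free_simps free_Abelian_group_def)
  have ev_diff: "ev (x - y) = ev x \<ominus>\<^bsub>C\<^esub> ev y" if xy: "x \<in> carrier W" "y \<in> carrier W" for x y
  proof -
    have "ev x = ev (x - y) \<oplus>\<^bsub>C\<^esub> ev y"
      using ev_add[OF diff_in_carrier[OF xy] xy(2)] by simp
    then show ?thesis
      using ev_in xy diff_in_carrier[OF xy] by (simp add: C.minus_eq C.a_assoc C.r_neg)
  qed
  have ev_zero: "ev 0 = \<zero>\<^bsub>C\<^esub>"
    using ev_diff[OF W.one_closed W.one_closed] ev_in[OF W.one_closed] by (simp add: C.minus_eq C.r_neg)
  have ev_pure: "ev (frag_of (a, b)) = \<alpha> a \<otimes>\<^bsub>C\<^esub> \<kappa> b" if "a \<in> carrier A" "b \<in> carrier B" for a b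
    using ev_of[of "(a, b)"] that by simp
  have ev_mult: "ev (x \<otimes>\<^bsub>W\<^esub> y) = ev x \<otimes>\<^bsub>C\<^esub> ev y" if x: "x \<in> carrier W" and y: "y \<in> carrier W" for x y
    using x
  proof (induction rule: tensor_free_induct)
    case zero
    then show ?case using y ev_in by (simp add: tensor_free_mult_simps ev_zero)
  next
    case (pure a b)
    have ab: "frag_of (a, b) \<in> carrier W" using pure frag_of_in_carrier by simp
    show ?case using y
    proof (induction rule: tensor_free_induct)
      case zero
      then show ?case using pure by (simp add: tensor_free_mult_simps ev_zero ev_pure)
    next
      case (pure a' b')
      then show ?case using \<open>a \<in> carrier A\<close> \<open>b \<in> carrier B\<close>
        by (simp add: tensor_free_mult_simps ev_pure C.m_ac)
    next
      case (diff x y)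
      then show ?case using ev_in ab
        by (simp add: tensor_free_mult_simps ev_diff C.minus_eq C.r_distr C.r_minus)
    qed
  next
    case (diff x x')
    then show ?case using ev_in y
      by (simp add: tensor_free_mult_simps ev_diff C.minus_eq C.l_distr C.l_minus)
  qed
  have ev_hom: "ev \<in> ring_hom W C"
    by (rule ring_hom_memI) (use ev_in ev_mult ev_add in \<open>simp_all add: tensor_free_simps(2-4) ev_pure\<close>)
  interpret ev: ring_hom_ring W C ev
    by (rule ring_hom_ringI2[OF W.ring_axioms C.ring_axioms ev_hom])
  have "tensor_relations R \<phi> \<psi> A B \<subseteq> a_kernel W C ev"
  proof
    fix x assume x: "x \<in> tensor_relations R \<phi> \<psi> A B"
    have fr: "frag_of (a, b) \<in> carrier W" if "a \<in> carrier A" "b \<in> carrier B" for a b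
      using that by (rule frag_of_in_carrier)
    have "ev x = \<zero>\<^bsub>C\<^esub>"
      using x unfolding tensor_relations_def
    proof (elim UnE CollectE exE conjE)
      fix a a' b assume "x = frag_of (a \<oplus>\<^bsub>A\<^esub> a', b) - frag_of (a, b) - frag_of (a', b)"
        "a \<in> carrier A" "a' \<in> carrier A" "b \<in> carrier B"
      then show ?thesis
        by (simp add: ev_diff fr diff_in_carrier ev_pure C.l_distr C.minus_eq C.minus_add C.a_ac C.r_neg C.r_neg1 C.r_neg2)
    next
      fix a b b' assume "x = frag_of (a, b \<oplus>\<^bsub>B\<^esub> b') - frag_of (a, b) - frag_of (a, b')"
        "a \<in> carrier A" "b \<in> carrier B" "b' \<in> carrier B"
      then show ?thesis
        by (simp add: ev_diff fr diff_in_carrier ev_pure C.r_distr C.minus_eq C.minus_add C.a_ac C.r_neg C.r_neg1 C.r_neg2)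
    next
      fix r a b assume r: "x = frag_of (\<phi> r \<otimes>\<^bsub>A\<^esub> a, b) - frag_of (a, \<psi> r \<otimes>\<^bsub>B\<^esub> b)"
        "r \<in> carrier R" "a \<in> carrier A" "b \<in> carrier B"
      then show ?thesis using \<phi>_closed[of r] \<psi>_closed[of r] compat[of r]
        by (simp add: ev_diff fr ev_pure C.m_ac C.minus_eq C.r_neg)
    qed
    then show "x \<in> a_kernel W C ev"
      unfolding a_kernel_def' using x relations_in_carrier by blast
  qed
  \<comment> \<open>The kernel is an ideal, so it is enough that it contains the generating
    relations.\<close>
  then have "J \<subseteq> a_kernel W C ev"
    unfolding tensor_ideal_def by (rule W.genideal_minimal[OF ev.kernel_is_ideal])
  then have "\<exists>\<eta>\<in>ring_hom (W Quot J) C. \<forall>x\<in>carrier W. \<eta> (J +>\<^bsub>W\<^esub> x) = ev x"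
    unfolding a_kernel_def' by (intro ev.quot_lift J.ideal_axioms) blast
  then obtain \<eta> where "\<eta> \<in> ring_hom T C" "\<And>x. x \<in> carrier W \<Longrightarrow> \<eta> (J +>\<^bsub>W\<^esub> x) = ev x"
    by (auto simp: tensor_def)
  then show ?thesis
    by (intro bexI[of _ \<eta>]) (auto simp: pure_tensor_def frag_of_in_carrier ev_pure)
qed

end

section \<open>Fields of fractions\<close>

text \<open>Operations on classes are written as unions over representatives. A nonempty index set
  and a constant term are what independence of the representative amounts to in this form.\<close>

lemma UN_pairs_const:
  assumes "p \<in> Z" "\<And>a b. (a, b) \<in> Z \<Longrightarrow> f a b = c"
  shows "(\<Union>(a, b)\<in>Z. f a b) = c"
proof -
  have "(case q of (a, b) \<Rightarrow> f a b) = c" if "q \<in> Z" for q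
    using assms(2) that by (cases q) simp
  then show ?thesis using assms(1) by blast
qed

lemma (in comm_monoid) Units_cancel:
  assumes "u \<in> Units G" "x \<in> carrier G"
  shows "u \<otimes> (inv u \<otimes> x) = x" "inv u \<otimes> (u \<otimes> x) = x"
proof -
  have "u \<in> carrier G" "inv u \<in> carrier G" using assms by auto
  then show "u \<otimes> (inv u \<otimes> x) = x" "inv u \<otimes> (u \<otimes> x) = x"
    using assms m_assoc[of u "inv u" x] m_assoc[of "inv u" u x] by simp_all
qed

lemma (in comm_monoid) inv_mult_Units:
  assumes u: "u \<in> Units G" and v: "v \<in> Units G"
  shows "inv (u \<otimes> v) = inv u \<otimes> inv v"
proof (rule comm_inv_char)
  have "u \<otimes> v \<otimes> (inv u \<otimes> inv v) = (u \<otimes> inv u) \<otimes> (v \<otimes> inv v)"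
    using assms Units_closed Units_inv_closed by (simp add: m_ac)
  then show "u \<otimes> v \<otimes> (inv u \<otimes> inv v) = \<one>" using assms by simp
qed (use assms in auto)

context domain
begin

lemma frac_rel_equiv: "equiv (carrier R \<times> (carrier R - {\<zero>})) (frac_rel R)"
proof (rule equivI)
  show "frac_rel R \<subseteq> (carrier R \<times> (carrier R - {\<zero>})) \<times> (carrier R \<times> (carrier R - {\<zero>}))"
    by (auto simp: frac_rel_def)
  show "refl_on (carrier R \<times> (carrier R - {\<zero>})) (frac_rel R)"
    by (auto simp: refl_on_def frac_rel_def)
  show "sym (frac_rel R)"
    by (auto simp: sym_def frac_rel_def)
  show "trans (frac_rel R)"
  proof (rule transI)
    fix p q r assume "(p, q) \<in> frac_rel R" "(q, r) \<in> frac_rel R"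
    then obtain a b c d e f where p: "p = (a, b)" "q = (c, d)" "r = (e, f)"
      and in_R: "a \<in> carrier R" "b \<in> carrier R" "c \<in> carrier R" "d \<in> carrier R" "e \<in> carrier R" "f \<in> carrier R"
      and nz: "b \<noteq> \<zero>" "d \<noteq> \<zero>" "f \<noteq> \<zero>" and eq: "a \<otimes> d = c \<otimes> b" "c \<otimes> f = e \<otimes> d"
      by (auto simp: frac_rel_def)
    \<comment> \<open>Transitivity is where the absence of zero divisors matters: the middle
      denominator \<open>d\<close> is cancelled.\<close>
    have "d \<otimes> (a \<otimes> f) = (a \<otimes> d) \<otimes> f" using in_R by (simp add: m_ac)
    also have "\<dots> = (c \<otimes> f) \<otimes> b" unfolding eq(1) using in_R by (simp add: m_ac)
    also have "\<dots> = d \<otimes> (e \<otimes> b)" unfolding eq(2) using in_R by (simp add: m_ac)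
    finally have "a \<otimes> f = e \<otimes> b" using m_lcancel[OF nz(2) in_R(4)] in_R by simp
    then show "(p, r) \<in> frac_rel R" using p in_R nz by (simp add: frac_rel_def)
  qed
qed

lemma mem_fraction_iff:
  "(c, d) \<in> fraction R a b \<longleftrightarrow> a \<in> carrier R \<and> b \<in> carrier R \<and> b \<noteq> \<zero> \<and>
     c \<in> carrier R \<and> d \<in> carrier R \<and> d \<noteq> \<zero> \<and> a \<otimes> d = c \<otimes> b"
  by (auto simp: fraction_def frac_rel_def)

lemma fraction_eq_iff:
  assumes "a \<in> carrier R" "b \<in> carrier R" "b \<noteq> \<zero>" "c \<in> carrier R" "d \<in> carrier R" "d \<noteq> \<zero>"
  shows "fraction R a b = fraction R c d \<longleftrightarrow> a \<otimes> d = c \<otimes> b"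
  unfolding fraction_def
  by (subst eq_equiv_class_iff[OF frac_rel_equiv]) (use assms in \<open>auto simp: frac_rel_def\<close>)

lemma frac_field_carrier:
  "carrier (frac_field R) = {fraction R a b | a b. a \<in> carrier R \<and> b \<in> carrier R \<and> b \<noteq> \<zero>}"
  by (auto simp: frac_field_def fraction_def quotient_def)

lemma fraction_self:
  assumes "a \<in> carrier R" "b \<in> carrier R" "b \<noteq> \<zero>"
  shows "(a, b) \<in> fraction R a b"
  using assms by (simp add: mem_fraction_iff)

lemma fraction_mult:
  assumes ab: "a \<in> carrier R" "b \<in> carrier R" "b \<noteq> \<zero>" and cd: "c \<in> carrier R" "d \<in> carrier R" "d \<noteq> \<zero>"
  shows "fraction R a b \<otimes>\<^bsub>frac_field R\<^esub> fraction R c d = fraction R (a \<otimes> c) (b \<otimes> d)"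
proof -
  have eq: "fraction R (a' \<otimes> c') (b' \<otimes> d') = fraction R (a \<otimes> c) (b \<otimes> d)"
    if "(a', b') \<in> fraction R a b" "(c', d') \<in> fraction R c d" for a' b' c' d'
  proof -
    have in_R: "a' \<in> carrier R" "b' \<in> carrier R" "c' \<in> carrier R" "d' \<in> carrier R" "b' \<noteq> \<zero>" "d' \<noteq> \<zero>"
      and e: "a \<otimes> b' = a' \<otimes> b" "c \<otimes> d' = c' \<otimes> d"
      using that by (auto simp: mem_fraction_iff)
    have "a' \<otimes> c' \<otimes> (b \<otimes> d) = (a' \<otimes> b) \<otimes> (c' \<otimes> d)" using in_R ab cd by (simp add: m_ac)
    also have "\<dots> = a \<otimes> c \<otimes> (b' \<otimes> d')" unfolding e[symmetric] using in_R ab cd by (simp add: m_ac)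
    finally show ?thesis
      using in_R ab cd by (subst fraction_eq_iff) (auto simp: integral_iff)
  qed
  have "fraction R a b \<otimes>\<^bsub>frac_field R\<^esub> fraction R c d =
      (\<Union>(a', b')\<in>fraction R a b. \<Union>(c', d')\<in>fraction R c d. fraction R (a' \<otimes> c') (b' \<otimes> d'))"
    by (simp add: frac_field_def)
  also have "\<dots> = fraction R (a \<otimes> c) (b \<otimes> d)"
    by (intro UN_pairs_const[OF fraction_self[OF ab]] UN_pairs_const[OF fraction_self[OF cd]]) (rule eq)
  finally show ?thesis .
qed

lemma fraction_add:
  assumes ab: "a \<in> carrier R" "b \<in> carrier R" "b \<noteq> \<zero>" and cd: "c \<in> carrier R" "d \<in> carrier R" "d \<noteq> \<zero>"
  shows "fraction R a b \<oplus>\<^bsub>frac_field R\<^esub> fraction R c d = fraction R (a \<otimes> d \<oplus> c \<otimes> b) (b \<otimes> d)"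
proof -
  have eq: "fraction R (a' \<otimes> d' \<oplus> c' \<otimes> b') (b' \<otimes> d') = fraction R (a \<otimes> d \<oplus> c \<otimes> b) (b \<otimes> d)"
    if "(a', b') \<in> fraction R a b" "(c', d') \<in> fraction R c d" for a' b' c' d'
  proof -
    have in_R: "a' \<in> carrier R" "b' \<in> carrier R" "c' \<in> carrier R" "d' \<in> carrier R" "b' \<noteq> \<zero>" "d' \<noteq> \<zero>"
      and e: "a \<otimes> b' = a' \<otimes> b" "c \<otimes> d' = c' \<otimes> d"
      using that by (auto simp: mem_fraction_iff)
    have "(a' \<otimes> d' \<oplus> c' \<otimes> b') \<otimes> (b \<otimes> d) = (a' \<otimes> b) \<otimes> (d \<otimes> d') \<oplus> (c' \<otimes> d) \<otimes> (b \<otimes> b')"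
      using in_R ab cd by (simp add: l_distr r_distr m_ac)
    also have "\<dots> = (a \<otimes> d \<oplus> c \<otimes> b) \<otimes> (b' \<otimes> d')"
      unfolding e[symmetric] using in_R ab cd by (simp add: l_distr r_distr m_ac)
    finally show ?thesis
      using in_R ab cd by (subst fraction_eq_iff) (auto simp: integral_iff)
  qed
  have "fraction R a b \<oplus>\<^bsub>frac_field R\<^esub> fraction R c d =
      (\<Union>(a', b')\<in>fraction R a b. \<Union>(c', d')\<in>fraction R c d. fraction R (a' \<otimes> d' \<oplus> c' \<otimes> b') (b' \<otimes> d'))"
    by (simp add: frac_field_def)
  also have "\<dots> = fraction R (a \<otimes> d \<oplus> c \<otimes> b) (b \<otimes> d)"
    by (intro UN_pairs_const[OF fraction_self[OF ab]] UN_pairs_const[OF fraction_self[OF cd]]) (rule eq)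
  finally show ?thesis .
qed

lemma frac_field_closed:
  "\<one>\<^bsub>frac_field R\<^esub> \<in> carrier (frac_field R)"
  "Z \<in> carrier (frac_field R) \<Longrightarrow> Y \<in> carrier (frac_field R) \<Longrightarrow>
    Z \<otimes>\<^bsub>frac_field R\<^esub> Y \<in> carrier (frac_field R)"
  "Z \<in> carrier (frac_field R) \<Longrightarrow> Y \<in> carrier (frac_field R) \<Longrightarrow>
    Z \<oplus>\<^bsub>frac_field R\<^esub> Y \<in> carrier (frac_field R)"
proof -
  have frac: "fraction R a b \<in> carrier (frac_field R)"
    if "a \<in> carrier R" "b \<in> carrier R" "b \<noteq> \<zero>" for a b
    using that by (auto simp: frac_field_carrier)
  show "\<one>\<^bsub>frac_field R\<^esub> \<in> carrier (frac_field R)"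
    using frac[of \<one> \<one>] by (simp add: frac_field_def)
  assume "Z \<in> carrier (frac_field R)" "Y \<in> carrier (frac_field R)"
  then obtain a b c d where Z: "Z = fraction R a b" and Y: "Y = fraction R c d"
    and ab: "a \<in> carrier R" "b \<in> carrier R" "b \<noteq> \<zero>" and cd: "c \<in> carrier R" "d \<in> carrier R" "d \<noteq> \<zero>"
    by (auto simp: frac_field_carrier)
  have bd: "b \<otimes> d \<noteq> \<zero>" using ab cd by (simp add: integral_iff)
  show "Z \<otimes>\<^bsub>frac_field R\<^esub> Y \<in> carrier (frac_field R)"
    unfolding Z Y fraction_mult[OF ab cd] by (rule frac) (use ab cd bd in auto)
  show "Z \<oplus>\<^bsub>frac_field R\<^esub> Y \<in> carrier (frac_field R)"
    unfolding Z Y fraction_add[OF ab cd] by (rule frac) (use ab cd bd in auto)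
qed

lemma frac_field_one: "\<one>\<^bsub>frac_field R\<^esub> = fraction R \<one> \<one>"
  and frac_field_zero: "\<zero>\<^bsub>frac_field R\<^esub> = fraction R \<zero> \<one>"
  by (simp_all add: frac_field_def)

section \<open>Extending an embedding into a field to fractions\<close>

context
  fixes K :: "('k, 'n) ring_scheme" and j
  assumes K: "field K" and j: "j \<in> ring_hom R K" and inj: "inj_on j (carrier R)"
begin

interpretation K: field K by (rule K)

interpretation j: ring_hom_ring R K j
  by (rule ring_hom_ringI2[OF ring_axioms K.ring_axioms j])

lemma hom_nonzero: "b \<in> carrier R \<Longrightarrow> b \<noteq> \<zero> \<Longrightarrow> j b \<in> Units K"
  using inj_onD[OF inj, of b \<zero>] by (auto simp: K.field_Units)

text \<open>If \<open>a d = c b\<close>, then the quotients of the images agree in \<open>K\<close>,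
  since injectivity makes the denominators units. So the image of the class is a singleton, and
  \<open>the_elem\<close> reads off its element.\<close>

lemma frac_lift_fraction:
  assumes ab: "a \<in> carrier R" "b \<in> carrier R" "b \<noteq> \<zero>"
  shows "frac_lift K j (fraction R a b) = j a \<otimes>\<^bsub>K\<^esub> inv\<^bsub>K\<^esub> j b"
proof -
  have "j c \<otimes>\<^bsub>K\<^esub> inv\<^bsub>K\<^esub> j d = j a \<otimes>\<^bsub>K\<^esub> inv\<^bsub>K\<^esub> j b" if "(c, d) \<in> fraction R a b" for c d
  proof -
    have cd: "c \<in> carrier R" "d \<in> carrier R" "d \<noteq> \<zero>" "a \<otimes> d = c \<otimes> b"
      using that by (auto simp: mem_fraction_iff)
    have e: "j a \<otimes>\<^bsub>K\<^esub> j d = j c \<otimes>\<^bsub>K\<^esub> j b"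
      using cd ab by (metis j.hom_mult)
    have u: "j b \<in> Units K" "j d \<in> Units K" using hom_nonzero ab cd by auto
    have "j c \<otimes>\<^bsub>K\<^esub> inv\<^bsub>K\<^esub> j d = (j c \<otimes>\<^bsub>K\<^esub> j b) \<otimes>\<^bsub>K\<^esub> (inv\<^bsub>K\<^esub> j b \<otimes>\<^bsub>K\<^esub> inv\<^bsub>K\<^esub> j d)"
      using u ab cd by (simp add: K.m_assoc K.m_lcomm[of "j b"] K.Units_cancel)
    also have "\<dots> = j a \<otimes>\<^bsub>K\<^esub> inv\<^bsub>K\<^esub> j b"
      unfolding e[symmetric] using u ab cd by (simp add: K.m_assoc K.m_lcomm[of "j d"] K.Units_cancel)
    finally show ?thesis .
  qed
  then have "(\<lambda>(a, b). j a \<otimes>\<^bsub>K\<^esub> inv\<^bsub>K\<^esub> j b) ` fraction R a b \<subseteq> {j a \<otimes>\<^bsub>K\<^esub> inv\<^bsub>K\<^esub> j b}"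
    by clarsimp
  moreover have "j a \<otimes>\<^bsub>K\<^esub> inv\<^bsub>K\<^esub> j b \<in> (\<lambda>(a, b). j a \<otimes>\<^bsub>K\<^esub> inv\<^bsub>K\<^esub> j b) ` fraction R a b"
    by (rule image_eqI[OF _ fraction_self[OF ab]]) simp
  ultimately have "(\<lambda>(a, b). j a \<otimes>\<^bsub>K\<^esub> inv\<^bsub>K\<^esub> j b) ` fraction R a b = {j a \<otimes>\<^bsub>K\<^esub> inv\<^bsub>K\<^esub> j b}"
    by blast
  then show ?thesis by (simp add: frac_lift_def)
qed

lemma frac_lift_hom: "frac_lift K j \<in> ring_hom (frac_field R) K"
proof (rule ring_hom_memI)
  fix Z assume "Z \<in> carrier (frac_field R)"
  then show "frac_lift K j Z \<in> carrier K"
    using hom_nonzero by (auto simp: frac_field_carrier frac_lift_fraction)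
next
  fix Z Y assume "Z \<in> carrier (frac_field R)" "Y \<in> carrier (frac_field R)"
  then obtain a b c d where Z: "Z = fraction R a b" and Y: "Y = fraction R c d"
    and ab: "a \<in> carrier R" "b \<in> carrier R" "b \<noteq> \<zero>" and cd: "c \<in> carrier R" "d \<in> carrier R" "d \<noteq> \<zero>"
    by (auto simp: frac_field_carrier)
  have u: "j b \<in> Units K" "j d \<in> Units K" using hom_nonzero ab cd by auto
  have bd: "b \<otimes> d \<in> carrier R" "b \<otimes> d \<noteq> \<zero>" using ab cd by (auto simp: integral_iff)
  have inv: "inv\<^bsub>K\<^esub> j (b \<otimes> d) = inv\<^bsub>K\<^esub> j b \<otimes>\<^bsub>K\<^esub> inv\<^bsub>K\<^esub> j d"
    using u ab cd by (simp add: K.inv_mult_Units)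
  show "frac_lift K j (Z \<otimes>\<^bsub>frac_field R\<^esub> Y) = frac_lift K j Z \<otimes>\<^bsub>K\<^esub> frac_lift K j Y"
    unfolding Z Y fraction_mult[OF ab cd]
    using ab cd bd u inv by (simp add: frac_lift_fraction K.m_ac)
  have "frac_lift K j (Z \<oplus>\<^bsub>frac_field R\<^esub> Y) =
      (j a \<otimes>\<^bsub>K\<^esub> j d \<oplus>\<^bsub>K\<^esub> j c \<otimes>\<^bsub>K\<^esub> j b) \<otimes>\<^bsub>K\<^esub> (inv\<^bsub>K\<^esub> j b \<otimes>\<^bsub>K\<^esub> inv\<^bsub>K\<^esub> j d)"
    unfolding Z Y fraction_add[OF ab cd]
    using ab cd bd u inv by (simp add: frac_lift_fraction)
  also have "\<dots> = j a \<otimes>\<^bsub>K\<^esub> inv\<^bsub>K\<^esub> j b \<oplus>\<^bsub>K\<^esub> j c \<otimes>\<^bsub>K\<^esub> inv\<^bsub>K\<^esub> j d"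
    using u ab cd
    by (simp add: K.l_distr K.m_assoc K.m_lcomm[of "j d"] K.m_lcomm[of "j b"] K.Units_cancel)
  finally show "frac_lift K j (Z \<oplus>\<^bsub>frac_field R\<^esub> Y) = frac_lift K j Z \<oplus>\<^bsub>K\<^esub> frac_lift K j Y"
    unfolding Z Y using ab cd by (simp add: frac_lift_fraction)
next
  show "frac_lift K j \<one>\<^bsub>frac_field R\<^esub> = \<one>\<^bsub>K\<^esub>"
    by (simp add: frac_field_one frac_lift_fraction)
qed

lemma frac_lift_inj: "inj_on (frac_lift K j) (carrier (frac_field R))"
proof (rule inj_onI)
  fix Z Y assume "Z \<in> carrier (frac_field R)" "Y \<in> carrier (frac_field R)"
    and eq: "frac_lift K j Z = frac_lift K j Y"
  then obtain a b c d where Z: "Z = fraction R a b" and Y: "Y = fraction R c d"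
    and ab: "a \<in> carrier R" "b \<in> carrier R" "b \<noteq> \<zero>" and cd: "c \<in> carrier R" "d \<in> carrier R" "d \<noteq> \<zero>"
    by (auto simp: frac_field_carrier)
  have u: "j b \<in> Units K" "j d \<in> Units K" using hom_nonzero ab cd by auto
  have e: "j a \<otimes>\<^bsub>K\<^esub> inv\<^bsub>K\<^esub> j b = j c \<otimes>\<^bsub>K\<^esub> inv\<^bsub>K\<^esub> j d"
    using eq ab cd by (simp add: Z Y frac_lift_fraction)
  have "j (a \<otimes> d) = (j a \<otimes>\<^bsub>K\<^esub> inv\<^bsub>K\<^esub> j b) \<otimes>\<^bsub>K\<^esub> (j b \<otimes>\<^bsub>K\<^esub> j d)"
    using u ab cd by (simp add: K.m_assoc K.Units_cancel)
  also have "\<dots> = j (c \<otimes> b)"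
    unfolding e using u ab cd by (simp add: K.m_assoc K.m_comm[of "j b"] K.Units_cancel)
  finally have "a \<otimes> d = c \<otimes> b" using inj_onD[OF inj] ab cd by simp
  then show "Z = Y" unfolding Z Y using ab cd by (simp add: fraction_eq_iff)
qed

end

text \<open>The converse of the extension: an embedding of the fraction field is recovered from its
  values on the elements \<open>a / 1\<close>, because
  \<open>(a / b) \<cdot> (b / 1) = a / 1\<close> and \<open>b / 1\<close> goes to a unit.\<close>

lemma embedding_fraction:
  assumes K: "field K" and s: "s \<in> ring_hom (frac_field R) K" and inj: "inj_on s (carrier (frac_field R))"
  shows "(\<lambda>a. s (fraction R a \<one>)) \<in> ring_hom R K"
    and "inj_on (\<lambda>a. s (fraction R a \<one>)) (carrier R)"
    and "Z \<in> carrier (frac_field R) \<Longrightarrow> frac_lift K (\<lambda>a. s (fraction R a \<one>)) Z = s Z"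
proof -
  interpret K: field K by fact
  have in_F: "fraction R a b \<in> carrier (frac_field R)" if "a \<in> carrier R" "b \<in> carrier R" "b \<noteq> \<zero>" for a b
    using that by (auto simp: frac_field_carrier)
  show hom: "(\<lambda>a. s (fraction R a \<one>)) \<in> ring_hom R K"
  proof (rule ring_hom_memI)
    fix a b assume a: "a \<in> carrier R" and b: "b \<in> carrier R"
    show "s (fraction R (a \<otimes> b) \<one>) = s (fraction R a \<one>) \<otimes>\<^bsub>K\<^esub> s (fraction R b \<one>)"
      using a b ring_hom_mult[OF s in_F[of a \<one>] in_F[of b \<one>]] by (simp add: fraction_mult)
    show "s (fraction R (a \<oplus> b) \<one>) = s (fraction R a \<one>) \<oplus>\<^bsub>K\<^esub> s (fraction R b \<one>)"
      using a b ring_hom_add[OF s in_F[of a \<one>] in_F[of b \<one>]] by (simp add: fraction_add)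
  next
    show "s (fraction R \<one> \<one>) = \<one>\<^bsub>K\<^esub>"
      using ring_hom_one[OF s] by (simp add: frac_field_one)
  qed (use ring_hom_closed[OF s] in_F in auto)
  show inj': "inj_on (\<lambda>a. s (fraction R a \<one>)) (carrier R)"
  proof (rule inj_onI)
    fix a b assume ab: "a \<in> carrier R" "b \<in> carrier R" and "s (fraction R a \<one>) = s (fraction R b \<one>)"
    then have "fraction R a \<one> = fraction R b \<one>" using inj_onD[OF inj] in_F by simp
    then show "a = b" using ab by (simp add: fraction_eq_iff)
  qed
  assume "Z \<in> carrier (frac_field R)"
  then obtain a b where Z: "Z = fraction R a b" and ab: "a \<in> carrier R" "b \<in> carrier R" "b \<noteq> \<zero>"
    by (auto simp: frac_field_carrier)
  have u: "s (fraction R b \<one>) \<in> Units K"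
    using hom_nonzero[OF K hom inj'] ab by simp
  have "fraction R a b \<otimes>\<^bsub>frac_field R\<^esub> fraction R b \<one> = fraction R a \<one>"
    using ab by (simp add: fraction_mult fraction_eq_iff m_ac)
  then have "s (fraction R a \<one>) = s (fraction R a b) \<otimes>\<^bsub>K\<^esub> s (fraction R b \<one>)"
    using ring_hom_mult[OF s in_F[OF ab] in_F[of b \<one>]] ab by simp
  moreover have "s (fraction R a b) \<in> carrier K" using ring_hom_closed[OF s in_F[OF ab]] .
  ultimately show "frac_lift K (\<lambda>a. s (fraction R a \<one>)) Z = s Z"
    unfolding Z using u ab by (simp add: frac_lift_fraction[OF K hom inj'] K.m_assoc K.Units_closed)
qed

end

text \<open>Needed because the maps on cosets that are compared later are only known to agree on the
  carrier, not as functions on the whole type.\<close>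

lemma (in domain) frac_lift_cong:
  assumes "field K" "i \<in> ring_hom R K" "inj_on i (carrier R)"
    and "i' \<in> ring_hom R K" "inj_on i' (carrier R)"
    and "\<And>x. x \<in> carrier R \<Longrightarrow> i x = i' x" and "Z \<in> carrier (frac_field R)"
  shows "frac_lift K i Z = frac_lift K i' Z"
  using assms by (auto simp: frac_field_carrier frac_lift_fraction)

section \<open>Polynomial functions\<close>

lemma coord_ring_simps:
  "carrier (coord_ring scl) = poly_funs (linear_functionals scl)"
  "f \<otimes>\<^bsub>coord_ring scl\<^esub> g = (\<lambda>v. f v * g v)"
  "f \<oplus>\<^bsub>coord_ring scl\<^esub> g = (\<lambda>v. f v + g v)"
  "\<one>\<^bsub>coord_ring scl\<^esub> = (\<lambda>_. 1)" "\<zero>\<^bsub>coord_ring scl\<^esub> = (\<lambda>_. 0)"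
  by (simp_all add: coord_ring_def)

lemma coord_ring_cring: "cring (coord_ring scl)"
proof (rule cringI)
  show "abelian_group (coord_ring scl)"
  proof (rule abelian_groupI)
    fix f assume f: "f \<in> carrier (coord_ring scl)"
    then have "(\<lambda>v. (-1) * f v) \<in> carrier (coord_ring scl)"
      unfolding coord_ring_simps by (intro poly_funs.mult poly_funs.const)
    then show "\<exists>g\<in>carrier (coord_ring scl). g \<oplus>\<^bsub>coord_ring scl\<^esub> f = \<zero>\<^bsub>coord_ring scl\<^esub>"
      by (rule bexI[rotated]) (simp add: coord_ring_simps)
  qed (auto simp: coord_ring_simps algebra_simps intro: poly_funs.add poly_funs.const)
  show "comm_monoid (coord_ring scl)"
    by (rule comm_monoidI)
      (auto simp: coord_ring_simps algebra_simps intro: poly_funs.mult poly_funs.const)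
qed (auto simp: coord_ring_simps algebra_simps)

text \<open>A product of two nonzero polynomial functions is nonzero because it is so on the line through
  a point where the first and a point where the second does not vanish.\<close>

lemma poly_fun_on_line:
  assumes lin: "Vector_Spaces.vector_space scl" and f: "f \<in> poly_funs (linear_functionals scl)"
  shows "\<exists>p. \<forall>t. f (u + scl t w) = poly p t"
  using f
proof induction
  case (const c)
  show ?case by (rule exI[of _ "[:c:]"]) simp
next
  case (gen f)
  then have "Vector_Spaces.linear scl (*) f" by (simp add: linear_functionals_def)
  then have "f (u + scl t w) = f u + t * f w" for t
    by (simp add: Vector_Spaces.linear_iff)
  then show ?case by (intro exI[of _ "[:f u, f w:]"]) simp
next
  case (add f g)
  then obtain p q where "\<forall>t. f (u + scl t w) = poly p t" "\<forall>t. g (u + scl t w) = poly q t" by blast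
  then show ?case by (intro exI[of _ "p + q"]) simp
next
  case (mult f g)
  then obtain p q where "\<forall>t. f (u + scl t w) = poly p t" "\<forall>t. g (u + scl t w) = poly q t" by blast
  then show ?case by (intro exI[of _ "p * q"]) simp
qed

lemma coord_ring_domain:
  assumes V: "Vector_Spaces.vector_space scl"
  shows "domain (coord_ring scl)"
proof -
  interpret V: vector_space scl by fact
  interpret A: cring "coord_ring scl" by (rule coord_ring_cring)
  show ?thesis
  proof (intro domain.intro domain_axioms.intro A.cring_axioms)
    show "\<one>\<^bsub>coord_ring scl\<^esub> \<noteq> \<zero>\<^bsub>coord_ring scl\<^esub>"
      by (auto simp: coord_ring_simps dest: fun_cong)
  next
    fix f g assume fg: "f \<otimes>\<^bsub>coord_ring scl\<^esub> g = \<zero>\<^bsub>coord_ring scl\<^esub>"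
      and f: "f \<in> carrier (coord_ring scl)" and g: "g \<in> carrier (coord_ring scl)"
    show "f = \<zero>\<^bsub>coord_ring scl\<^esub> \<or> g = \<zero>\<^bsub>coord_ring scl\<^esub>"
    proof (rule ccontr)
      assume "\<not> ?thesis"
      then obtain u v where uv: "f u \<noteq> 0" "g v \<noteq> 0" by (auto simp: coord_ring_simps fun_eq_iff)
      obtain p where p: "\<And>t. f (u + scl t (v - u)) = poly p t"
        using poly_fun_on_line[OF V, of f u "v - u"] f unfolding coord_ring_simps by blast
      obtain q where q: "\<And>t. g (u + scl t (v - u)) = poly q t"
        using poly_fun_on_line[OF V, of g u "v - u"] g unfolding coord_ring_simps by blast
      have "poly p 0 \<noteq> 0" "poly q 1 \<noteq> 0" using uv p[of 0] q[of 1] by simp_all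
      then have "p * q \<noteq> 0" by auto
      moreover have "poly (p * q) t = 0" for t
        using fun_cong[OF fg, of "u + scl t (v - u)"] p q by (simp add: coord_ring_simps)
      then have "p * q = 0" by (simp add: poly_all_0_iff_0[symmetric])
      ultimately show False by blast
    qed
  qed
qed

section \<open>The complex numbers as a field of scalars\<close>

lemma complex_ring_simps:
  "carrier (ring_of_type_algebra :: complex ring) = UNIV"
  "(x :: complex) \<otimes>\<^bsub>ring_of_type_algebra\<^esub> y = x * y"
  "(x :: complex) \<oplus>\<^bsub>ring_of_type_algebra\<^esub> y = x + y"
  "\<one>\<^bsub>ring_of_type_algebra :: complex ring\<^esub> = 1" "\<zero>\<^bsub>ring_of_type_algebra :: complex ring\<^esub> = 0"
  by (simp_all add: ring_of_type_algebra_def)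

text \<open>The content is the fundamental theorem of algebra. The work lies in matching two
  representations: lists in \<open>poly_ring\<close> begin with the leading coefficient, arguments
  of \<open>Poly\<close> with the constant one, hence the \<open>rev\<close>. The nonzero head
  bounds the degree from below and makes the polynomial nonconstant.\<close>

lemma complex_ring_algebraically_closed:
  "algebraically_closed (ring_of_type_algebra :: complex ring)"
proof -
  let ?C = "ring_of_type_algebra :: complex ring"
  interpret C: field ?C by (rule field_from_type_algebra)
  have pow: "x [^]\<^bsub>?C\<^esub> n = x ^ n" for x and n :: nat
    by (induction n) (simp_all add: complex_ring_simps)
  have eval: "C.eval p x = poly (Poly (rev p)) x" for p x
    by (induction p) (simp_all add: complex_ring_simps pow Poly_append poly_monom)
  show ?thesis
  proof (rule C.algebraically_closedI)
    fix p assume p: "p \<in> carrier (poly_ring ?C)" "1 < Polynomials.degree p"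
    then have len: "length p > 1" by simp
    then have "hd p \<noteq> 0" using p by (auto simp: univ_poly_def polynomial_def complex_ring_simps)
    moreover have "coeff (Poly (rev p)) (length p - 1) = hd p"
      using len by (cases p) (simp_all add: nth_default_def nth_append)
    ultimately have "Polynomial.degree (Poly (rev p)) \<ge> length p - 1"
      by (intro le_degree) simp
    then have "\<not> constant (poly (Poly (rev p)))"
      using len by (simp add: constant_degree)
    then obtain z where "poly (Poly (rev p)) z = 0"
      using fundamental_theorem_of_algebra by blast
    then show "\<exists>x\<in>carrier ?C. C.eval p x = \<zero>\<^bsub>?C\<^esub>"
      by (auto simp: eval complex_ring_simps)
  qed
qed

lemma uncountable_UNIV_complex: "uncountable (UNIV :: complex set)"
proof
  assume "countable (UNIV :: complex set)"
  then have "countable (range Re)" by simp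
  moreover have "range Re = UNIV" by (metis Re_complex_of_real surjI)
  ultimately show False using uncountable_UNIV_real by simp
qed

lemma constants_hom: "(\<lambda>c _. c) \<in> ring_hom (ring_of_type_algebra :: complex ring) (coord_ring scl)"
  by (rule ring_hom_memI) (auto simp: coord_ring_simps complex_ring_simps intro: poly_funs.const)

section \<open>Monomials, evaluations and the Nullstellensatz on the vector space\<close>

context
  fixes scl :: "complex \<Rightarrow> 'v \<Rightarrow> 'v::ab_group_add" and Basis :: "'v set"
  assumes V: "finite_dimensional_vector_space scl Basis"
begin

interpretation V: finite_dimensional_vector_space scl Basis by (rule V)

interpretation A: cring "coord_ring scl" by (rule coord_ring_cring)

definition coordinate :: "'v \<Rightarrow> 'v \<Rightarrow> complex"
  where "coordinate b v = V.representation Basis v b"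

text \<open>A monomial is given by the list of its factors instead of an exponent vector. Products
  become concatenations and countability is that of finite lists; that reordered lists give the same
  function does no harm.\<close>

definition monomials :: "('v \<Rightarrow> complex) set"
  where "monomials = (\<lambda>bs v. \<Prod>b\<leftarrow>bs. coordinate b v) ` lists Basis"

lemma linear_functional_expand:
  assumes "\<phi> \<in> linear_functionals scl"
  shows "\<phi> v = (\<Sum>b\<in>Basis. \<phi> b * coordinate b v)"
proof -
  interpret \<phi>: Vector_Spaces.linear scl "(*)" \<phi> using assms by (simp add: linear_functionals_def)
  have "v = (\<Sum>b\<in>Basis. scl (coordinate b v) b)"
    using V.sum_representation_eq[OF V.independent_Basis _ V.finite_Basis subset_refl, of v]
    by (simp add: V.span_Basis coordinate_def)
  then have "\<phi> v = \<phi> (\<Sum>b\<in>Basis. scl (coordinate b v) b)" by simp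
  then show ?thesis by (simp add: \<phi>.sum \<phi>.scale mult.commute)
qed

lemma coordinate_linear: "coordinate b \<in> linear_functionals scl"
proof -
  have "vector_space ((*) :: complex \<Rightarrow> complex \<Rightarrow> complex)"
    by unfold_locales (simp_all add: algebra_simps)
  then show ?thesis
    using V.vector_space_axioms
    by (simp add: linear_functionals_def Vector_Spaces.linear_iff coordinate_def
        V.representation_add[OF V.independent_Basis] V.representation_scale[OF V.independent_Basis] V.span_Basis)
qed

lemma coordinate_in_coord_ring: "coordinate b \<in> carrier (coord_ring scl)"
  unfolding coord_ring_simps by (rule poly_funs.gen[OF coordinate_linear])

lemma countable_monomials: "countable monomials"
  unfolding monomials_def
  by (intro countable_image countable_lists countable_finite V.finite_Basis)

lemma monomials_in_carrier: "monomials \<subseteq> carrier (coord_ring scl)"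
proof -
  have "(\<lambda>v. \<Prod>b\<leftarrow>bs. coordinate b v) \<in> carrier (coord_ring scl)" for bs
  proof (induction bs)
    case Nil
    then show ?case using poly_funs.const[of 1] by (simp add: coord_ring_simps)
  next
    case (Cons b bs)
    then show ?case using poly_funs.mult[of "coordinate b"] coordinate_in_coord_ring[of b]
      by (simp add: coord_ring_simps)
  qed
  then show ?thesis by (auto simp: monomials_def)
qed

lemma monomials_mult:
  assumes "f \<in> monomials" "g \<in> monomials"
  shows "f \<otimes>\<^bsub>coord_ring scl\<^esub> g \<in> monomials"
proof -
  obtain bs cs where "f = (\<lambda>v. \<Prod>b\<leftarrow>bs. coordinate b v)" "g = (\<lambda>v. \<Prod>b\<leftarrow>cs. coordinate b v)"
    and l: "bs \<in> lists Basis" "cs \<in> lists Basis"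
    using assms by (auto simp: monomials_def)
  then have "f \<otimes>\<^bsub>coord_ring scl\<^esub> g = (\<lambda>v. \<Prod>b\<leftarrow>bs @ cs. coordinate b v)"
    by (simp add: coord_ring_simps)
  moreover have "bs @ cs \<in> lists Basis" using l by auto
  ultimately show ?thesis unfolding monomials_def by blast
qed

text \<open>The empty product accounts for constants and the expansion in coordinates for linear
  functionals. Closure of the monomials under multiplication takes care of products.\<close>

lemma coord_ring_lin_span:
  "carrier (coord_ring scl) \<subseteq> lin_span (coord_ring scl) (range (\<lambda>c _. c)) monomials"
proof
  let ?A = "coord_ring scl"
  let ?F = "range (\<lambda>c _. c) :: ('v \<Rightarrow> complex) set"
  have F: "?F \<subseteq> carrier ?A" "\<And>a b. a \<in> ?F \<Longrightarrow> b \<in> ?F \<Longrightarrow> a \<otimes>\<^bsub>?A\<^esub> b \<in> ?F"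
    by (auto simp: coord_ring_simps intro: poly_funs.const)
  note S = monomials_in_carrier
  have mono: "(\<lambda>v. c * m v) \<in> lin_span ?A ?F monomials" if "m \<in> monomials" for c m
    using lin_span.step[of "\<lambda>_. c" ?F m monomials "\<zero>\<^bsub>?A\<^esub>" ?A] that lin_span.zero[of ?A]
    by (simp add: coord_ring_simps)
  fix f assume "f \<in> carrier ?A"
  then have "f \<in> poly_funs (linear_functionals scl)" by (simp add: coord_ring_simps)
  then show "f \<in> lin_span ?A ?F monomials"
  proof induction
    case (const c)
    have "(\<lambda>v. 1) \<in> monomials"
      unfolding monomials_def by (rule image_eqI[of _ _ "[]"]) auto
    then show ?case using mono[of "\<lambda>v. 1" c] by simp
  next
    case (gen f)
    have "(\<lambda>v. \<Sum>b\<in>B. f b * coordinate b v) \<in> lin_span ?A ?F monomials"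
      if "finite B" "B \<subseteq> Basis" for B
      using that
    proof (induction B rule: finite_induct)
      case empty
      then show ?case using lin_span.zero[of ?A] by (simp add: coord_ring_simps)
    next
      case (insert b B)
      have "coordinate b \<in> monomials"
        unfolding monomials_def by (rule image_eqI[of _ _ "[b]"]) (use insert in auto)
      from A.lin_span_add[OF F(1) S mono[OF this] insert.IH] insert
      show ?case by (simp add: coord_ring_simps)
    qed
    from this[OF V.finite_Basis subset_refl] show ?case
      by (simp flip: linear_functional_expand[OF gen])
  next
    case (add f g)
    then show ?case using A.lin_span_add[OF F(1) S, of f g] by (simp add: coord_ring_simps)
  next
    case (mult f g)
    then show ?case using A.lin_span_mult[OF F S monomials_mult, of f g] by (simp add: coord_ring_simps)
  qed
qed

text \<open>The point \<open>v\<close> is forced: its coordinates must be the values of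
  \<open>\<eta>\<close> on the coordinate functions. The two characters then agree on linear
  functionals and constants, which generate all polynomial functions.\<close>

lemma character_eq_evaluation:
  assumes \<eta>: "\<eta> \<in> ring_hom (coord_ring scl) (ring_of_type_algebra :: complex ring)"
    and const: "\<And>c. \<eta> (\<lambda>_. c) = c"
  shows "\<exists>v. \<forall>g\<in>carrier (coord_ring scl). \<eta> g = g v"
proof -
  define v where "v = (\<Sum>b\<in>Basis. scl (\<eta> (coordinate b)) b)"
  have add: "\<eta> (\<lambda>v. f v + g v) = \<eta> f + \<eta> g"
    and mult: "\<eta> (\<lambda>v. f v * g v) = \<eta> f * \<eta> g"
    if "f \<in> poly_funs (linear_functionals scl)" "g \<in> poly_funs (linear_functionals scl)" for f g
    using ring_hom_add[OF \<eta>, of f g] ring_hom_mult[OF \<eta>, of f g] that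
    by (simp_all add: coord_ring_simps complex_ring_simps)
  have "\<eta> g = g v" if "g \<in> poly_funs (linear_functionals scl)" for g
    using that
  proof induction
    case (gen f)
    have "(\<lambda>v. \<Sum>b\<in>B. f b * coordinate b v) \<in> poly_funs (linear_functionals scl) \<and>
        \<eta> (\<lambda>v. \<Sum>b\<in>B. f b * coordinate b v) = (\<Sum>b\<in>B. f b * \<eta> (coordinate b))" if "finite B" for B
      using that
    proof (induction B rule: finite_induct)
      case empty
      then show ?case using poly_funs.const[of 0] const[of 0] by simp
    next
      case (insert b B)
      have b: "coordinate b \<in> poly_funs (linear_functionals scl)"
        by (rule poly_funs.gen[OF coordinate_linear])
      have fb: "(\<lambda>v. f b * coordinate b v) \<in> poly_funs (linear_functionals scl)"
        by (rule poly_funs.mult[OF poly_funs.const b])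
      show ?case
        using insert poly_funs.add[OF fb, of "\<lambda>v. \<Sum>b\<in>B. f b * coordinate b v"]
          add[OF fb, of "\<lambda>v. \<Sum>b\<in>B. f b * coordinate b v"] mult[OF poly_funs.const b, of "f b"]
        by (simp add: const)
    qed
    from this[OF V.finite_Basis] have "\<eta> f = (\<Sum>b\<in>Basis. f b * \<eta> (coordinate b))"
      by (simp flip: linear_functional_expand[OF gen])
    also have "\<dots> = f v"
    proof -
      interpret f: Vector_Spaces.linear scl "(*)" f using gen by (simp add: linear_functionals_def)
      show ?thesis by (simp add: v_def f.sum f.scale mult.commute)
    qed
    finally show ?case .
  qed (simp_all add: const add mult)
  then show ?thesis by (auto simp: coord_ring_simps)
qed

text \<open>A character of \<complex>[V] that kills \<open>P\<close> but not \<open>f\<close> is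
  evaluation at some point, and this point is a zero of \<open>P\<close> at which \<open>f\<close>
  does not vanish.\<close>

lemma nullstellensatz:
  assumes P: "ideal P (coord_ring scl)" and f: "f \<in> carrier (coord_ring scl)"
    and not_in: "\<And>n::nat. f [^]\<^bsub>coord_ring scl\<^esub> n \<notin> P"
  shows "\<exists>v. (\<forall>g\<in>P. g v = 0) \<and> f v \<noteq> 0"
proof -
  let ?C = "ring_of_type_algebra :: complex ring"
  have unc: "uncountable (carrier ?C)"
    using uncountable_UNIV_complex by (simp add: complex_ring_simps)
  have span: "carrier (coord_ring scl) \<subseteq> lin_span (coord_ring scl) ((\<lambda>c _. c) ` carrier ?C) monomials"
    using coord_ring_lin_span by (simp add: complex_ring_simps)
  obtain \<eta> where \<eta>: "\<eta> \<in> ring_hom (coord_ring scl) ?C" "\<And>c. c \<in> carrier ?C \<Longrightarrow> \<eta> (\<lambda>_. c) = c"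
    "\<And>g. g \<in> P \<Longrightarrow> \<eta> g = \<zero>\<^bsub>?C\<^esub>" "\<eta> f \<noteq> \<zero>\<^bsub>?C\<^esub>"
    by (rule exists_hom_to_alg_closed[OF complex_ring_algebraically_closed unc A.cring_axioms
          constants_hom countable_monomials monomials_in_carrier span P f not_in]) blast
  obtain v where v: "\<And>g. g \<in> carrier (coord_ring scl) \<Longrightarrow> \<eta> g = g v"
    using character_eq_evaluation[OF \<eta>(1)] \<eta>(2) by (auto simp: complex_ring_simps)
  have "g v = 0" if "g \<in> P" for g
    using \<eta>(3)[OF that] v additive_subgroup.a_subset[OF ideal.axioms(1)[OF P]] that
    by (auto simp: complex_ring_simps)
  then show ?thesis
    using \<eta>(4) v[OF f] by (auto simp: complex_ring_simps)
qed

end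

section \<open>Closed points and embeddings\<close>

lemma inv_ring_simps:
  "f \<in> carrier (inv_ring scl G \<rho>) \<longleftrightarrow> f \<in> carrier (coord_ring scl) \<and> (\<forall>g\<in>G. act \<rho> g f = f)"
  "f \<otimes>\<^bsub>inv_ring scl G \<rho>\<^esub> g = f \<otimes>\<^bsub>coord_ring scl\<^esub> g"
  "f \<oplus>\<^bsub>inv_ring scl G \<rho>\<^esub> g = f \<oplus>\<^bsub>coord_ring scl\<^esub> g"
  "\<one>\<^bsub>inv_ring scl G \<rho>\<^esub> = \<one>\<^bsub>coord_ring scl\<^esub>"
  by (simp_all add: inv_ring_def)

lemma inv_ring_const: "(\<lambda>_. c) \<in> carrier (inv_ring scl G \<rho>)"
  by (auto simp: inv_ring_simps coord_ring_simps act_def intro: poly_funs.const)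

lemma inv_field_simps:
  "Z \<otimes>\<^bsub>inv_field scl G \<rho>\<^esub> Y = Z \<otimes>\<^bsub>frac_field (coord_ring scl)\<^esub> Y"
  "Z \<oplus>\<^bsub>inv_field scl G \<rho>\<^esub> Y = Z \<oplus>\<^bsub>frac_field (coord_ring scl)\<^esub> Y"
  "\<one>\<^bsub>inv_field scl G \<rho>\<^esub> = \<one>\<^bsub>frac_field (coord_ring scl)\<^esub>"
  by (simp_all add: inv_field_def)

section \<open>Invariants, their values in K, and the two tensor products\<close>

locale extension_data =
  fixes scl :: "complex \<Rightarrow> 'v::ab_group_add \<Rightarrow> 'v"
    and Basis :: "'v set"
    and G :: "(complex^'m^'m) set"
    and \<rho> :: "complex^'m^'m \<Rightarrow> 'v \<Rightarrow> 'v"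
    and K :: "'k ring"
    and \<iota> :: "'v rat_fun \<Rightarrow> 'k"
  assumes V: "finite_dimensional_vector_space scl Basis"
    and frac: "carrier (inv_field scl G \<rho>) =
      {fraction (coord_ring scl) a b | a b.
         a \<in> carrier (inv_ring scl G \<rho>) \<and>
         b \<in> carrier (inv_ring scl G \<rho>) - {\<zero>\<^bsub>coord_ring scl\<^esub>}}"
    and incl: "\<iota> \<in> ring_hom (inv_field scl G \<rho>) K"
    and alg_closed: "algebraically_closed K"
begin

abbreviation A :: "('v \<Rightarrow> complex) ring"
  where "A \<equiv> coord_ring scl"
abbreviation B :: "('v \<Rightarrow> complex) ring"
  where "B \<equiv> inv_ring scl G \<rho>"
abbreviation j :: "('v \<Rightarrow> complex) \<Rightarrow> 'k"
  where "j \<equiv> inv_to_K scl \<iota>"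
abbreviation T :: "(('v \<Rightarrow> complex) \<times> 'k \<Rightarrow>\<^sub>0 int) set ring"
  where "T \<equiv> param_ring scl G \<rho> K \<iota>"

sublocale V: finite_dimensional_vector_space scl Basis by (rule V)

sublocale A: domain A by (rule coord_ring_domain[OF V.vector_space_axioms])

sublocale K: algebraically_closed K by (rule alg_closed)

lemma B_subset: "f \<in> carrier B \<Longrightarrow> f \<in> carrier A"
  by (simp add: inv_ring_simps)

lemma B_one: "\<one>\<^bsub>A\<^esub> \<in> carrier B"
  using inv_ring_const[of 1] by (simp add: coord_ring_simps)

lemma fraction_in_inv_field:
  assumes "a \<in> carrier B" "b \<in> carrier B" "b \<noteq> \<zero>\<^bsub>A\<^esub>"
  shows "fraction A a b \<in> carrier (inv_field scl G \<rho>)"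
  using assms unfolding frac by blast

lemma j_eq: "j f = \<iota> (fraction A f \<one>\<^bsub>A\<^esub>)"
  by (simp add: inv_to_K_def coord_ring_simps)

lemma j_hom: "j \<in> ring_hom B K"
proof (rule ring_hom_memI)
  fix f assume "f \<in> carrier B"
  then show "j f \<in> carrier K"
    unfolding j_eq by (intro ring_hom_closed[OF incl] fraction_in_inv_field B_one) simp_all
next
  fix f g assume f: "f \<in> carrier B" and g: "g \<in> carrier B"
  have in_F: "fraction A f \<one>\<^bsub>A\<^esub> \<in> carrier (inv_field scl G \<rho>)" "fraction A g \<one>\<^bsub>A\<^esub> \<in> carrier (inv_field scl G \<rho>)"
    using f g B_one by (auto intro!: fraction_in_inv_field)
  show "j (f \<otimes>\<^bsub>B\<^esub> g) = j f \<otimes>\<^bsub>K\<^esub> j g"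
    using ring_hom_mult[OF incl in_F] f g
    by (simp add: j_eq inv_field_simps inv_ring_simps(2) A.fraction_mult B_subset)
  show "j (f \<oplus>\<^bsub>B\<^esub> g) = j f \<oplus>\<^bsub>K\<^esub> j g"
    using ring_hom_add[OF incl in_F] f g
    by (simp add: j_eq inv_field_simps inv_ring_simps(3) A.fraction_add B_subset)
next
  show "j \<one>\<^bsub>B\<^esub> = \<one>\<^bsub>K\<^esub>"
    using ring_hom_one[OF incl] by (simp add: j_eq inv_field_simps inv_ring_simps(4) A.frac_field_one)
qed

lemma j_closed: "f \<in> carrier B \<Longrightarrow> j f \<in> carrier K"
  by (rule ring_hom_closed[OF j_hom])

text \<open>An explicit inverse is available: the image of the reciprocal \<open>1 / b\<close>,
  again a fraction of invariants. This gives nonvanishing without first turning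
  \<open>inv_field\<close> into a field.\<close>

lemma j_Units:
  assumes b: "b \<in> carrier B" "b \<noteq> \<zero>\<^bsub>A\<^esub>"
  shows "j b \<in> Units K"
proof -
  have in_F: "fraction A b \<one>\<^bsub>A\<^esub> \<in> carrier (inv_field scl G \<rho>)" "fraction A \<one>\<^bsub>A\<^esub> b \<in> carrier (inv_field scl G \<rho>)"
    using b B_one by (auto intro!: fraction_in_inv_field)
  have "fraction A b \<one>\<^bsub>A\<^esub> \<otimes>\<^bsub>frac_field A\<^esub> fraction A \<one>\<^bsub>A\<^esub> b = \<one>\<^bsub>frac_field A\<^esub>"
    using b B_subset by (simp add: A.fraction_mult A.frac_field_one A.fraction_eq_iff)
  then have "j b \<otimes>\<^bsub>K\<^esub> \<iota> (fraction A \<one>\<^bsub>A\<^esub> b) = \<one>\<^bsub>K\<^esub>"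
    using ring_hom_mult[OF incl in_F] ring_hom_one[OF incl] by (simp add: j_eq inv_field_simps)
  moreover have "\<iota> (fraction A \<one>\<^bsub>A\<^esub> b) \<in> carrier K" by (rule ring_hom_closed[OF incl in_F(2)])
  ultimately have "j b \<noteq> \<zero>\<^bsub>K\<^esub>" by auto
  then show ?thesis using j_closed[OF b(1)] by (simp add: K.field_Units)
qed

lemma \<iota>_fraction:
  assumes a: "a \<in> carrier B" and b: "b \<in> carrier B" "b \<noteq> \<zero>\<^bsub>A\<^esub>"
  shows "\<iota> (fraction A a b) = j a \<otimes>\<^bsub>K\<^esub> inv\<^bsub>K\<^esub> j b"
proof -
  have in_F: "fraction A a b \<in> carrier (inv_field scl G \<rho>)" "fraction A b \<one>\<^bsub>A\<^esub> \<in> carrier (inv_field scl G \<rho>)"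
    using a b B_one by (auto intro!: fraction_in_inv_field)
  have "fraction A a b \<otimes>\<^bsub>frac_field A\<^esub> fraction A b \<one>\<^bsub>A\<^esub> = fraction A a \<one>\<^bsub>A\<^esub>"
    using a b B_subset by (simp add: A.fraction_mult A.fraction_eq_iff A.m_ac)
  then have "j a = \<iota> (fraction A a b) \<otimes>\<^bsub>K\<^esub> j b"
    using ring_hom_mult[OF incl in_F] by (simp add: j_eq inv_field_simps)
  then show ?thesis
    using j_Units[OF b] ring_hom_closed[OF incl in_F(1)] by (simp add: K.m_assoc K.Units_closed)
qed

lemma complex_to_K_hom: "complex_to_K scl \<iota> \<in> ring_hom (ring_of_type_algebra :: complex ring) K"
proof -
  have "(\<lambda>c _. c) \<in> ring_hom (ring_of_type_algebra :: complex ring) B"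
    by (rule ring_hom_memI)
      (auto simp: inv_ring_const inv_ring_simps(2-4) coord_ring_simps complex_ring_simps)
  from ring_hom_trans[OF this j_hom] show ?thesis
    by (simp add: o_def complex_to_K_def[abs_def])
qed

text \<open>Constants are invariant, and a homomorphism from a field to a nontrivial ring is
  injective, so \<open>K\<close> contains a copy of \<complex>.\<close>

lemma uncountable_K: "uncountable (carrier K)"
proof
  assume count: "countable (carrier K)"
  let ?C = "ring_of_type_algebra :: complex ring"
  interpret C: field ?C by (rule field_from_type_algebra)
  interpret \<kappa>: ring_hom_ring ?C K "complex_to_K scl \<iota>"
    by (rule ring_hom_ringI2[OF C.ring_axioms K.ring_axioms complex_to_K_hom])
  have "inj_on (complex_to_K scl \<iota>) (carrier ?C)"
    by (rule \<kappa>.img_is_subfield(1)[OF C.carrier_is_subfield K.one_not_zero])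
  moreover have "countable (complex_to_K scl \<iota> ` carrier ?C)"
    by (rule countable_subset[OF _ count]) auto
  ultimately have "countable (UNIV :: complex set)"
    unfolding complex_ring_simps by (rule countable_image_inj_on[rotated])
  then show False using uncountable_UNIV_complex by blast
qed

sublocale P: tensor_product B "\<lambda>f. f" j A K
  by (intro tensor_product.intro tensor_product_axioms.intro A.cring_axioms K.cring_axioms B_subset j_closed)

sublocale M: tensor_product "ring_of_type_algebra :: complex ring" "\<lambda>c _. c" "complex_to_K scl \<iota>" A K
  by (intro tensor_product.intro tensor_product_axioms.intro A.cring_axioms K.cring_axioms
      ring_hom_closed[OF complex_to_K_hom] ring_hom_closed[OF constants_hom])

lemma param_ring_eq: "P.T = T"
  by (simp add: param_ring_def)

lemma ambient_ring_eq: "M.T = ambient_ring scl K \<iota>"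
  by (simp add: ambient_ring_def)

lemma ambient_pure_eq: "M.pure = ambient_pure scl K \<iota>"
  by (simp add: ambient_pure_def)

text \<open>Constant functions are invariants, so every relation over \<complex> is also a relation
  over \<complex>[V]^G.\<close>

lemma ambient_ideal_subset: "M.J \<subseteq> P.J"
  unfolding tensor_ideal_def[of "ring_of_type_algebra :: complex ring"]
proof (rule P.W.genideal_minimal[OF P.J.ideal_axioms])
  have "tensor_relations (ring_of_type_algebra :: complex ring) (\<lambda>c _. c) (complex_to_K scl \<iota>) A K
      \<subseteq> tensor_relations B (\<lambda>f. f) j A K"
    unfolding tensor_relations_def complex_to_K_def using inv_ring_const by blast
  then show "tensor_relations (ring_of_type_algebra :: complex ring) (\<lambda>c _. c) (complex_to_K scl \<iota>) A K \<subseteq> P.J"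
    using P.relation_in_ideal by blast
qed

lemma ambient_to_param_hom: "ambient_to_param scl G \<rho> K \<iota> \<in> ring_hom (ambient_ring scl K \<iota>) T"
  using P.W.quot_coarsen_hom[OF M.J.ideal_axioms P.J.ideal_axioms ambient_ideal_subset]
  unfolding ambient_to_param_def[abs_def] param_ring_def ambient_ring_def tensor_def .

lemma ambient_to_param_pure:
  assumes "f \<in> carrier A" "k \<in> carrier K"
  shows "ambient_to_param scl G \<rho> K \<iota> (ambient_pure scl K \<iota> f k) = P.pure f k"
  using P.W.quot_coarsen[OF M.J.ideal_axioms P.J.ideal_axioms ambient_ideal_subset P.frag_of_in_carrier[OF assms]]
  unfolding ambient_to_param_def ambient_pure_def pure_tensor_def .

text \<open>A pure tensor \<open>f \<otimes> k\<close> is \<open>f \<otimes> 1\<close> scaled by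
  \<open>k\<close>. Expanding \<open>f\<close> in monomials leaves complex constants on the left,
  and balancing moves them across into \<open>K\<close>. Hence countably many monomials span the
  algebra over \<open>K\<close>.\<close>

lemma param_ring_lin_span:
  "carrier T \<subseteq> lin_span T ((\<lambda>k. P.pure \<one>\<^bsub>A\<^esub> k) ` carrier K)
     ((\<lambda>f. P.pure f \<one>\<^bsub>K\<^esub>) ` monomials scl Basis)"
  unfolding param_ring_eq[symmetric]
proof
  let ?F = "(\<lambda>k. P.pure \<one>\<^bsub>A\<^esub> k) ` carrier K"
  let ?S = "(\<lambda>f. P.pure f \<one>\<^bsub>K\<^esub>) ` monomials scl Basis"
  have S: "?S \<subseteq> carrier P.T" using monomials_in_carrier[OF V] by auto
  have F: "?F \<subseteq> carrier P.T" "\<And>a b. a \<in> ?F \<Longrightarrow> b \<in> ?F \<Longrightarrow> a \<otimes>\<^bsub>P.T\<^esub> b \<in> ?F"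
    by (auto simp: P.pure_mult)
  interpret \<alpha>: ring_hom_ring A P.T "\<lambda>f. P.pure f \<one>\<^bsub>K\<^esub>"
    by (rule ring_hom_ringI2[OF A.ring_axioms P.T.ring_axioms P.pure_hom_left])
  have pure_left: "P.pure f \<one>\<^bsub>K\<^esub> \<in> lin_span P.T ?F ?S" if f: "f \<in> carrier A" for f
  proof -
    have c: "range (\<lambda>c _. c) \<subseteq> carrier A"
      by (auto simp: coord_ring_simps intro: poly_funs.const)
    have "(\<lambda>f. P.pure f \<one>\<^bsub>K\<^esub>) ` range (\<lambda>c _. c) \<subseteq> ?F"
    proof (intro image_subsetI)
      fix b :: "'v \<Rightarrow> complex" assume "b \<in> range (\<lambda>c _. c)"
      then have b: "b \<in> carrier B" using inv_ring_const by auto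
      then have "P.pure b \<one>\<^bsub>K\<^esub> = P.pure \<one>\<^bsub>A\<^esub> (j b)"
        using P.pure_balanced[OF b A.one_closed K.one_closed] B_subset[OF b] j_closed[OF b] by simp
      then show "P.pure b \<one>\<^bsub>K\<^esub> \<in> ?F" using j_closed[OF b] by blast
    qed
    then show ?thesis
      using \<alpha>.lin_span_hom[OF c monomials_in_carrier[OF V]] coord_ring_lin_span[OF V] f
      by (intro lin_span_mono[of _ ?F]) auto
  qed
  fix Z assume "Z \<in> carrier P.T"
  then show "Z \<in> lin_span P.T ?F ?S"
  proof (induction rule: P.tensor_induct)
    case zero
    show ?case by (rule lin_span.zero)
  next
    case (pure f k)
    have "P.pure f k = P.pure \<one>\<^bsub>A\<^esub> k \<otimes>\<^bsub>P.T\<^esub> P.pure f \<one>\<^bsub>K\<^esub>"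
      using pure by (simp add: P.pure_mult)
    then show ?case
      using P.T.lin_span_smult[OF F S _ pure_left[OF pure(1)]] pure(2) by simp
  next
    case (diff x y)
    interpret \<beta>: ring_hom_ring K P.T "\<lambda>k. P.pure \<one>\<^bsub>A\<^esub> k"
      by (rule ring_hom_ringI2[OF K.ring_axioms P.T.ring_axioms P.pure_hom_right])
    \<comment> \<open>Spans are closed under sums and multiples, so subtraction is rewritten with
      the scalar \<open>-1\<close> from \<open>K\<close>.\<close>
    have e1: "x \<ominus>\<^bsub>P.T\<^esub> y = x \<oplus>\<^bsub>P.T\<^esub> P.pure \<one>\<^bsub>A\<^esub> (\<ominus>\<^bsub>K\<^esub> \<one>\<^bsub>K\<^esub>) \<otimes>\<^bsub>P.T\<^esub> y"
      using diff by (simp add: P.T.minus_eq P.T.l_minus P.pure_one)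
    have e2: "P.pure \<one>\<^bsub>A\<^esub> (\<ominus>\<^bsub>K\<^esub> \<one>\<^bsub>K\<^esub>) \<otimes>\<^bsub>P.T\<^esub> y \<in> lin_span P.T ?F ?S"
      by (rule P.T.lin_span_smult[OF F S imageI diff(4)]) simp_all
    show ?case
      unfolding e1 by (rule P.T.lin_span_add[OF F(1) S diff(3) e2])
  qed
qed

text \<open>The residue map at \<open>p\<close> followed by the identification of the residue field
  with \<open>K\<close>. The condition on scalars selects the identification over
  \<open>K\<close>.\<close>

definition residue_hom where
  "residue_hom p \<eta> \<longleftrightarrow> \<eta> \<in> ring_hom T K \<and> (\<forall>k\<in>carrier K. \<eta> (P.pure \<one>\<^bsub>A\<^esub> k) = k) \<and> p = a_kernel T K \<eta>"

sublocale T: cring T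
  using P.tensor_cring by (simp add: param_ring_eq)

text \<open>The weak Nullstellensatz, obtained with \<open>f = 1\<close>, whose powers avoid the
  proper ideal \<open>p\<close>. It gives a homomorphism that kills \<open>p\<close>; its kernel is
  proper, so by maximality it is no larger than \<open>p\<close>.\<close>

lemma closed_point_residue_hom:
  assumes "closed_point scl G \<rho> K \<iota> p"
  obtains \<eta> where "residue_hom p \<eta>"
proof -
  interpret p: maximalideal p T using assms by (simp add: closed_point_def)
  have one: "\<one>\<^bsub>T\<^esub> [^]\<^bsub>T\<^esub> n \<notin> p" for n :: nat
    using p.I_notcarr p.one_imp_carrier by auto
  have S: "countable ((\<lambda>f. P.pure f \<one>\<^bsub>K\<^esub>) ` monomials scl Basis)"
    "(\<lambda>f. P.pure f \<one>\<^bsub>K\<^esub>) ` monomials scl Basis \<subseteq> carrier T"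
    using countable_monomials[OF V] monomials_in_carrier[OF V] P.pure_closed by (auto simp: param_ring_eq)
  have \<beta>: "(\<lambda>k. P.pure \<one>\<^bsub>A\<^esub> k) \<in> ring_hom K T"
    using P.pure_hom_right by (simp add: param_ring_eq)
  obtain \<eta> where \<eta>: "\<eta> \<in> ring_hom T K" "\<And>k. k \<in> carrier K \<Longrightarrow> \<eta> (P.pure \<one>\<^bsub>A\<^esub> k) = k"
    "\<And>x. x \<in> p \<Longrightarrow> \<eta> x = \<zero>\<^bsub>K\<^esub>"
    by (rule exists_hom_to_alg_closed[OF alg_closed uncountable_K T.cring_axioms \<beta> S
          param_ring_lin_span p.ideal_axioms T.one_closed one]) blast
  interpret \<eta>: ring_hom_ring T K \<eta>
    by (rule ring_hom_ringI2[OF T.ring_axioms K.ring_axioms \<eta>(1)])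
  have "p \<subseteq> a_kernel T K \<eta>"
    using \<eta>(3) p.a_Hcarr by (blast intro: a_kernel_mem_iff[THEN iffD2])
  moreover have "\<one>\<^bsub>T\<^esub> \<notin> a_kernel T K \<eta>"
    unfolding a_kernel_mem_iff using K.one_not_zero by simp
  ultimately have "p = a_kernel T K \<eta>"
    using p.I_maximal[OF \<eta>.kernel_is_ideal] T.one_closed by (blast dest: a_kernel_mem_iff[THEN iffD1])
  then show thesis using \<eta> by (intro that[of \<eta>]) (simp add: residue_hom_def)
qed

lemma residue_hom_closed_point:
  assumes "residue_hom p \<eta>"
  shows "closed_point scl G \<rho> K \<iota> p"
proof -
  have \<eta>: "\<eta> \<in> ring_hom T K" "\<And>k. k \<in> carrier K \<Longrightarrow> \<eta> (P.pure \<one>\<^bsub>A\<^esub> k) = k" and p: "p = a_kernel T K \<eta>"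
    using assms by (auto simp: residue_hom_def)
  interpret \<eta>: ring_hom_ring T K \<eta>
    by (rule ring_hom_ringI2[OF T.ring_axioms K.ring_axioms \<eta>(1)])
  have pure_in: "P.pure \<one>\<^bsub>A\<^esub> k \<in> carrier T" if "k \<in> carrier K" for k
    using P.pure_closed that by (simp add: param_ring_eq)
  show ?thesis
    unfolding closed_point_def p
  proof (rule maximalidealI[OF \<eta>.kernel_is_ideal])
    have "\<one>\<^bsub>T\<^esub> \<notin> a_kernel T K \<eta>"
      unfolding a_kernel_mem_iff using K.one_not_zero by simp
    then show "carrier T \<noteq> a_kernel T K \<eta>" using T.one_closed by blast
  next
    fix J assume J: "ideal J T" "a_kernel T K \<eta> \<subseteq> J" "J \<subseteq> carrier T"
    interpret J: ideal J T by fact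
    show "J = a_kernel T K \<eta> \<or> J = carrier T"
    proof (cases "J \<subseteq> a_kernel T K \<eta>")
      case True
      then show ?thesis using J by blast
    next
      case False
      then obtain x where x: "x \<in> J" "x \<in> carrier T" "\<eta> x \<noteq> \<zero>\<^bsub>K\<^esub>"
        using J(3) a_kernel_mem_iff[of _ T K \<eta>] by blast
      then have u: "\<eta> x \<in> Units K" by (simp add: K.field_Units)
      then have inv_in: "inv\<^bsub>K\<^esub> (\<eta> x) \<in> carrier K" by simp
      \<comment> \<open>Scaling \<open>x\<close> by an element of \<open>K\<close> gives it the
        value 1. Then \<open>1 - y\<close> lies in the kernel and \<open>y\<close> in
        \<open>J\<close>, so \<open>1\<close> lies in \<open>J\<close>.\<close>
      define y where "y = P.pure \<one>\<^bsub>A\<^esub> (inv\<^bsub>K\<^esub> (\<eta> x)) \<otimes>\<^bsub>T\<^esub> x"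
      have y: "y \<in> J" unfolding y_def using x(1) pure_in[OF inv_in] by (rule J.I_l_closed)
      then have yT: "y \<in> carrier T" using J by blast
      have \<eta>y: "\<eta> y = \<one>\<^bsub>K\<^esub>" unfolding y_def \<eta>.hom_mult[OF pure_in[OF inv_in] x(2)] \<eta>(2)[OF inv_in]
        using u by simp
      have "\<eta> (\<one>\<^bsub>T\<^esub> \<ominus>\<^bsub>T\<^esub> y) = \<eta> \<one>\<^bsub>T\<^esub> \<oplus>\<^bsub>K\<^esub> \<ominus>\<^bsub>K\<^esub> \<eta> y"
        unfolding T.minus_eq using yT by (simp del: \<eta>.hom_one)
      also have "\<dots> = \<zero>\<^bsub>K\<^esub>" unfolding \<eta>y by (simp add: K.r_neg)
      finally have "\<one>\<^bsub>T\<^esub> \<ominus>\<^bsub>T\<^esub> y \<in> a_kernel T K \<eta>"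
        unfolding a_kernel_mem_iff using yT by blast
      then have "(\<one>\<^bsub>T\<^esub> \<ominus>\<^bsub>T\<^esub> y) \<oplus>\<^bsub>T\<^esub> y \<in> J" using J y by (intro J.a_closed) auto
      moreover have "(\<one>\<^bsub>T\<^esub> \<ominus>\<^bsub>T\<^esub> y) \<oplus>\<^bsub>T\<^esub> y = \<one>\<^bsub>T\<^esub>"
        using yT by (simp add: T.minus_eq T.a_assoc T.l_neg)
      ultimately have "\<one>\<^bsub>T\<^esub> \<in> J" by simp
      then show ?thesis using J.one_imp_carrier by blast
    qed
  qed
qed

lemma residue_hom_hom: "residue_hom p \<eta> \<Longrightarrow> \<eta> \<in> ring_hom T K"
  and residue_hom_scalar: "residue_hom p \<eta> \<Longrightarrow> k \<in> carrier K \<Longrightarrow> \<eta> (P.pure \<one>\<^bsub>A\<^esub> k) = k"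
  and residue_hom_kernel: "residue_hom p \<eta> \<Longrightarrow> p = a_kernel T K \<eta>"
  by (simp_all add: residue_hom_def)

section \<open>The homomorphism on polynomial functions attached to a closed point\<close>

context
  fixes p \<eta> assumes r: "residue_hom p \<eta>"
begin

lemma coord_hom: "(\<lambda>f. \<eta> (P.pure f \<one>\<^bsub>K\<^esub>)) \<in> ring_hom A K"
  using ring_hom_trans[OF P.pure_hom_left residue_hom_hom[OF r, folded param_ring_eq]]
  by (simp add: o_def)

text \<open>Balancing moves an invariant to the scalar side of the tensor, where
  \<open>\<eta>\<close> acts as the identity.\<close>

lemma coord_hom_invariant:
  assumes "f \<in> carrier B"
  shows "\<eta> (P.pure f \<one>\<^bsub>K\<^esub>) = j f"
proof -
  have "P.pure f \<one>\<^bsub>K\<^esub> = P.pure \<one>\<^bsub>A\<^esub> (j f)"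
    using P.pure_balanced[OF assms A.one_closed K.one_closed] B_subset[OF assms] j_closed[OF assms] by simp
  then show ?thesis using residue_hom_scalar[OF r j_closed[OF assms]] by simp
qed

lemma residue_hom_pure:
  assumes "f \<in> carrier A" "k \<in> carrier K"
  shows "\<eta> (P.pure f k) = \<eta> (P.pure f \<one>\<^bsub>K\<^esub>) \<otimes>\<^bsub>K\<^esub> k"
proof -
  have "P.pure f k = P.pure f \<one>\<^bsub>K\<^esub> \<otimes>\<^bsub>P.T\<^esub> P.pure \<one>\<^bsub>A\<^esub> k"
    using assms by (simp add: P.pure_mult)
  moreover have "\<eta> (P.pure f \<one>\<^bsub>K\<^esub> \<otimes>\<^bsub>P.T\<^esub> P.pure \<one>\<^bsub>A\<^esub> k) = \<eta> (P.pure f \<one>\<^bsub>K\<^esub>) \<otimes>\<^bsub>K\<^esub> \<eta> (P.pure \<one>\<^bsub>A\<^esub> k)"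
    using assms by (intro ring_hom_mult[OF residue_hom_hom[OF r, folded param_ring_eq]]) auto
  ultimately show ?thesis using residue_hom_scalar[OF r assms(2)] by simp
qed

lemma point_ideal_eq:
  "point_ideal scl G \<rho> K \<iota> p = a_kernel (ambient_ring scl K \<iota>) K (\<eta> \<circ> ambient_to_param scl G \<rho> K \<iota>)"
  unfolding point_ideal_def residue_hom_kernel[OF r] a_kernel_def'
  using ring_hom_closed[OF ambient_to_param_hom] by auto

lemma point_prime_eq:
  "point_prime scl G \<rho> K \<iota> p = a_kernel A K (\<lambda>f. \<eta> (P.pure f \<one>\<^bsub>K\<^esub>))"
proof -
  have "ambient_pure scl K \<iota> f \<one>\<^bsub>K\<^esub> \<in> carrier (ambient_ring scl K \<iota>)" if "f \<in> carrier A" for f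
    using M.pure_closed[OF that K.one_closed] by (simp add: ambient_ring_eq ambient_pure_eq)
  then show ?thesis
    unfolding point_prime_def point_ideal_eq
    by (auto simp: a_kernel_def' ambient_to_param_pure)
qed

text \<open>\<open>f \<otimes> 1\<close> and \<open>1 \<otimes> k\<close> with
  \<open>k = \<eta> (f \<otimes> 1)\<close> have the same image in \<open>K\<close>, hence the same
  class modulo the ideal of the point. No other scalar has this class, so inverting
  \<open>k \<mapsto> 1 \<otimes> k\<close> returns that value.\<close>

lemma residue_value_eq:
  assumes f: "f \<in> carrier A"
  shows "residue_value scl K \<iota> (point_ideal scl G \<rho> K \<iota> p) (ambient_pure scl K \<iota> f \<one>\<^bsub>K\<^esub>) = \<eta> (P.pure f \<one>\<^bsub>K\<^esub>)"
proof -
  let ?T0 = "ambient_ring scl K \<iota>"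
  let ?\<eta>0 = "\<eta> \<circ> ambient_to_param scl G \<rho> K \<iota>"
  let ?m = "a_kernel ?T0 K ?\<eta>0"
  interpret T0: cring ?T0 using M.tensor_cring by (simp add: ambient_ring_eq)
  interpret \<eta>0: ring_hom_ring ?T0 K ?\<eta>0
    by (intro ring_hom_ringI2 T0.ring_axioms K.ring_axioms ring_hom_trans[OF ambient_to_param_hom residue_hom_hom[OF r]])
  have pure_in: "ambient_pure scl K \<iota> g k \<in> carrier ?T0" if "g \<in> carrier A" "k \<in> carrier K" for g k
    using M.pure_closed[OF that] by (simp add: ambient_ring_eq ambient_pure_eq)
  have scalar: "?\<eta>0 (ambient_pure scl K \<iota> \<one>\<^bsub>A\<^esub> k) = k" if "k \<in> carrier K" for k
    using that residue_hom_scalar[OF r] by (simp add: ambient_to_param_pure)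
  have h_in: "\<eta> (P.pure f \<one>\<^bsub>K\<^esub>) \<in> carrier K" using ring_hom_closed[OF coord_hom f] .
  show ?thesis
    unfolding residue_value_def point_ideal_eq
  proof (rule the_inv_into_f_eq)
    show "inj_on (\<lambda>k. ?m +>\<^bsub>?T0\<^esub> ambient_pure scl K \<iota> \<one>\<^bsub>A\<^esub> k) (carrier K)"
    proof (rule inj_onI)
      fix k l assume kl: "k \<in> carrier K" "l \<in> carrier K"
        and "?m +>\<^bsub>?T0\<^esub> ambient_pure scl K \<iota> \<one>\<^bsub>A\<^esub> k = ?m +>\<^bsub>?T0\<^esub> ambient_pure scl K \<iota> \<one>\<^bsub>A\<^esub> l"
      then have "?\<eta>0 (ambient_pure scl K \<iota> \<one>\<^bsub>A\<^esub> k) = ?\<eta>0 (ambient_pure scl K \<iota> \<one>\<^bsub>A\<^esub> l)"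
        using \<eta>0.kernel_coset_eq_iff[OF pure_in pure_in] by blast
      then show "k = l" using scalar kl by metis
    qed
    have "?\<eta>0 (ambient_pure scl K \<iota> \<one>\<^bsub>A\<^esub> (\<eta> (P.pure f \<one>\<^bsub>K\<^esub>))) = ?\<eta>0 (ambient_pure scl K \<iota> f \<one>\<^bsub>K\<^esub>)"
      unfolding scalar[OF h_in] using f by (simp add: ambient_to_param_pure)
    then show "?m +>\<^bsub>?T0\<^esub> ambient_pure scl K \<iota> \<one>\<^bsub>A\<^esub> (\<eta> (P.pure f \<one>\<^bsub>K\<^esub>)) =
        ?m +>\<^bsub>?T0\<^esub> ambient_pure scl K \<iota> f \<one>\<^bsub>K\<^esub>"
      using \<eta>0.kernel_coset_eq_iff[OF pure_in[OF A.one_closed h_in] pure_in[OF f K.one_closed]] by blast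
  qed (rule h_in)
qed

section \<open>Functions on the subvariety of a closed point\<close>

context
  fixes Y assumes Y: "point_subvariety scl G \<rho> K \<iota> p = Y"
begin

interpretation h: ring_hom_ring A K "\<lambda>f. \<eta> (P.pure f \<one>\<^bsub>K\<^esub>)"
  by (rule ring_hom_ringI2[OF A.ring_axioms K.ring_axioms coord_hom])

text \<open>One inclusion holds because \<open>Y\<close> is the zero set of the kernel. The other
  needs the Nullstellensatz: a function outside the kernel must be nonzero at some point of
  \<open>Y\<close>.\<close>

lemma vanishing_ideal_eq: "vanishing_ideal scl Y = a_kernel A K (\<lambda>f. \<eta> (P.pure f \<one>\<^bsub>K\<^esub>))"
proof
  show "a_kernel A K (\<lambda>f. \<eta> (P.pure f \<one>\<^bsub>K\<^esub>)) \<subseteq> vanishing_ideal scl Y"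
  proof
    fix f assume f: "f \<in> a_kernel A K (\<lambda>f. \<eta> (P.pure f \<one>\<^bsub>K\<^esub>))"
    then have "f \<in> carrier A" unfolding a_kernel_mem_iff by blast
    then show "f \<in> vanishing_ideal scl Y"
      using f unfolding vanishing_ideal_def Y[symmetric] point_subvariety_def point_prime_eq by blast
  qed
  show "vanishing_ideal scl Y \<subseteq> a_kernel A K (\<lambda>f. \<eta> (P.pure f \<one>\<^bsub>K\<^esub>))"
  proof
    fix f assume "f \<in> vanishing_ideal scl Y"
    then have f: "f \<in> carrier A" and zero: "\<And>v. v \<in> Y \<Longrightarrow> f v = 0" by (auto simp: vanishing_ideal_def)
    show "f \<in> a_kernel A K (\<lambda>f. \<eta> (P.pure f \<one>\<^bsub>K\<^esub>))"
    proof (rule ccontr)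
      assume "f \<notin> a_kernel A K (\<lambda>f. \<eta> (P.pure f \<one>\<^bsub>K\<^esub>))"
      then have nz: "\<eta> (P.pure f \<one>\<^bsub>K\<^esub>) \<noteq> \<zero>\<^bsub>K\<^esub>" using f unfolding a_kernel_mem_iff by blast
      \<comment> \<open>Since \<open>K\<close> has no zero divisors, the kernel is radical, so no
        power of \<open>f\<close> lies in it.\<close>
      have "\<eta> (P.pure f \<one>\<^bsub>K\<^esub>) [^]\<^bsub>K\<^esub> n \<noteq> \<zero>\<^bsub>K\<^esub>" for n :: nat
      proof (induction n)
        case (Suc n)
        then show ?case
          using nz f h.hom_closed[OF f] K.integral[of "\<eta> (P.pure f \<one>\<^bsub>K\<^esub>) [^]\<^bsub>K\<^esub> n" "\<eta> (P.pure f \<one>\<^bsub>K\<^esub>)"] by auto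
      qed simp
      then have "f [^]\<^bsub>A\<^esub> n \<notin> a_kernel A K (\<lambda>f. \<eta> (P.pure f \<one>\<^bsub>K\<^esub>))" for n :: nat
        unfolding a_kernel_mem_iff h.hom_nat_pow[OF f] by blast
      from nullstellensatz[OF V h.kernel_is_ideal f this]
      obtain v where "\<forall>g\<in>a_kernel A K (\<lambda>f. \<eta> (P.pure f \<one>\<^bsub>K\<^esub>)). g v = 0" "f v \<noteq> 0" by blast
      then show False
        using zero[of v] unfolding Y[symmetric] point_subvariety_def point_prime_eq by blast
    qed
  qed
qed

lemma subvariety_ring_eq: "subvariety_ring scl Y = A Quot a_kernel A K (\<lambda>f. \<eta> (P.pure f \<one>\<^bsub>K\<^esub>))"
  by (simp add: subvariety_ring_def vanishing_ideal_eq)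

lemma vanishing_ideal_ideal: "ideal (vanishing_ideal scl Y) A"
  unfolding vanishing_ideal_eq by (rule h.kernel_is_ideal)

text \<open>\<open>Y\<close> is determined by its ideal. A point constructed later is therefore
  known to lie over \<open>Y\<close> as soon as its prime is the vanishing ideal.\<close>

lemma point_subvariety_vanishing_ideal: "Y = {v. \<forall>f\<in>vanishing_ideal scl Y. f v = 0}"
  using Y unfolding vanishing_ideal_eq point_subvariety_def point_prime_eq by simp

lemma subvariety_ring_cring: "cring (subvariety_ring scl Y)"
  unfolding subvariety_ring_def by (rule ideal.quotient_is_cring[OF vanishing_ideal_ideal A.cring_axioms])

lemma subvariety_ring_carrier:
  "carrier (subvariety_ring scl Y) = (+>\<^bsub>A\<^esub>) (vanishing_ideal scl Y) ` carrier A"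
  unfolding subvariety_ring_def by (rule ideal.quot_carrier[OF vanishing_ideal_ideal])

text \<open>In this form the map is the one that the first isomorphism theorem attaches to the
  homomorphism \<open>f \<mapsto> \<eta> (f \<otimes> 1)\<close>, so that being a homomorphism and
  being injective both come from there.\<close>

lemma coord_embedding_eq_the_elem:
  assumes "F \<in> carrier (subvariety_ring scl Y)"
  shows "coord_embedding scl G \<rho> K \<iota> p F = the_elem ((\<lambda>f. \<eta> (P.pure f \<one>\<^bsub>K\<^esub>)) ` F)"
proof -
  obtain f where f: "f \<in> carrier A" "F = vanishing_ideal scl Y +>\<^bsub>A\<^esub> f"
    using assms unfolding subvariety_ring_carrier by blast
  then have "F \<subseteq> carrier A"
    using A.a_r_coset_subset_G[OF _ f(1)] ideal.Icarr[OF vanishing_ideal_ideal] by blast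
  then have "(\<lambda>f. residue_value scl K \<iota> (point_ideal scl G \<rho> K \<iota> p) (ambient_pure scl K \<iota> f \<one>\<^bsub>K\<^esub>)) ` F
      = (\<lambda>f. \<eta> (P.pure f \<one>\<^bsub>K\<^esub>)) ` F"
    by (intro image_cong refl residue_value_eq) blast
  then show ?thesis unfolding coord_embedding_def by simp
qed

lemma coord_embedding_coset:
  assumes f: "f \<in> carrier A"
  shows "coord_embedding scl G \<rho> K \<iota> p (vanishing_ideal scl Y +>\<^bsub>A\<^esub> f) = \<eta> (P.pure f \<one>\<^bsub>K\<^esub>)"
proof -
  have "vanishing_ideal scl Y +>\<^bsub>A\<^esub> f \<in> carrier (subvariety_ring scl Y)"
    using f unfolding subvariety_ring_carrier by blast
  from coord_embedding_eq_the_elem[OF this] show ?thesis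
    unfolding vanishing_ideal_eq h.the_elem_simp[OF f] .
qed

lemma coord_embedding_hom: "coord_embedding scl G \<rho> K \<iota> p \<in> ring_hom (subvariety_ring scl Y) K"
proof (rule ring.ring_hom_restrict)
  show "ring (subvariety_ring scl Y)" using subvariety_ring_cring by (rule cring.axioms(1))
  show "(\<lambda>F. the_elem ((\<lambda>f. \<eta> (P.pure f \<one>\<^bsub>K\<^esub>)) ` F)) \<in> ring_hom (subvariety_ring scl Y) K"
    unfolding subvariety_ring_eq by (rule h.the_elem_hom)
qed (rule coord_embedding_eq_the_elem[symmetric])

lemma coord_embedding_inj: "inj_on (coord_embedding scl G \<rho> K \<iota> p) (carrier (subvariety_ring scl Y))"
proof (rule inj_onI)
  fix E F assume EF: "E \<in> carrier (subvariety_ring scl Y)" "F \<in> carrier (subvariety_ring scl Y)"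
    and "coord_embedding scl G \<rho> K \<iota> p E = coord_embedding scl G \<rho> K \<iota> p F"
  then have "the_elem ((\<lambda>f. \<eta> (P.pure f \<one>\<^bsub>K\<^esub>)) ` E) = the_elem ((\<lambda>f. \<eta> (P.pure f \<one>\<^bsub>K\<^esub>)) ` F)"
    by (simp add: coord_embedding_eq_the_elem)
  then show "E = F" using EF h.the_elem_inj unfolding subvariety_ring_eq by blast
qed

text \<open>The ring embeds into the field \<open>K\<close>. Geometrically, this is the
  irreducibility of \<open>Y\<close>.\<close>

lemma subvariety_ring_domain: "domain (subvariety_ring scl Y)"
proof -
  interpret D: cring "subvariety_ring scl Y" by (rule subvariety_ring_cring)
  interpret e: ring_hom_ring "subvariety_ring scl Y" K "coord_embedding scl G \<rho> K \<iota> p"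
    by (rule ring_hom_ringI2[OF D.ring_axioms K.ring_axioms coord_embedding_hom])
  have zero: "E = \<zero>\<^bsub>subvariety_ring scl Y\<^esub>"
    if "E \<in> carrier (subvariety_ring scl Y)" "coord_embedding scl G \<rho> K \<iota> p E = \<zero>\<^bsub>K\<^esub>" for E
    using inj_onD[OF coord_embedding_inj, of E "\<zero>\<^bsub>subvariety_ring scl Y\<^esub>"] that by simp
  show ?thesis
  proof (intro domain.intro domain_axioms.intro D.cring_axioms)
    show "\<one>\<^bsub>subvariety_ring scl Y\<^esub> \<noteq> \<zero>\<^bsub>subvariety_ring scl Y\<^esub>"
      using e.hom_one e.hom_zero K.one_not_zero by metis
  next
    fix E F assume EF: "E \<otimes>\<^bsub>subvariety_ring scl Y\<^esub> F = \<zero>\<^bsub>subvariety_ring scl Y\<^esub>"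
      "E \<in> carrier (subvariety_ring scl Y)" "F \<in> carrier (subvariety_ring scl Y)"
    then have "coord_embedding scl G \<rho> K \<iota> p E \<otimes>\<^bsub>K\<^esub> coord_embedding scl G \<rho> K \<iota> p F = \<zero>\<^bsub>K\<^esub>"
      using e.hom_mult[OF EF(2,3)] by simp
    then have "coord_embedding scl G \<rho> K \<iota> p E = \<zero>\<^bsub>K\<^esub> \<or> coord_embedding scl G \<rho> K \<iota> p F = \<zero>\<^bsub>K\<^esub>"
      using K.integral EF by simp
    then show "E = \<zero>\<^bsub>subvariety_ring scl Y\<^esub> \<or> F = \<zero>\<^bsub>subvariety_ring scl Y\<^esub>"
      using zero EF by blast
  qed
qed

text \<open>From \<open>a d = c b\<close> the cosets satisfy the same cross relation, so all
  representatives with denominator nonzero on \<open>Y\<close> restrict to one fraction, and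
  \<open>a / b\<close> itself shows that such a representative exists.\<close>

lemma restrict_rat_fraction:
  assumes a: "a \<in> carrier A" and b: "b \<in> carrier A" "b \<notin> vanishing_ideal scl Y"
  shows "restrict_rat scl Y (fraction A a b) =
    fraction (subvariety_ring scl Y) (vanishing_ideal scl Y +>\<^bsub>A\<^esub> a) (vanishing_ideal scl Y +>\<^bsub>A\<^esub> b)"
proof -
  let ?I = "vanishing_ideal scl Y" and ?D = "subvariety_ring scl Y"
  interpret I: ideal ?I A by (rule vanishing_ideal_ideal)
  interpret D: domain ?D by (rule subvariety_ring_domain)
  interpret q: ring_hom_ring A ?D "(+>\<^bsub>A\<^esub>) ?I"
    unfolding subvariety_ring_def by (rule I.rcos_ring_hom_ring)
  have nz: "?I +>\<^bsub>A\<^esub> d \<noteq> \<zero>\<^bsub>?D\<^esub>" if "d \<in> carrier A" "d \<notin> ?I" for d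
    using I.quot_zero_iff[OF that(1)] that(2) by (simp add: subvariety_ring_def)
  have b0: "b \<noteq> \<zero>\<^bsub>A\<^esub>" using b(2) I.zero_closed by blast
  show ?thesis
    unfolding restrict_rat_def
  proof (rule UN_pairs_const)
    show "(a, b) \<in> {(c, d) \<in> fraction A a b. d \<notin> ?I}"
      using A.fraction_self[OF a b(1) b0] b(2) by simp
  next
    fix c d assume "(c, d) \<in> {(c, d) \<in> fraction A a b. d \<notin> ?I}"
    then have cd: "c \<in> carrier A" "d \<in> carrier A" "d \<notin> ?I" "a \<otimes>\<^bsub>A\<^esub> d = c \<otimes>\<^bsub>A\<^esub> b"
      by (auto simp: A.mem_fraction_iff)
    have "(?I +>\<^bsub>A\<^esub> c) \<otimes>\<^bsub>?D\<^esub> (?I +>\<^bsub>A\<^esub> b) = (?I +>\<^bsub>A\<^esub> a) \<otimes>\<^bsub>?D\<^esub> (?I +>\<^bsub>A\<^esub> d)"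
      using q.hom_mult[OF cd(1) b(1)] q.hom_mult[OF a cd(2)] cd(4) by simp
    then show "fraction ?D (?I +>\<^bsub>A\<^esub> c) (?I +>\<^bsub>A\<^esub> d) = fraction ?D (?I +>\<^bsub>A\<^esub> a) (?I +>\<^bsub>A\<^esub> b)"
      using nz a b cd by (subst D.fraction_eq_iff) auto
  qed
qed

end

end

section \<open>The natural map and its inverse\<close>

lemma natural_embedding_in_K_embeddings:
  assumes r: "residue_hom p \<eta>" and Y: "point_subvariety scl G \<rho> K \<iota> p = Y"
  shows "natural_embedding scl G \<rho> K \<iota> Y p \<in> K_embeddings scl G \<rho> K \<iota> Y"
proof -
  let ?I = "vanishing_ideal scl Y" and ?D = "subvariety_ring scl Y"
  let ?e = "coord_embedding scl G \<rho> K \<iota> p"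
  interpret D: domain ?D by (rule subvariety_ring_domain[OF r Y])
  note e = K.field_axioms coord_embedding_hom[OF r Y] coord_embedding_inj[OF r Y]
  have F: "function_field scl Y = frac_field ?D" by (simp add: function_field_def)
  have "natural_embedding scl G \<rho> K \<iota> Y p (restrict_rat scl Y Z) = \<iota> Z"
    if Z: "Z \<in> carrier (inv_field scl G \<rho>)" for Z
  proof -
    obtain a b where ab: "a \<in> carrier B" "b \<in> carrier B" "b \<noteq> \<zero>\<^bsub>A\<^esub>" "Z = fraction A a b"
      using Z unfolding frac by blast
    note abA = B_subset[OF ab(1)] B_subset[OF ab(2)]
    \<comment> \<open>On invariants the homomorphism of the point is \<open>j\<close>, which sends
      the denominator to a unit. So \<open>b\<close> is not in the ideal of \<open>Y\<close>, and
      \<open>a / b\<close> has a restriction.\<close>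
    have jb: "j b \<noteq> \<zero>\<^bsub>K\<^esub>" using j_Units[OF ab(2,3)] by (simp add: K.field_Units)
    then have bI: "b \<notin> ?I"
      unfolding vanishing_ideal_eq[OF r Y] a_kernel_mem_iff coord_hom_invariant[OF r ab(2)] by blast
    have in_D: "?I +>\<^bsub>A\<^esub> a \<in> carrier ?D" "?I +>\<^bsub>A\<^esub> b \<in> carrier ?D"
      unfolding subvariety_ring_carrier[OF r Y] using abA by blast+
    have nz: "?I +>\<^bsub>A\<^esub> b \<noteq> \<zero>\<^bsub>?D\<^esub>"
      using ideal.quot_zero_iff[OF vanishing_ideal_ideal[OF r Y] abA(2)] bI by (simp add: subvariety_ring_def)
    have "fraction ?D (?I +>\<^bsub>A\<^esub> a) (?I +>\<^bsub>A\<^esub> b) \<in> carrier (frac_field ?D)"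
      unfolding D.frac_field_carrier using in_D nz by blast
    then have "natural_embedding scl G \<rho> K \<iota> Y p (restrict_rat scl Y Z) =
        ?e (?I +>\<^bsub>A\<^esub> a) \<otimes>\<^bsub>K\<^esub> inv\<^bsub>K\<^esub> ?e (?I +>\<^bsub>A\<^esub> b)"
      unfolding natural_embedding_def F ab(4) restrict_rat_fraction[OF r Y abA bI]
      by (simp add: D.frac_lift_fraction[OF e in_D nz])
    also have "\<dots> = \<iota> Z"
      unfolding coord_embedding_coset[OF r Y abA(1)] coord_embedding_coset[OF r Y abA(2)]
        coord_hom_invariant[OF r ab(1)] coord_hom_invariant[OF r ab(2)] ab(4)
      by (rule \<iota>_fraction[OF ab(1-3), symmetric])
    finally show ?thesis .
  qed
  moreover have "natural_embedding scl G \<rho> K \<iota> Y p \<in> ring_hom (function_field scl Y) K"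
    unfolding natural_embedding_def F
    by (rule restrict_ring_hom[OF D.frac_lift_hom[OF e]]) (rule D.frac_field_closed; assumption)+
  moreover have "inj_on (natural_embedding scl G \<rho> K \<iota> Y p) (carrier (function_field scl Y))"
    unfolding natural_embedding_def F using D.frac_lift_inj[OF e] by (simp add: inj_on_restrict_eq)
  ultimately show ?thesis
    unfolding K_embeddings_def by (simp add: natural_embedding_def)
qed

text \<open>Evaluating the embedding at \<open>f / 1\<close> returns the value at
  \<open>f \<otimes> 1\<close>. Linearity over \<open>K\<close> extends this to all pure tensors, so
  the two homomorphisms agree on the tensor product and have the same kernel.\<close>

lemma natural_embedding_determines_point:
  assumes r: "residue_hom p \<eta>" and Y: "point_subvariety scl G \<rho> K \<iota> p = Y"
    and r': "residue_hom q \<theta>" and Y': "point_subvariety scl G \<rho> K \<iota> q = Y"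
    and eq: "natural_embedding scl G \<rho> K \<iota> Y p = natural_embedding scl G \<rho> K \<iota> Y q"
  shows "p = q"
proof -
  let ?I = "vanishing_ideal scl Y" and ?D = "subvariety_ring scl Y"
  interpret D: domain ?D by (rule subvariety_ring_domain[OF r Y])
  note e = K.field_axioms coord_embedding_hom[OF r Y] coord_embedding_inj[OF r Y]
  note e' = K.field_axioms coord_embedding_hom[OF r' Y'] coord_embedding_inj[OF r' Y']
  have coord: "\<eta> (P.pure f \<one>\<^bsub>K\<^esub>) = \<theta> (P.pure f \<one>\<^bsub>K\<^esub>)" if f: "f \<in> carrier A" for f
  proof -
    let ?Z = "fraction ?D (?I +>\<^bsub>A\<^esub> f) \<one>\<^bsub>?D\<^esub>"
    have fD: "?I +>\<^bsub>A\<^esub> f \<in> carrier ?D"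
      unfolding subvariety_ring_carrier[OF r Y] using f by blast
    then have Z: "?Z \<in> carrier (function_field scl Y)"
      unfolding function_field_def D.frac_field_carrier using D.one_closed D.one_not_zero by blast
    have "coord_embedding scl G \<rho> K \<iota> p (?I +>\<^bsub>A\<^esub> f) = natural_embedding scl G \<rho> K \<iota> Y p ?Z"
      using Z fD ring_hom_closed[OF e(2) fD] ring_hom_one[OF e(2)]
      by (simp add: natural_embedding_def D.frac_lift_fraction[OF e])
    also have "\<dots> = coord_embedding scl G \<rho> K \<iota> q (?I +>\<^bsub>A\<^esub> f)"
      unfolding eq using Z fD ring_hom_closed[OF e'(2) fD] ring_hom_one[OF e'(2)]
      by (simp add: natural_embedding_def D.frac_lift_fraction[OF e'])
    finally show ?thesis
      unfolding coord_embedding_coset[OF r Y f] coord_embedding_coset[OF r' Y' f] .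
  qed
  interpret \<eta>: ring_hom_ring P.T K \<eta>
    by (rule ring_hom_ringI2[OF P.T.ring_axioms K.ring_axioms residue_hom_hom[OF r, folded param_ring_eq]])
  interpret \<theta>: ring_hom_ring P.T K \<theta>
    by (rule ring_hom_ringI2[OF P.T.ring_axioms K.ring_axioms residue_hom_hom[OF r', folded param_ring_eq]])
  have "\<eta> Z = \<theta> Z" if "Z \<in> carrier P.T" for Z
    using that
  proof (induction rule: P.tensor_induct)
    case zero
    then show ?case by simp
  next
    case (pure f k)
    then show ?case using residue_hom_pure[OF r pure] residue_hom_pure[OF r' pure] coord by simp
  next
    case (diff x y)
    then show ?case by (simp add: P.T.minus_eq)
  qed
  then show ?thesis
    unfolding residue_hom_kernel[OF r] residue_hom_kernel[OF r'] param_ring_eq a_kernel_def' by auto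
qed

text \<open>The inverse construction: restrict \<open>s\<close> to \<complex>[Y], pull it back to a
  homomorphism \<open>h\<close> on \<complex>[V], and combine \<open>h\<close> with the identity of
  \<open>K\<close> by the universal property of the tensor product. The kernel of the result is the
  required point. The given point \<open>p0\<close> guarantees that \<complex>[Y] is a domain and
  that \<open>Y\<close> is the zero set of its ideal.\<close>

lemma embedding_is_natural:
  assumes r0: "residue_hom p0 \<eta>0" and Y: "point_subvariety scl G \<rho> K \<iota> p0 = Y"
    and s: "s \<in> K_embeddings scl G \<rho> K \<iota> Y"
  shows "\<exists>p \<eta>. residue_hom p \<eta> \<and> point_subvariety scl G \<rho> K \<iota> p = Y \<and>
    natural_embedding scl G \<rho> K \<iota> Y p = s"
proof -
  let ?I = "vanishing_ideal scl Y" and ?D = "subvariety_ring scl Y"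
  interpret D: domain ?D by (rule subvariety_ring_domain[OF r0 Y])
  interpret I: ideal ?I A by (rule vanishing_ideal_ideal[OF r0 Y])
  have q: "(+>\<^bsub>A\<^esub>) ?I \<in> ring_hom A ?D"
    unfolding subvariety_ring_def by (rule I.rcos_ring_hom)
  have F: "function_field scl Y = frac_field ?D" by (simp add: function_field_def)
  have s_hom: "s \<in> ring_hom (frac_field ?D) K" and s_inj: "inj_on s (carrier (frac_field ?D))"
    and s_ext: "s \<in> extensional (carrier (frac_field ?D))"
    and s_id: "\<And>Z. Z \<in> carrier (inv_field scl G \<rho>) \<Longrightarrow> s (restrict_rat scl Y Z) = \<iota> Z"
    using s unfolding K_embeddings_def F by auto
  define e where "e = (\<lambda>E. s (fraction ?D E \<one>\<^bsub>?D\<^esub>))"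
  have e_hom: "e \<in> ring_hom ?D K" and e_inj: "inj_on e (carrier ?D)"
    unfolding e_def using D.embedding_fraction[OF K.field_axioms s_hom s_inj] by blast+
  interpret e: ring_hom_ring ?D K e
    by (rule ring_hom_ringI2[OF D.ring_axioms K.ring_axioms e_hom])
  define h where "h f = e (?I +>\<^bsub>A\<^esub> f)" for f
  have h_hom: "h \<in> ring_hom A K"
    using ring_hom_trans[OF q e_hom] by (simp add: h_def[abs_def] o_def)
  have one_I: "\<one>\<^bsub>A\<^esub> \<notin> ?I"
    using I.quot_zero_iff[OF A.one_closed] ring_hom_one[OF q] D.one_not_zero by (simp add: subvariety_ring_def)
  \<comment> \<open>The compatibility required over \<complex>[V]^G: apply the identity condition on
    \<open>s\<close> to the invariant rational function \<open>f / 1\<close>, whose restriction is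
    the coset of \<open>f\<close> over 1.\<close>
  have h_inv: "h f = j f" if f: "f \<in> carrier B" for f
  proof -
    have "j f = s (restrict_rat scl Y (fraction A f \<one>\<^bsub>A\<^esub>))"
      unfolding j_eq by (rule s_id[symmetric]) (use f B_one in \<open>auto intro!: fraction_in_inv_field\<close>)
    also have "\<dots> = h f"
      unfolding restrict_rat_fraction[OF r0 Y B_subset[OF f] A.one_closed one_I] h_def e_def ring_hom_one[OF q] ..
    finally show ?thesis ..
  qed
  \<comment> \<open>Injectivity of the embedding makes the kernel of \<open>h\<close> equal to the
    ideal of \<open>Y\<close>, so that the new point lies over \<open>Y\<close> itself and not over
    a smaller subvariety.\<close>
  have h_zero: "h f = \<zero>\<^bsub>K\<^esub> \<longleftrightarrow> f \<in> ?I" if f: "f \<in> carrier A" for f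
  proof -
    have "h f = e \<zero>\<^bsub>?D\<^esub> \<longleftrightarrow> ?I +>\<^bsub>A\<^esub> f = \<zero>\<^bsub>?D\<^esub>"
      unfolding h_def by (rule inj_on_eq_iff[OF e_inj]) (use ring_hom_closed[OF q f] in auto)
    also have "\<dots> \<longleftrightarrow> f \<in> ?I" unfolding subvariety_ring_def by (rule I.quot_zero_iff[OF f])
    finally show ?thesis unfolding e.hom_zero .
  qed
  have "\<exists>\<eta>\<in>ring_hom P.T K. \<forall>f\<in>carrier A. \<forall>k\<in>carrier K. \<eta> (P.pure f k) = h f \<otimes>\<^bsub>K\<^esub> k"
  proof (rule P.tensor_lift[OF K.cring_axioms h_hom])
    show "(\<lambda>k. k) \<in> ring_hom K K" by (rule ring_hom_memI) auto
  qed (rule h_inv)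
  then obtain \<eta> where \<eta>: "\<eta> \<in> ring_hom P.T K"
    and \<eta>_pure: "\<And>f k. f \<in> carrier A \<Longrightarrow> k \<in> carrier K \<Longrightarrow> \<eta> (P.pure f k) = h f \<otimes>\<^bsub>K\<^esub> k" by blast
  define p where "p = a_kernel T K \<eta>"
  have h_in: "h f \<in> carrier K" if "f \<in> carrier A" for f using ring_hom_closed[OF h_hom that] .
  have r: "residue_hom p \<eta>"
    using \<eta> \<eta>_pure ring_hom_one[OF h_hom] by (simp add: residue_hom_def p_def param_ring_eq)
  have \<eta>_h: "\<eta> (P.pure f \<one>\<^bsub>K\<^esub>) = h f" if "f \<in> carrier A" for f
    using \<eta>_pure[OF that K.one_closed] h_in[OF that] by simp
  have "point_prime scl G \<rho> K \<iota> p = ?I"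
  proof -
    have "?I \<subseteq> carrier A" by (rule I.a_subset)
    then show ?thesis
      unfolding point_prime_eq[OF r] using \<eta>_h h_zero by (auto simp: a_kernel_mem_iff)
  qed
  then have pY: "point_subvariety scl G \<rho> K \<iota> p = Y"
    unfolding point_subvariety_def using point_subvariety_vanishing_ideal[OF r0 Y] by simp
  \<comment> \<open>Both sides are extensional, so agreement on \<complex>(Y) suffices; there each
    is the extension to fractions of its values on \<complex>[Y], and these values are
    \<open>e\<close>.\<close>
  have "natural_embedding scl G \<rho> K \<iota> Y p = s"
  proof (rule extensionalityI)
    show "natural_embedding scl G \<rho> K \<iota> Y p \<in> extensional (carrier (frac_field ?D))"
      by (simp add: natural_embedding_def F)
    fix Z assume Z: "Z \<in> carrier (frac_field ?D)"
    have coset: "coord_embedding scl G \<rho> K \<iota> p E = e E" if "E \<in> carrier ?D" for E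
    proof -
      have "E \<in> (+>\<^bsub>A\<^esub>) ?I ` carrier A"
        using that unfolding subvariety_ring_carrier[OF r0 Y] .
      then obtain f where f: "E = ?I +>\<^bsub>A\<^esub> f" "f \<in> carrier A" by (rule imageE)
      show ?thesis
        unfolding f(1) coord_embedding_coset[OF r pY f(2)] \<eta>_h[OF f(2)] h_def ..
    qed
    have "natural_embedding scl G \<rho> K \<iota> Y p Z = frac_lift K (coord_embedding scl G \<rho> K \<iota> p) Z"
      using Z by (simp add: natural_embedding_def F)
    also have "\<dots> = frac_lift K e Z"
      by (rule D.frac_lift_cong[OF K.field_axioms coord_embedding_hom[OF r pY] coord_embedding_inj[OF r pY]
            e_hom e_inj coset Z])
    also have "\<dots> = s Z"
      unfolding e_def by (rule D.embedding_fraction(3)[OF K.field_axioms s_hom s_inj Z])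
    finally show "natural_embedding scl G \<rho> K \<iota> Y p Z = s Z" .
  qed (rule s_ext)
  with r pY show ?thesis by blast
qed

end

theorem theorem1:
  fixes scl :: "complex \<Rightarrow> 'v::ab_group_add \<Rightarrow> 'v"
    and Basis :: "'v set"
    and G :: "(complex^'m^'m) set"
    and \<rho> :: "complex^'m^'m \<Rightarrow> 'v \<Rightarrow> 'v"
    and K :: "'k ring"
    and \<iota> :: "'v rat_fun \<Rightarrow> 'k"
    and Y :: "'v set"
  assumes V: "finite_dimensional_vector_space scl Basis"
    and G: "reductive_group G"
    and rep: "rational_representation scl G \<rho>"
    and frac: "carrier (inv_field scl G \<rho>) =
      {fraction (coord_ring scl) a b | a b.
         a \<in> carrier (inv_ring scl G \<rho>) \<and>
         b \<in> carrier (inv_ring scl G \<rho>) - {\<zero>\<^bsub>coord_ring scl\<^esub>}}"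
    and incl: "\<iota> \<in> ring_hom (inv_field scl G \<rho>) K"
    and K: "algebraic_closure K (\<iota> ` carrier (inv_field scl G \<rho>))"
    and Y: "extension_subvariety scl G \<rho> K \<iota> Y"
  shows "bij_betw (natural_embedding scl G \<rho> K \<iota> Y)
    {p. closed_point scl G \<rho> K \<iota> p \<and> point_subvariety scl G \<rho> K \<iota> p = Y}
    (K_embeddings scl G \<rho> K \<iota> Y)"
proof -
  interpret K: algebraic_closure K "\<iota> ` carrier (inv_field scl G \<rho>)" by (rule K)
  interpret extension_data scl Basis G \<rho> K \<iota>
    by (rule extension_data.intro[OF V frac incl K.algebraically_closed_axioms])
  \<comment> \<open>Surjectivity has to start from a point over \<open>Y\<close>: through
    \<open>p0\<close> it is known that \<complex>[Y] is a domain before any point is built from an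
    embedding.\<close>
  obtain p0 where "closed_point scl G \<rho> K \<iota> p0" and p0: "point_subvariety scl G \<rho> K \<iota> p0 = Y"
    using Y unfolding extension_subvariety_def by blast
  then obtain \<eta>0 where r0: "residue_hom p0 \<eta>0" using closed_point_residue_hom by blast
  have closed_iff: "closed_point scl G \<rho> K \<iota> p \<longleftrightarrow> (\<exists>\<eta>. residue_hom p \<eta>)" for p
    using closed_point_residue_hom residue_hom_closed_point by blast
  show ?thesis
    unfolding bij_betw_def
  proof
    show "inj_on (natural_embedding scl G \<rho> K \<iota> Y)
        {p. closed_point scl G \<rho> K \<iota> p \<and> point_subvariety scl G \<rho> K \<iota> p = Y}"
      unfolding inj_on_def closed_iff using natural_embedding_determines_point by blast
    show "natural_embedding scl G \<rho> K \<iota> Y ` {p. closed_point scl G \<rho> K \<iota> p \<and> point_subvariety scl G \<rho> K \<iota> p = Y}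
        = K_embeddings scl G \<rho> K \<iota> Y"
    proof
      show "natural_embedding scl G \<rho> K \<iota> Y ` {p. closed_point scl G \<rho> K \<iota> p \<and> point_subvariety scl G \<rho> K \<iota> p = Y}
          \<subseteq> K_embeddings scl G \<rho> K \<iota> Y"
        unfolding closed_iff using natural_embedding_in_K_embeddings by blast
      show "K_embeddings scl G \<rho> K \<iota> Y \<subseteq>
          natural_embedding scl G \<rho> K \<iota> Y ` {p. closed_point scl G \<rho> K \<iota> p \<and> point_subvariety scl G \<rho> K \<iota> p = Y}"
        unfolding closed_iff using embedding_is_natural[OF r0 p0] by blast
    qed
  qed
qed

end
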